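(* Let $(M,\alpha)$ be a closed $(2n-1)$-dimensional contact manifold with a nondegenerate contact form $\alpha$. Fix one coefficient ring $\mathbb{Q}[H_2(M,\mathbb{Z})/\mathcal{R}]$, used for all the homologies below. Then the following statements are equivalent (where "vanishes" means that the homology of the indicated differential graded algebra is zero): (i) the contact homology $H_*(\mathcal{A}_{CH},\partial)$ (without marked points) of $(M,\alpha)$ vanishes; (ii) the rational SFT $H_*(\mathcal{A}_{rSFT},d^{\mathbf h})$ (without marked points) of $(M,\alpha)$ vanishes; (iii) the SFT $H_*(\mathcal{A}_{SFT},d^{\mathbf H})$ (without marked points) of $(M,\alpha)$ vanishes; (iv) the contact homology with marked points $H_*(\mathcal{A}_{CH}^*,\partial^* )$ of $(M,\alpha)$ vanishes; (v) the rational SFT with marked points $H_*(\mathcal{A}_{rSFT}^*,\partial^* )$ of $(M,\alpha)$ vanishes; (vi) the SFT with marked points $H_*(\mathcal{A}_{SFT}^*,\partial^* )$ of $(M,\alpha)$ vanishes.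
   Context: **Differential graded algebras.** A differential graded algebra $(\mathcal{A},\partial)$ is a graded unital algebra with a map $\partial:\mathcal{A}_*\to\mathcal{A}_{*-1}$ such that $\partial^2=0$ and $\partial(ab)=(\partial a)b+(-1)^{|a|}a\,\partial b$. **Reeb orbits.** Let $\xi=\ker\alpha$. The Reeb field $R_\alpha$ is given by $\alpha(R_\alpha)=1$, $i_{R_\alpha}d\alpha=0$. The form $\alpha$ is nondegenerate if no closed Reeb orbit (multiple covers included) has a linearized Poincaré return map with eigenvalue $1$. Then there are countably many closed orbits; order them as $\gamma_1,\gamma_2,\dots$ (multiple covers are listed as separate orbits). $T(\gamma)$ is the period, $\kappa_\gamma$ the multiplicity; a base point is fixed on each orbit. For a sequence $I=(i_k)_k$ of nonnegative integers with finitely many nonzero entries, $\boldsymbol\gamma^I$ is the tuple in which $\gamma_k$ appears $i_k$ times, $|I|=\sum_k i_k$, $C(I)=\prod_k i_k!\,\kappa_{\gamma_k}^{i_k}$, and $\mathbf{0}$ is the zero sequence. Conley–Zehnder indices $\mathrm{CZ}(\gamma)$ are computed as follows: fix closed paths representing a basis of $H_1(M,\mathbb{Z})$ and trivializations of $\xi$ along them; for each $\gamma$ choose a surface $S_\gamma$ bounding $\gamma$ and the combination of these paths representing $[\gamma]$, and extend the trivialization over $S_\gamma$ to $\gamma$ (if $H_1(M,\mathbb{Z})$ has torsion, the standard modification of Eliashberg–Givental–Hofer is used). **Holomorphic curves.** On $\mathbb{R}\times M$ (coordinate $t$ on $\mathbb{R}$) let $J$ be the $\mathbb{R}$-invariant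 almost complex structure with $J\partial_t=R_\alpha$ which restricts on $\xi$ to a $d\alpha$-compatible complex structure ($d\alpha(\cdot,J\cdot)$ is a metric on $\xi$). Consider closed Riemann surfaces $(\Sigma_g,j)$ of genus $g$ with pairwise distinct positive punctures, negative punctures and $m$ marked points $y_1,\dots,y_m$, with a nonzero tangent vector (asymptotic marker) at each puncture, and maps $\tilde u=(a,u)$ from the punctured surface to $\mathbb{R}\times M$ with $J\circ D\tilde u=D\tilde u\circ j$. In a holomorphic disc chart with polar coordinates $\rho e^{i\vartheta}$ centered at a puncture, with the marker along the positive real axis, one requires, as $\rho\to0$: $a\to+\infty$ and $u(\rho e^{i\vartheta})\to\gamma_k(-T(\gamma_k)\vartheta/2\pi)$ at a positive puncture assigned to $\gamma_k$; $a\to-\infty$ and $u(\rho e^{i\vartheta})\to\gamma_l(T(\gamma_l)\vartheta/2\pi)$ at a negative puncture assigned to $\gamma_l$. $\mathcal{M}^A_{g,m}(\boldsymbol\gamma^{I^-};\boldsymbol\gamma^{I^+},\gamma)$ denotes the space of such maps with negative punctures asymptotic to $\boldsymbol\gamma^{I^-}$, positive punctures asymptotic to $\boldsymbol\gamma^{I^+}$, one additional positive puncture asymptotic to $\gamma$, and such that $u$ glued with suitable surfaces $S_{\gamma_k}$ represents $A\in H_2(M,\mathbb{Z})$. $\mathcal{M}^A_{g,m}(\gamma,\boldsymbol\gamma^{I^-};\boldsymbol\gamma^{I^+})$ is defined in the same way, with the additional puncture asymptotic to $\gamma$ being negative. If $I^+=\mathbf{0}$ we write $(\boldsymbol\gamma^{I};\gamma)$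 for $(\boldsymbol\gamma^{I};\boldsymbol\gamma^{\mathbf 0},\gamma)$. $\widehat{\mathcal{M}}$ is the quotient by biholomorphic reparametrizations preserving punctures, markers and marked points, and by shifts in the $\mathbb{R}$-direction. $\overline{\mathcal{M}}$ is its compactification by holomorphic buildings. The expected dimension of $\widehat{\mathcal{M}}$ is $(n-3)(2-2g-|I^-|-|I^+|-1)-1+2m\pm\mathrm{CZ}(\gamma)+2\langle c_1(\xi)|A\rangle+\sum_j(i_j^+-i_j^-)\mathrm{CZ}(\gamma_j)$, with $+$ if the extra puncture is positive and $-$ if it is negative. **Standing assumption (transversality).** By generic choices and sufficiently small abstract (multivalued) perturbations of the Cauchy–Riemann equation, the spaces $\overline{\mathcal{M}}$ are oriented branched manifolds with rational weights, with boundary and corners, of the expected dimension, carrying evaluation maps $\mathrm{ev}=(u(y_1),\dots,u(y_m))$ to $M^m$; with these choices the operators defined below are well-defined differentials (degree $-1$, square zero). For closed forms $\Theta_1,\dots,\Theta_m$ on $M$ set $\langle n^A_{g,m}(\dots)|(\Theta_1,\dots,\Theta_m)\rangle=\int_{\overline{\mathcal{M}}^A_{g,m}(\dots)}\mathrm{ev}^*(\Theta_1\times\dots\times\Theta_m)$, which is $0$ if $\sum\deg\Theta_j$ is not the dimension of the moduli space. For $m=0$, $n^A_{g,0}(\dots)\in\mathbb{Q}$ is the signed weighted count of the zero-dimensional moduli space ($0$ if the dimension is not zero). **Coefficients and variables.** Choose a submodule $\mathcal{R}\le\{A\in H_2(M,\mathbb{Z}):\langle c_1(\xi)|A\rangle=0\}$.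 The coefficient ring is the group ring $\mathbb{Q}[H_2(M,\mathbb{Z})/\mathcal{R}]$, with elements $\sum_j c_je^{A_j}$ and $|c\,e^A|=-2\langle c_1(\xi)|A\rangle$. For each closed Reeb orbit $\gamma$ there are variables $q_\gamma,p_\gamma$ with $|q_\gamma|=\mathrm{CZ}(\gamma)+n-3$ and $|p_\gamma|=-\mathrm{CZ}(\gamma)+n-3$. Further, $|\hbar|=2(n-3)$. Write $\mathbf{q}^I=\prod_k q_{\gamma_k}^{i_k}$ and $\mathbf{p}^I=\prod_k p_{\gamma_k}^{i_k}$ (ordered products). **Contact homology.** $\mathcal{A}_{CH}$ is the algebra of polynomials in the supercommuting variables $q_\gamma$ over the coefficient ring, with $\partial q_\gamma=\sum_{A,I}\frac{n^A_{0,0}(\boldsymbol\gamma^I;\gamma)}{C(I)}e^A\mathbf{q}^I$ (a finite sum), extended by the graded Leibniz rule. **Rational SFT.** $\mathcal{A}_{rSFT}$ consists of formal power series $\sum_{I^+}f_{I^+}(\mathbf{q})\mathbf{p}^{I^+}$ with $f_{I^+}\in\mathcal{A}_{CH}$, all $q$'s and $p$'s supercommuting. The differential is given by $d^{\mathbf h}q_\gamma=\sum_{A,I^-,I^+}\frac{n^A_{0,0}(\boldsymbol\gamma^{I^-};\boldsymbol\gamma^{I^+},\gamma)}{C(I^-)C(I^+)}e^A\mathbf{q}^{I^-}\mathbf{p}^{I^+}$ and $d^{\mathbf h}p_\gamma=(-1)^{|p_\gamma|+1}\sum_{A,I^-,I^+}\frac{n^A_{0,0}(\gamma,\boldsymbol\gamma^{I^-};\boldsymbol\gamma^{I^+})}{C(I^-)C(I^+)}e^A\mathbf{q}^{I^-}\mathbf{p}^{I^+}$,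 extended by the graded Leibniz rule. **SFT.** $\mathcal{A}_{SFT}$ consists of formal power series $\sum_{g\ge0}\sum_{I^+}f_{g,I^+}(\mathbf{q})\mathbf{p}^{I^+}\hbar^g$ with $f_{g,I^+}\in\mathcal{A}_{CH}$. The $q$'s supercommute among themselves, the $p$'s supercommute among themselves, $\hbar$ is central, and $p_\gamma q_{\gamma'}-(-1)^{|p_\gamma||q_{\gamma'}|}q_{\gamma'}p_\gamma$ equals $\kappa_\gamma\hbar$ if $\gamma=\gamma'$ and $0$ otherwise (i.e. $p_\gamma$ acts as $\kappa_\gamma\hbar\,\partial/\partial q_\gamma$). The differential is given by $d^{\mathbf H}\hbar=0$, $d^{\mathbf H}q_\gamma=\sum_{g,A,I^-,I^+}\frac{n^A_{g,0}(\boldsymbol\gamma^{I^-};\boldsymbol\gamma^{I^+},\gamma)}{C(I^-)C(I^+)}e^A\mathbf{q}^{I^-}\mathbf{p}^{I^+}\hbar^g$ and $d^{\mathbf H}p_\gamma=(-1)^{|p_\gamma|+1}\sum_{g,A,I^-,I^+}\frac{n^A_{g,0}(\gamma,\boldsymbol\gamma^{I^-};\boldsymbol\gamma^{I^+})}{C(I^-)C(I^+)}e^A\mathbf{q}^{I^-}\mathbf{p}^{I^+}\hbar^g$, extended by the graded Leibniz rule. **Marked points.** Let $\Theta^1,\dots,\Theta^d$ be closed forms representing an integral basis of $H^*_{dR}(M)$, and let $t_1,\dots,t_d$ be variables with $|t_j|=\deg\Theta^j-2$. For $\mathcal{A}\in\{\mathcal{A}_{CH},\mathcal{A}_{rSFT},\mathcal{A}_{SFT}\}$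 let $\mathcal{A}^*$ be the algebra of formal power series in $t_1,\dots,t_d$ with coefficients in $\mathcal{A}$, the $t_j$ supercommuting among themselves and with all other variables. Put $\langle n^A_{g,m}(\dots)|(\boldsymbol\Theta,\dots,\boldsymbol\Theta)\rangle=\sum_{1\le a_1,\dots,a_m\le d}\langle n^A_{g,m}(\dots)|(\Theta^{a_1},\dots,\Theta^{a_m})\rangle\,t_{a_1}\cdots t_{a_m}$. Then $\partial^*t_j=0$, $\partial^*\hbar=0$, $\partial^*q_\gamma=\sum_{g,m,A,I^-,I^+}\frac{\langle n^A_{g,m}(\boldsymbol\gamma^{I^-};\boldsymbol\gamma^{I^+},\gamma)|(\boldsymbol\Theta,\dots,\boldsymbol\Theta)\rangle}{m!\,C(I^-)C(I^+)}e^A\mathbf{q}^{I^-}\mathbf{p}^{I^+}\hbar^g$ and $\partial^*p_\gamma=(-1)^{|p_\gamma|+1}\sum_{g,m,A,I^-,I^+}\frac{\langle n^A_{g,m}(\gamma,\boldsymbol\gamma^{I^-};\boldsymbol\gamma^{I^+})|(\boldsymbol\Theta,\dots,\boldsymbol\Theta)\rangle}{m!\,C(I^-)C(I^+)}e^A\mathbf{q}^{I^-}\mathbf{p}^{I^+}\hbar^g$, extended by the graded Leibniz rule. Here only $g=0$, $I^+=\mathbf{0}$ (and no $p$-variables) are used for $\mathcal{A}_{CH}$, only $g=0$ for $\mathcal{A}_{rSFT}$, and all $g\ge0$ and all $I^+$ for $\mathcal{A}_{SFT}$. *)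

theory Defs
  imports
    "HOL-Analysis.Analysis"
    "HOL-Complex_Analysis.Complex_Analysis"
    "HOL-Homology.Homology"
    "HOL-Combinatorics.Permutations"
begin

section \<open>Smooth maps, submanifolds and differential forms\<close>

primrec Ck :: "nat \<Rightarrow> 'a::real_normed_vector set \<Rightarrow> ('a \<Rightarrow> 'b::real_normed_vector) \<Rightarrow> bool" where
  "Ck 0 U f \<longleftrightarrow> continuous_on U f"
| "Ck (Suc k) U f \<longleftrightarrow>
     (\<exists>f'. (\<forall>x\<in>U. (f has_derivative f' x) (at x)) \<and> (\<forall>v. Ck k U (\<lambda>x. f' x v)))"

definition smooth_on :: "'a::real_normed_vector set \<Rightarrow> ('a \<Rightarrow> 'b::real_normed_vector) \<Rightarrow> bool" where
  "smooth_on U f \<longleftrightarrow> open U \<and> (\<forall>k. Ck k U f)"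

text \<open>Closed manifolds are compact submanifolds without boundary of a Euclidean space of arbitrary
  dimension (every closed manifold is of this kind, by Whitney).\<close>

definition submanifold :: "nat \<Rightarrow> 'a::euclidean_space set \<Rightarrow> bool" where
  "submanifold d M \<longleftrightarrow>
     (\<forall>x\<in>M. \<exists>U V \<phi> \<psi> (L :: 'a set). x \<in> U \<and> smooth_on U \<phi> \<and> smooth_on V \<psi> \<and> \<phi> ` U = V \<and> \<psi> ` V = U \<and>
        (\<forall>y\<in>U. \<psi> (\<phi> y) = y) \<and> (\<forall>y\<in>V. \<phi> (\<psi> y) = y) \<and>
        subspace L \<and> dim L = d \<and> \<phi> ` (U \<inter> M) = V \<inter> L)"

definition closed_manifold :: "nat \<Rightarrow> 'a::euclidean_space set \<Rightarrow> bool" where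
  "closed_manifold d M \<longleftrightarrow> compact M \<and> submanifold d M"

definition tangent :: "'a::euclidean_space set \<Rightarrow> 'a \<Rightarrow> 'a set" where
  "tangent M x = {v. \<exists>b. b 0 = x \<and> (\<forall>s::real. b s \<in> M) \<and> (b has_vector_derivative v) (at 0)}"

text \<open>A differential form of degree \<open>k\<close> on \<open>M\<close> is given by a form on a neighbourhood of \<open>M\<close>; only its
  values on tangent vectors of \<open>M\<close> are ever used.\<close>

definition form_on :: "nat \<Rightarrow> 'a::euclidean_space set \<Rightarrow> ('a \<Rightarrow> 'a list \<Rightarrow> real) \<Rightarrow> bool" where
  "form_on k M \<omega> \<longleftrightarrow> (\<exists>U. open U \<and> M \<subseteq> U \<and>
     (\<forall>x\<in>U. \<forall>vs. length vs = k \<longrightarrow>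
        (\<forall>i<k. linear (\<lambda>v. \<omega> x (vs[i := v]))) \<and>
        (\<forall>i<k. \<forall>j<k. i \<noteq> j \<and> vs ! i = vs ! j \<longrightarrow> \<omega> x vs = 0)) \<and>
     (\<forall>vs. length vs = k \<longrightarrow> smooth_on U (\<lambda>x. \<omega> x vs)))"

definition ext_deriv :: "('a::euclidean_space \<Rightarrow> 'a list \<Rightarrow> real) \<Rightarrow> 'a \<Rightarrow> 'a list \<Rightarrow> real" where
  "ext_deriv \<omega> x vs = (\<Sum>i<length vs.
     (-1) ^ i * frechet_derivative (\<lambda>y. \<omega> y (take i vs @ drop (Suc i) vs)) (at x) (vs ! i))"

definition closed_form_on :: "nat \<Rightarrow> 'a::euclidean_space set \<Rightarrow> ('a \<Rightarrow> 'a list \<Rightarrow> real) \<Rightarrow> bool" where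
  "closed_form_on k M \<omega> \<longleftrightarrow> form_on k M \<omega> \<and>
     (\<forall>x\<in>M. \<forall>vs. length vs = Suc k \<and> set vs \<subseteq> tangent M x \<longrightarrow> ext_deriv \<omega> x vs = 0)"

text \<open>\<open>Ckn k d F\<close>: \<open>F\<close> is \<open>k\<close> times continuously differentiable on the Euclidean space of the first \<open>d\<close>
  coordinates.\<close>

definition euc :: "nat \<Rightarrow> (nat \<Rightarrow> real) set" where
  "euc d = {x. \<forall>i\<ge>d. x i = 0}"

primrec Ckn :: "nat \<Rightarrow> nat \<Rightarrow> ((nat \<Rightarrow> real) \<Rightarrow> 'a::real_normed_vector) \<Rightarrow> bool" where
  "Ckn 0 d F \<longleftrightarrow> continuous_on (euc d) F"
| "Ckn (Suc k) d F \<longleftrightarrow> continuous_on (euc d) F \<and>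
     (\<exists>F'. \<forall>i<d. (\<forall>x\<in>euc d. ((\<lambda>s. F (x(i := s))) has_vector_derivative F' i x) (at (x i))) \<and>
        Ckn k d (F' i))"

text \<open>Singular simplices live on \<open>standard_simplex d\<close> (barycentric coordinates); \<open>bary d\<close> is the
  orientation preserving affine parametrization of it by the corner of the unit cube.\<close>

definition corner :: "nat \<Rightarrow> (nat \<Rightarrow> real) set" where
  "corner d = {x. (\<forall>i<d. 0 \<le> x i) \<and> (\<Sum>i<d. x i) \<le> 1}"

definition bary :: "nat \<Rightarrow> (nat \<Rightarrow> real) \<Rightarrow> nat \<Rightarrow> real" where
  "bary d x = (\<lambda>i. if i = 0 then 1 - (\<Sum>j<d. x j) else if i \<le> d then x (i - 1) else 0)"

definition smooth_simplex :: "nat \<Rightarrow> ((nat \<Rightarrow> real) \<Rightarrow> 'a::real_normed_vector) \<Rightarrow> bool" where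
  "smooth_simplex d \<sigma> \<longleftrightarrow> (\<exists>F. (\<forall>k. Ckn k d F) \<and> (\<forall>x\<in>euc d \<inter> corner d. \<sigma> (bary d x) = F x))"

definition simplex_partial :: "nat \<Rightarrow> ((nat \<Rightarrow> real) \<Rightarrow> 'a::real_normed_vector) \<Rightarrow> (nat \<Rightarrow> real) \<Rightarrow> nat \<Rightarrow> 'a" where
  "simplex_partial d \<sigma> x i = vector_derivative (\<lambda>s. \<sigma> (bary d (x(i := s)))) (at (x i))"

text \<open>Integral of the pullback of the exterior product \<open>\<omega>\<^sub>0 \<times> \<dots> \<times> \<omega>\<^sub>m\<^sub>-\<^sub>1\<close> (\<open>\<omega>\<^sub>j\<close> of degree \<open>k j\<close>) under the
  map \<open>(\<sigma>\<^sub>0, \<dots>, \<sigma>\<^sub>m\<^sub>-\<^sub>1)\<close> from the simplex of dimension \<open>k 0 + \<dots> + k (m - 1)\<close>.\<close>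

definition simplex_integral ::
  "nat \<Rightarrow> (nat \<Rightarrow> nat) \<Rightarrow> (nat \<Rightarrow> 'a::euclidean_space \<Rightarrow> 'a list \<Rightarrow> real) \<Rightarrow> (nat \<Rightarrow> (nat \<Rightarrow> real) \<Rightarrow> 'a) \<Rightarrow> real" where
  "simplex_integral m k \<omega> \<sigma> = (let d = (\<Sum>j<m. k j) in
     integral\<^sup>L (Pi\<^sub>M {..<d} (\<lambda>_. lborel)) (\<lambda>x. indicat_real (corner d) x *
       ((\<Sum>\<pi> | \<pi> permutes {..<d}. of_int (sign \<pi>) *
           (\<Prod>j<m. \<omega> j (\<sigma> j (bary d x))
              (map (\<lambda>i. simplex_partial d (\<sigma> j) x (\<pi> ((\<Sum>l<j. k l) + i))) [0..<k j]))) /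
        (\<Prod>j<m. fact (k j)))))"

definition chain_integral :: "nat \<Rightarrow> ('a::euclidean_space \<Rightarrow> 'a list \<Rightarrow> real) \<Rightarrow> 'a chain \<Rightarrow> real" where
  "chain_integral k \<omega> z = (\<Sum>\<sigma>\<in>Poly_Mapping.keys z.
     of_int (Poly_Mapping.lookup z \<sigma>) * simplex_integral 1 (\<lambda>_. k) (\<lambda>_. \<omega>) (\<lambda>_. \<sigma>))"

definition integral_periods :: "nat \<Rightarrow> 'a::euclidean_space set \<Rightarrow> ('a \<Rightarrow> 'a list \<Rightarrow> real) \<Rightarrow> bool" where
  "integral_periods k M \<omega> \<longleftrightarrow>
     (\<forall>z. singular_relcycle k (top_of_set M) {} z \<and> (\<forall>\<sigma>\<in>Poly_Mapping.keys z. smooth_simplex k \<sigma>) \<longrightarrow>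
        chain_integral k \<omega> z \<in> \<int>)"

text \<open>\<open>\<Theta> 0, \<dots>, \<Theta> (N - 1)\<close> represent a basis of the lattice of integral classes in de Rham cohomology,
  i.e. of the classes of closed forms with integral periods.\<close>

definition integral_basis ::
  "'a::euclidean_space set \<Rightarrow> nat \<Rightarrow> (nat \<Rightarrow> nat) \<Rightarrow> (nat \<Rightarrow> 'a \<Rightarrow> 'a list \<Rightarrow> real) \<Rightarrow> bool" where
  "integral_basis M N dg \<Theta> \<longleftrightarrow>
     (\<forall>j<N. closed_form_on (dg j) M (\<Theta> j) \<and> integral_periods (dg j) M (\<Theta> j)) \<and>
     (\<forall>k \<omega>. closed_form_on k M \<omega> \<and> integral_periods k M \<omega> \<longrightarrow>
        (\<exists>!c :: nat \<Rightarrow> int. (\<forall>j. \<not> (j < N \<and> dg j = k) \<longrightarrow> c j = 0) \<and>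
           (\<exists>\<eta>. (0 < k \<longrightarrow> form_on (k - 1) M \<eta>) \<and>
              (\<forall>x\<in>M. \<forall>vs. length vs = k \<and> set vs \<subseteq> tangent M x \<longrightarrow>
                 \<omega> x vs - (\<Sum>j<N. if dg j = k then of_int (c j) * \<Theta> j x vs else 0) =
                 (if k = 0 then 0 else ext_deriv \<eta> x vs)))))"


section \<open>The Conley--Zehnder index of a path of symplectic matrices\<close>

text \<open>Real \<open>2m \<times> 2m\<close> matrices are functions on pairs of indices \<open>< 2 * m\<close>; coordinates are
  \<open>(x\<^sub>1, \<dots>, x\<^sub>m, y\<^sub>1, \<dots>, y\<^sub>m)\<close>.\<close>

definition omega0 :: "nat \<Rightarrow> (nat \<Rightarrow> real) \<Rightarrow> (nat \<Rightarrow> real) \<Rightarrow> real" where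
  "omega0 m v w = (\<Sum>i<m. v i * w (m + i) - v (m + i) * w i)"

definition mat_vec :: "nat \<Rightarrow> (nat \<Rightarrow> nat \<Rightarrow> real) \<Rightarrow> (nat \<Rightarrow> real) \<Rightarrow> nat \<Rightarrow> real" where
  "mat_vec m A v = (\<lambda>i. if i < 2 * m then \<Sum>j<2 * m. A i j * v j else 0)"

definition symplectic :: "nat \<Rightarrow> (nat \<Rightarrow> nat \<Rightarrow> real) \<Rightarrow> bool" where
  "symplectic m A \<longleftrightarrow> (\<forall>v w. omega0 m (mat_vec m A v) (mat_vec m A w) = omega0 m v w)"

definition fixed_vectors :: "nat \<Rightarrow> (nat \<Rightarrow> nat \<Rightarrow> real) \<Rightarrow> (nat \<Rightarrow> real) set" where
  "fixed_vectors m A = {v. mat_vec m A v = v}"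

definition pos_index :: "(nat \<Rightarrow> real) set \<Rightarrow> ((nat \<Rightarrow> real) \<Rightarrow> real) \<Rightarrow> nat" where
  "pos_index K q = Max {r. \<exists>b. (\<forall>i<r. b i \<in> K) \<and>
     (\<forall>c :: nat \<Rightarrow> real. (\<exists>i<r. c i \<noteq> 0) \<longrightarrow> 0 < q (\<lambda>j. \<Sum>i<r. c i * b i j))}"

definition signature :: "(nat \<Rightarrow> real) set \<Rightarrow> ((nat \<Rightarrow> real) \<Rightarrow> real) \<Rightarrow> int" where
  "signature K q = int (pos_index K q) - int (pos_index K (\<lambda>v. - q v))"

text \<open>Robbin--Salamon: make all crossings regular by a homotopy with fixed end points; the crossing
  form at \<open>t\<close> is \<open>v \<mapsto> \<omega>\<^sub>0(v, \<Psi>'(t) v)\<close> on the kernel of \<open>\<Psi>(t) - 1\<close>.  With this normalization the path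
  \<open>t \<mapsto> exp(i\<theta>t)\<close>, \<open>0 < \<theta> < 2\<pi>\<close>, has index \<open>1\<close>.\<close>

definition cz_path :: "nat \<Rightarrow> (real \<Rightarrow> nat \<Rightarrow> nat \<Rightarrow> real) \<Rightarrow> int" where
  "cz_path m \<Phi> = (THE k. \<exists>\<Psi> \<Psi>' H C.
     (\<forall>i<2 * m. \<forall>j<2 * m.
        continuous_on ({0..1} \<times> {0..1}) (\<lambda>(s, t). H s t i j) \<and>
        (\<forall>t\<in>{0..1}. H 0 t i j = \<Phi> t i j \<and> H 1 t i j = \<Psi> t i j) \<and>
        (\<forall>s\<in>{0..1::real}. H s 0 i j = (if i = j then 1 else 0) \<and> H s 1 i j = \<Phi> 1 i j) \<and>
        (\<forall>t\<in>{0..1::real}. ((\<lambda>t. \<Psi> t i j) has_real_derivative \<Psi>' t i j) (at t within {0..1})) \<and>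
        continuous_on {0..1} (\<lambda>t. \<Psi>' t i j)) \<and>
     (\<forall>s\<in>{0..1}. \<forall>t\<in>{0..1}. symplectic m (H s t)) \<and>
     C = {t\<in>{0..1}. \<exists>v\<in>fixed_vectors m (\<Psi> t). \<exists>i. v i \<noteq> 0} \<and> finite C \<and>
     (\<forall>t\<in>C. \<forall>v\<in>fixed_vectors m (\<Psi> t). (\<exists>i. v i \<noteq> 0) \<longrightarrow>
        (\<exists>w\<in>fixed_vectors m (\<Psi> t). omega0 m v (mat_vec m (\<Psi>' t) w) \<noteq> 0)) \<and>
     real_of_int k =
       (let sig = (\<lambda>t. real_of_int (signature (fixed_vectors m (\<Psi> t)) (\<lambda>v. omega0 m v (mat_vec m (\<Psi>' t) v))))
        in sig 0 / 2 + (\<Sum>t\<in>C \<inter> {0<..<1}. sig t)))"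


section \<open>The data defining the differential graded algebras\<close>

text \<open>Sequences \<open>I\<close> of nonnegative integers with finitely many nonzero entries.\<close>
type_synonym mindex = "nat \<Rightarrow>\<^sub>0 nat"

text \<open>\<open>W p \<sigma> x i\<close> is the \<open>i\<close>-th vector of a frame over the point \<open>x\<close> of the singular \<open>p\<close>-simplex \<open>\<sigma>\<close>.\<close>
type_synonym 'a frames = "nat \<Rightarrow> ((nat \<Rightarrow> real) \<Rightarrow> 'a) \<Rightarrow> (nat \<Rightarrow> real) \<Rightarrow> nat \<Rightarrow> 'a"

text \<open>A compact oriented weighted branched manifold of dimension \<open>d\<close> with boundary and corners and an
  evaluation map to \<open>M\<^sup>m\<close>, in terms of a triangulation: the list of its top-dimensional cells, each with
  its rational weight (negated where the parametrization reverses the orientation) and the \<open>m\<close> components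
  of the evaluation map on it.  Dimension and smoothness are imposed in \<open>transversality\<close>.\<close>
type_synonym 'a branched = "(rat \<times> (nat \<Rightarrow> (nat \<Rightarrow> real) \<Rightarrow> 'a)) list"

record 'a sft_data =
  mfd :: "'a set"                          \<comment> \<open>\<open>M\<close>\<close>
  hdim :: nat                              \<comment> \<open>\<open>n\<close>, where \<open>dim M = 2n - 1\<close>\<close>
  cform :: "'a \<Rightarrow> 'a \<Rightarrow> real"             \<comment> \<open>\<open>\<alpha>\<close>\<close>
  reeb :: "'a \<Rightarrow> 'a"                      \<comment> \<open>\<open>R\<^sub>\<alpha>\<close>\<close>
  acs :: "'a \<Rightarrow> 'a \<Rightarrow> 'a"                 \<comment> \<open>\<open>J\<close> on \<open>\<xi>\<close>\<close>
  orbs :: "nat set"                        \<comment> \<open>index set of the closed orbits\<close>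
  orb :: "nat \<Rightarrow> real \<Rightarrow> 'a"              \<comment> \<open>\<open>\<gamma>\<^sub>k\<close>, with base point \<open>\<gamma>\<^sub>k(0)\<close>\<close>
  period :: "nat \<Rightarrow> real"                 \<comment> \<open>\<open>T(\<gamma>\<^sub>k)\<close>\<close>
  nloop :: nat                             \<comment> \<open>number of generators of \<open>H\<^sub>1\<close>\<close>
  hloop :: "nat \<Rightarrow> real \<Rightarrow> 'a"            \<comment> \<open>closed paths representing them\<close>
  tors :: "nat \<Rightarrow> nat"                    \<comment> \<open>their orders, \<open>0\<close> if infinite\<close>
  hframe :: "nat \<Rightarrow> (nat \<Rightarrow> real) \<Rightarrow> nat \<Rightarrow> 'a"  \<comment> \<open>trivializations of \<open>\<xi>\<close> along them\<close>
  tchain :: "nat \<Rightarrow> 'a chain"             \<comment> \<open>surface bounding the multiple \<open>tors i\<close> of path \<open>i\<close>\<close>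
  capcoef :: "nat \<Rightarrow> nat \<Rightarrow> int"          \<comment> \<open>coordinates of \<open>[\<gamma>\<^sub>k]\<close> in \<open>H\<^sub>1\<close>\<close>
  cap :: "nat \<Rightarrow> 'a chain"                \<comment> \<open>the surface of \<open>\<gamma>\<^sub>k\<close>\<close>
  capframe :: "nat \<Rightarrow> 'a frames"          \<comment> \<open>extended trivialization over \<open>cap k\<close>\<close>
  nform :: nat                             \<comment> \<open>number of forms \<open>\<Theta>\<close>\<close>
  tdeg :: "nat \<Rightarrow> nat"
  theta :: "nat \<Rightarrow> 'a \<Rightarrow> 'a list \<Rightarrow> real"
  rels :: "'a chain set set"               \<comment> \<open>the submodule of \<open>H\<^sub>2(M, \<int>)\<close>\<close>
  moduli :: "bool \<Rightarrow> nat \<Rightarrow> nat \<Rightarrow> 'a chain set \<Rightarrow> mindex \<Rightarrow> mindex \<Rightarrow> nat \<Rightarrow> 'a branched"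
    \<comment> \<open>\<open>moduli True g m A I J k\<close> is the perturbed compactified moduli space with negative orbits \<open>I\<close>,
       positive orbits \<open>J\<close> and the extra positive orbit \<open>k\<close>; with \<open>False\<close> the extra orbit is negative\<close>


section \<open>Contact manifolds and closed Reeb orbits\<close>

definition dcform :: "('a::euclidean_space, 'b) sft_data_scheme \<Rightarrow> 'a \<Rightarrow> 'a \<Rightarrow> 'a \<Rightarrow> real" where
  "dcform D x v w =
     frechet_derivative (\<lambda>y. cform D y w) (at x) v - frechet_derivative (\<lambda>y. cform D y v) (at x) w"

definition contact_plane :: "('a::euclidean_space, 'b) sft_data_scheme \<Rightarrow> 'a \<Rightarrow> 'a set" where
  "contact_plane D x = {v \<in> tangent (mfd D) x. cform D x v = 0}"

text \<open>The last condition is \<open>\<alpha> \<and> (d\<alpha>)\<^sup>n\<^sup>-\<^sup>1 \<noteq> 0\<close>, written out up to a positive factor.\<close>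

definition contact_manifold :: "('a::euclidean_space, 'b) sft_data_scheme \<Rightarrow> bool" where
  "contact_manifold D \<longleftrightarrow> 1 \<le> hdim D \<and> closed_manifold (2 * hdim D - 1) (mfd D) \<and>
     (\<exists>U. open U \<and> mfd D \<subseteq> U \<and> (\<forall>x\<in>U. linear (cform D x)) \<and> (\<forall>v. smooth_on U (\<lambda>x. cform D x v))) \<and>
     (\<forall>x\<in>mfd D. \<exists>v. (\<forall>i<2 * hdim D - 1. v i \<in> tangent (mfd D) x) \<and>
        (\<Sum>\<pi> | \<pi> permutes {..<2 * hdim D - 1}. of_int (sign \<pi>) * cform D x (v (\<pi> 0)) *
           (\<Prod>i<hdim D - 1. dcform D x (v (\<pi> (2 * i + 1))) (v (\<pi> (2 * i + 2))))) \<noteq> 0)"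

definition reeb_field :: "('a::euclidean_space, 'b) sft_data_scheme \<Rightarrow> bool" where
  "reeb_field D \<longleftrightarrow> (\<forall>x\<in>mfd D. reeb D x \<in> tangent (mfd D) x \<and> cform D x (reeb D x) = 1 \<and>
     (\<forall>w\<in>tangent (mfd D) x. dcform D x (reeb D x) w = 0))"

definition flow_line :: "('a::euclidean_space, 'b) sft_data_scheme \<Rightarrow> (real \<Rightarrow> 'a) \<Rightarrow> bool" where
  "flow_line D c \<longleftrightarrow> (\<forall>s. c s \<in> mfd D \<and> (c has_vector_derivative reeb D (c s)) (at s))"

definition reeb_flow :: "('a::euclidean_space, 'b) sft_data_scheme \<Rightarrow> real \<Rightarrow> 'a \<Rightarrow> 'a" where
  "reeb_flow D t x = (THE y. \<exists>c. flow_line D c \<and> c 0 = x \<and> c t = y)"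

definition reeb_flow_deriv :: "('a::euclidean_space, 'b) sft_data_scheme \<Rightarrow> real \<Rightarrow> 'a \<Rightarrow> 'a \<Rightarrow> 'a" where
  "reeb_flow_deriv D t x v = (THE w. \<exists>b. b 0 = x \<and> (\<forall>s::real. b s \<in> mfd D) \<and>
     (b has_vector_derivative v) (at 0) \<and> ((\<lambda>s. reeb_flow D t (b s)) has_vector_derivative w) (at 0))"

definition closed_orbit :: "('a::euclidean_space, 'b) sft_data_scheme \<Rightarrow> (real \<Rightarrow> 'a) \<Rightarrow> real \<Rightarrow> bool" where
  "closed_orbit D c T \<longleftrightarrow> 0 < T \<and> flow_line D c \<and> (\<forall>s. c (s + T) = c s)"

definition nondegenerate :: "('a::euclidean_space, 'b) sft_data_scheme \<Rightarrow> bool" where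
  "nondegenerate D \<longleftrightarrow> (\<forall>c T. closed_orbit D c T \<longrightarrow>
     \<not> (\<exists>v\<in>contact_plane D (c 0). v \<noteq> 0 \<and> reeb_flow_deriv D T (c 0) v = v))"

text \<open>Every closed orbit, up to a shift of its parametrization, is listed exactly once; multiple covers
  are distinguished by their periods.\<close>

definition orbit_enumeration :: "('a::euclidean_space, 'b) sft_data_scheme \<Rightarrow> bool" where
  "orbit_enumeration D \<longleftrightarrow> (orbs D = UNIV \<or> (\<exists>N. orbs D = {..<N})) \<and>
     (\<forall>k\<in>orbs D. closed_orbit D (orb D k) (period D k)) \<and>
     (\<forall>c T. closed_orbit D c T \<longrightarrow>
        (\<exists>!k. k \<in> orbs D \<and> period D k = T \<and> (\<exists>s0. \<forall>s. c s = orb D k (s + s0))))"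

definition multiplicity_of :: "('a::euclidean_space, 'b) sft_data_scheme \<Rightarrow> nat \<Rightarrow> nat" where
  "multiplicity_of D k =
     (GREATEST m. 0 < m \<and> (\<forall>s. orb D k (s + period D k / real m) = orb D k s))"

definition compatible_acs :: "('a::euclidean_space, 'b) sft_data_scheme \<Rightarrow> bool" where
  "compatible_acs D \<longleftrightarrow>
     (\<exists>U. open U \<and> mfd D \<subseteq> U \<and> (\<forall>x\<in>U. linear (acs D x)) \<and> (\<forall>v. smooth_on U (\<lambda>x. acs D x v))) \<and>
     (\<forall>x\<in>mfd D. \<forall>v\<in>contact_plane D x.
        acs D x v \<in> contact_plane D x \<and> acs D x (acs D x v) = - v \<and>
        (v \<noteq> 0 \<longrightarrow> 0 < dcform D x v (acs D x v)) \<and>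
        (\<forall>w\<in>contact_plane D x. dcform D x v (acs D x w) = dcform D x w (acs D x v)))"

text \<open>The \<open>\<real>\<close>-invariant almost complex structure on \<open>\<real> \<times> M\<close>.\<close>

definition symplectization_acs ::
  "('a::euclidean_space, 'b) sft_data_scheme \<Rightarrow> 'a \<Rightarrow> real \<times> 'a \<Rightarrow> real \<times> 'a" where
  "symplectization_acs D x = (\<lambda>(s, v).
     (- cform D x v, s *\<^sub>R reeb D x + acs D x (v - cform D x v *\<^sub>R reeb D x)))"


section \<open>Trivializations, Chern numbers and Conley--Zehnder indices\<close>

definition unitary_frame :: "('a::euclidean_space, 'b) sft_data_scheme \<Rightarrow> 'a \<Rightarrow> (nat \<Rightarrow> 'a) \<Rightarrow> bool" where
  "unitary_frame D x e \<longleftrightarrow> (\<forall>i<hdim D - 1. e i \<in> contact_plane D x \<and>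
     (\<forall>j<hdim D - 1. dcform D x (e i) (acs D x (e j)) = (if i = j then 1 else 0) \<and>
        dcform D x (e i) (e j) = 0))"

text \<open>Determinant of the complex matrix expressing the unitary frame \<open>f\<close> in terms of \<open>e\<close>.\<close>

definition frame_det :: "('a::euclidean_space, 'b) sft_data_scheme \<Rightarrow> 'a \<Rightarrow> (nat \<Rightarrow> 'a) \<Rightarrow> (nat \<Rightarrow> 'a) \<Rightarrow> complex" where
  "frame_det D x e f = (\<Sum>\<pi> | \<pi> permutes {..<hdim D - 1}. of_int (sign \<pi>) *
     (\<Prod>j<hdim D - 1. Complex (dcform D x (f j) (acs D x (e (\<pi> j)))) (dcform D x (e (\<pi> j)) (f j))))"

definition trivialization ::
  "('a::euclidean_space, 'b) sft_data_scheme \<Rightarrow> nat \<Rightarrow> ((nat \<Rightarrow> real) \<Rightarrow> 'a) \<Rightarrow> ((nat \<Rightarrow> real) \<Rightarrow> nat \<Rightarrow> 'a) \<Rightarrow> bool" where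
  "trivialization D p \<sigma> f \<longleftrightarrow> (\<forall>x\<in>standard_simplex p. unitary_frame D (\<sigma> x) (f x)) \<and>
     (\<forall>i<hdim D - 1. continuous_on (standard_simplex p) (\<lambda>x. f x i))"

definition edge :: "real \<Rightarrow> nat \<Rightarrow> real" where
  "edge t = (\<lambda>i. if i = 0 then 1 - t else if i = 1 then t else 0)"

definition loop_simplex :: "(real \<Rightarrow> 'a) \<Rightarrow> (nat \<Rightarrow> real) \<Rightarrow> 'a" where
  "loop_simplex c = restrict (\<lambda>x. c (x 1)) (standard_simplex 1)"

text \<open>Trivializations over the edges of a 2-chain which agree at common vertices.\<close>

definition edge_frames :: "('a::euclidean_space, 'b) sft_data_scheme \<Rightarrow> 'a chain \<Rightarrow> 'a frames \<Rightarrow> bool" where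
  "edge_frames D z W \<longleftrightarrow> (\<forall>\<sigma>\<in>Poly_Mapping.keys z. \<forall>k\<le>2.
     trivialization D 1 (singular_face 2 k \<sigma>) (W 1 (singular_face 2 k \<sigma>)) \<and>
     (\<forall>l\<le>1. \<forall>x\<in>standard_simplex 0. \<forall>i<hdim D - 1.
        W 0 (singular_face 1 l (singular_face 2 k \<sigma>)) x i = W 1 (singular_face 2 k \<sigma>) (simplical_face l x) i))"

text \<open>A trivialization over the surface given by the 2-chain \<open>z\<close>.\<close>

definition surface_frames :: "('a::euclidean_space, 'b) sft_data_scheme \<Rightarrow> 'a chain \<Rightarrow> 'a frames \<Rightarrow> bool" where
  "surface_frames D z W \<longleftrightarrow> edge_frames D z W \<and> (\<forall>\<sigma>\<in>Poly_Mapping.keys z.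
     trivialization D 2 \<sigma> (W 2 \<sigma>) \<and>
     (\<forall>k\<le>2. \<forall>x\<in>standard_simplex 1. \<forall>i<hdim D - 1.
        W 2 \<sigma> (simplical_face k x) i = W 1 (singular_face 2 k \<sigma>) x i))"

text \<open>The first Chern class as the obstruction to extending the section of the determinant bundle of \<open>\<xi>\<close>
  given by \<open>W\<close> on the edges over the triangles: the sum of its winding numbers around the triangles,
  measured in trivializations \<open>G\<close> over the triangles.\<close>

definition chern_sum ::
  "('a::euclidean_space, 'b) sft_data_scheme \<Rightarrow> 'a chain \<Rightarrow> 'a frames \<Rightarrow>
   (((nat \<Rightarrow> real) \<Rightarrow> 'a) \<Rightarrow> (nat \<Rightarrow> real) \<Rightarrow> nat \<Rightarrow> 'a) \<Rightarrow> real" where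
  "chern_sum D z W G = (\<Sum>\<sigma>\<in>Poly_Mapping.keys z. of_int (Poly_Mapping.lookup z \<sigma>) *
     (let p = (\<lambda>k t. frame_det D (singular_face 2 k \<sigma> (edge t))
                 (G \<sigma> (simplical_face k (edge t))) (W 1 (singular_face 2 k \<sigma>) (edge t)))
      in Re (winding_number (p 2 +++ p 0 +++ reversepath (p 1)) 0)))"

definition chern :: "('a::euclidean_space, 'b) sft_data_scheme \<Rightarrow> 'a chain set \<Rightarrow> int" where
  "chern D A = (THE k. \<exists>z W G. singular_relcycle 2 (top_of_set (mfd D)) {} z \<and>
     A = homologous_rel_set 2 (top_of_set (mfd D)) {} z \<and> edge_frames D z W \<and>
     (\<forall>\<sigma>\<in>Poly_Mapping.keys z. trivialization D 2 \<sigma> (G \<sigma>)) \<and> of_int k = chern_sum D z W G)"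

text \<open>Relative Chern number of the surface \<open>tchain D i\<close> with respect to \<open>hframe D i\<close> on its boundary.\<close>

definition tors_chern :: "('a::euclidean_space, 'b) sft_data_scheme \<Rightarrow> nat \<Rightarrow> int" where
  "tors_chern D i = (THE k. \<exists>W G. edge_frames D (tchain D i) W \<and>
     (\<forall>x\<in>standard_simplex 1. \<forall>j<hdim D - 1. W 1 (loop_simplex (hloop D i)) x j = hframe D i x j) \<and>
     (\<forall>\<sigma>\<in>Poly_Mapping.keys (tchain D i). trivialization D 2 \<sigma> (G \<sigma>)) \<and>
     of_int k = chern_sum D (tchain D i) W G)"

definition loop_combination :: "('a::euclidean_space, 'b) sft_data_scheme \<Rightarrow> (nat \<Rightarrow> int) \<Rightarrow> 'a chain" where
  "loop_combination D a = (\<Sum>i<nloop D. frag_cmul (a i) (frag_of (loop_simplex (hloop D i))))"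

definition orbit_simplex :: "('a::euclidean_space, 'b) sft_data_scheme \<Rightarrow> nat \<Rightarrow> (nat \<Rightarrow> real) \<Rightarrow> 'a" where
  "orbit_simplex D k = loop_simplex (\<lambda>t. orb D k (period D k * t))"

definition normal_coefs :: "('a::euclidean_space, 'b) sft_data_scheme \<Rightarrow> (nat \<Rightarrow> int) \<Rightarrow> bool" where
  "normal_coefs D a \<longleftrightarrow>
     (\<forall>i. (nloop D \<le> i \<longrightarrow> a i = 0) \<and> (0 < tors D i \<longrightarrow> 0 \<le> a i \<and> a i < int (tors D i)))"

text \<open>Paths generating \<open>H\<^sub>1(M, \<int>)\<close> as a direct sum of cyclic groups of orders \<open>tors\<close> (a basis if there is
  no torsion), and surfaces bounding each closed orbit together with the combination of these paths
  representing its class.\<close>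

definition cz_choices :: "('a::euclidean_space, 'b) sft_data_scheme \<Rightarrow> bool" where
  "cz_choices D \<longleftrightarrow>
     (\<forall>i<nloop D. continuous_on {0..1} (hloop D i) \<and> hloop D i ` {0..1} \<subseteq> mfd D \<and> hloop D i 0 = hloop D i 1 \<and>
        trivialization D 1 (loop_simplex (hloop D i)) (hframe D i) \<and>
        (\<forall>j<hdim D - 1. hframe D i (edge 0) j = hframe D i (edge 1) j) \<and>
        tors D i \<noteq> 1 \<and>
        (0 < tors D i \<longrightarrow> singular_chain 2 (top_of_set (mfd D)) (tchain D i) \<and>
           chain_boundary 2 (tchain D i) = frag_cmul (int (tors D i)) (frag_of (loop_simplex (hloop D i))))) \<and>
     (\<forall>h\<in>carrier (homology_group 1 (top_of_set (mfd D))). \<exists>!a. normal_coefs D a \<and>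
        h = homologous_rel_set 1 (top_of_set (mfd D)) {} (loop_combination D a)) \<and>
     (\<forall>k\<in>orbs D. normal_coefs D (capcoef D k) \<and> singular_chain 2 (top_of_set (mfd D)) (cap D k) \<and>
        chain_boundary 2 (cap D k) = frag_of (orbit_simplex D k) - loop_combination D (capcoef D k) \<and>
        surface_frames D (cap D k) (capframe D k) \<and>
        trivialization D 1 (orbit_simplex D k) (capframe D k 1 (orbit_simplex D k)) \<and>
        (\<forall>j<hdim D - 1. capframe D k 1 (orbit_simplex D k) (edge 0) j = capframe D k 1 (orbit_simplex D k) (edge 1) j) \<and>
        (\<forall>i<nloop D. \<forall>x\<in>standard_simplex 1. \<forall>j<hdim D - 1.
           capframe D k 1 (loop_simplex (hloop D i)) x j = hframe D i x j))"

text \<open>The symplectic basis \<open>e\<^sub>1, \<dots>, e\<^sub>n\<^sub>-\<^sub>1, Je\<^sub>1, \<dots>, Je\<^sub>n\<^sub>-\<^sub>1\<close> of a unitary frame and its coordinates.\<close>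

definition frame_vec :: "('a::euclidean_space, 'b) sft_data_scheme \<Rightarrow> 'a \<Rightarrow> (nat \<Rightarrow> 'a) \<Rightarrow> nat \<Rightarrow> 'a" where
  "frame_vec D x e j = (if j < hdim D - 1 then e j else acs D x (e (j - (hdim D - 1))))"

definition frame_coord :: "('a::euclidean_space, 'b) sft_data_scheme \<Rightarrow> 'a \<Rightarrow> (nat \<Rightarrow> 'a) \<Rightarrow> 'a \<Rightarrow> nat \<Rightarrow> real" where
  "frame_coord D x e v i =
     (if i < hdim D - 1 then dcform D x v (acs D x (e i)) else dcform D x (e (i - (hdim D - 1))) v)"

definition cz_int :: "('a::euclidean_space, 'b) sft_data_scheme \<Rightarrow> nat \<Rightarrow> int" where
  "cz_int D k = (let f = capframe D k 1 (orbit_simplex D k); x = orb D k in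
     cz_path (hdim D - 1) (\<lambda>t i j. frame_coord D (x (period D k * t)) (f (edge t))
       (reeb_flow_deriv D (period D k * t) (x 0) (frame_vec D (x 0) (f (edge 0)) j)) i))"

text \<open>Torsion in \<open>H\<^sub>1\<close> leads to a rational grading: the correction makes the dimension formula hold for
  classes \<open>A\<close> closed up with the surfaces \<open>tchain\<close>.  Signs depend on the parity of \<open>cz_int\<close>, which does not
  depend on the trivialization.\<close>

definition CZ :: "('a::euclidean_space, 'b) sft_data_scheme \<Rightarrow> nat \<Rightarrow> real" where
  "CZ D k = of_int (cz_int D k) +
     (\<Sum>i\<in>{i. i < nloop D \<and> 0 < tors D i}. 2 * of_int (capcoef D k i) / of_nat (tors D i) * of_int (tors_chern D i))"

definition H2 :: "('a::euclidean_space, 'b) sft_data_scheme \<Rightarrow> 'a chain set monoid" where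
  "H2 D = homology_group 2 (top_of_set (mfd D))"

definition coefficient_submodule :: "('a::euclidean_space, 'b) sft_data_scheme \<Rightarrow> bool" where
  "coefficient_submodule D \<longleftrightarrow> subgroup (rels D) (H2 D) \<and> (\<forall>A\<in>rels D. chern D A = 0)"

definition sft_choices :: "('a::euclidean_space, 'b) sft_data_scheme \<Rightarrow> bool" where
  "sft_choices D \<longleftrightarrow> orbit_enumeration D \<and> compatible_acs D \<and> cz_choices D \<and>
     integral_basis (mfd D) (nform D) (tdeg D) (theta D) \<and> coefficient_submodule D"


section \<open>Holomorphic curves and buildings\<close>

text \<open>Riemann surfaces have cardinality at most that of the continuum, so the points may be taken to be
  real numbers, with an arbitrary topology.  \<open>disc z\<close> is a holomorphic disc chart centered at the puncture
  \<open>z\<close>; the asymptotic marker at \<open>z\<close> is the tangent vector along its positive real axis.\<close>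

record 'a hcurve =
  surf :: "real topology"
  atlas :: "(real set \<times> (real \<Rightarrow> complex)) set"
  genus :: nat
  ppos :: "real set"
  pneg :: "real set"
  porb :: "real \<Rightarrow> nat"
  disc :: "real \<Rightarrow> real set \<times> (real \<Rightarrow> complex)"
  amap :: "real \<Rightarrow> real"
  umap :: "real \<Rightarrow> 'a"

definition holomorphic_chart :: "real topology \<Rightarrow> (real set \<times> (real \<Rightarrow> complex)) set \<Rightarrow> real set \<Rightarrow> (real \<Rightarrow> complex) \<Rightarrow> bool" where
  "holomorphic_chart X \<A> U \<phi> \<longleftrightarrow> openin X U \<and> open (\<phi> ` U) \<and>
     homeomorphic_map (subtopology X U) (top_of_set (\<phi> ` U)) \<phi> \<and>
     (\<forall>(V, \<psi>)\<in>\<A>. (\<phi> \<circ> inv_into V \<psi>) holomorphic_on \<psi> ` (U \<inter> V))"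

definition closed_riemann_surface :: "real topology \<Rightarrow> (real set \<times> (real \<Rightarrow> complex)) set \<Rightarrow> nat \<Rightarrow> bool" where
  "closed_riemann_surface X \<A> g \<longleftrightarrow> Hausdorff_space X \<and> compact_space X \<and> connected_space X \<and> topspace X \<noteq> {} \<and>
     \<Union> (fst ` \<A>) = topspace X \<and> (\<forall>(U, \<phi>)\<in>\<A>. holomorphic_chart X \<A> U \<phi>) \<and>
     homology_group 1 X \<cong> free_Abelian_group {..<2 * g}"

definition punctures :: "('a, 'c) hcurve_scheme \<Rightarrow> real set" where
  "punctures C = ppos C \<union> pneg C"

definition puncture_sign :: "('a, 'c) hcurve_scheme \<Rightarrow> real \<Rightarrow> real" where
  "puncture_sign C z = (if z \<in> ppos C then 1 else - 1)"

definition holomorphic_curve :: "('a::euclidean_space, 'b) sft_data_scheme \<Rightarrow> 'a hcurve \<Rightarrow> bool" where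
  "holomorphic_curve D C \<longleftrightarrow> closed_riemann_surface (surf C) (atlas C) (genus C) \<and>
     finite (punctures C) \<and> punctures C \<subseteq> topspace (surf C) \<and> ppos C \<inter> pneg C = {} \<and>
     porb C ` punctures C \<subseteq> orbs D \<and>
     umap C ` (topspace (surf C) - punctures C) \<subseteq> mfd D \<and>
     (\<forall>(U, \<phi>)\<in>atlas C. let \<Omega> = \<phi> ` (U - punctures C); a = amap C \<circ> inv_into U \<phi>; u = umap C \<circ> inv_into U \<phi> in
        smooth_on \<Omega> a \<and> smooth_on \<Omega> u \<and>
        (\<forall>z\<in>\<Omega>. \<forall>v. symplectization_acs D (u z) (frechet_derivative a (at z) v, frechet_derivative u (at z) v) =
           (frechet_derivative a (at z) (\<i> * v), frechet_derivative u (at z) (\<i> * v)))) \<and>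
     (\<forall>z\<in>punctures C. \<forall>z'\<in>punctures C. z \<noteq> z' \<longrightarrow> fst (disc C z) \<inter> fst (disc C z') = {}) \<and>
     (\<forall>z\<in>punctures C. let U = fst (disc C z); \<psi> = snd (disc C z); k = porb C z; \<epsilon> = puncture_sign C z in
        holomorphic_chart (surf C) (atlas C) U \<psi> \<and> z \<in> U \<and> \<psi> z = 0 \<and> \<psi> ` U = ball 0 1 \<and>
        (\<forall>B. \<exists>r>0. \<forall>p\<in>U - {z}. cmod (\<psi> p) < r \<longrightarrow> B < \<epsilon> * amap C p) \<and>
        uniform_limit UNIV (\<lambda>\<rho> \<theta>. umap C (inv_into U \<psi> (rcis \<rho> \<theta>)))
          (\<lambda>\<theta>. orb D k (- \<epsilon> * period D k * \<theta> / (2 * pi))) (at_right 0))"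

text \<open>The continuous extension of \<open>u\<close> to the compact surface bounded by circles, realized as the complement
  of the discs of radius \<open>1/4\<close>: the annuli \<open>1/4 \<le> \<bar>w\<bar> < 1/2\<close> are stretched over \<open>0 \<le> \<bar>w\<bar> < 1/2\<close>.\<close>

definition capped_surface :: "'a hcurve \<Rightarrow> real set" where
  "capped_surface C = topspace (surf C) - (\<Union>z\<in>punctures C. {p \<in> fst (disc C z). cmod (snd (disc C z) p) < 1/4})"

definition capped_map :: "('a::euclidean_space, 'b) sft_data_scheme \<Rightarrow> 'a hcurve \<Rightarrow> real \<Rightarrow> 'a" where
  "capped_map D C p =
     (if \<exists>z\<in>punctures C. p \<in> fst (disc C z) \<and> cmod (snd (disc C z) p) < 1/2 then
        (let z = (THE z. z \<in> punctures C \<and> p \<in> fst (disc C z)); w = snd (disc C z) p; \<rho> = 2 * (cmod w - 1/4) in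
         if \<rho> \<le> 0 then orb D (porb C z) (- puncture_sign C z * period D (porb C z) * Arg w / (2 * pi))
         else umap C (inv_into (fst (disc C z)) (snd (disc C z)) (rcis \<rho> (Arg w))))
      else umap C p)"

text \<open>The boundary circle at a puncture, parametrized so that \<open>capped_map\<close> maps it to the orbit in the
  direction of the Reeb field.\<close>

definition puncture_loop :: "'a hcurve \<Rightarrow> real \<Rightarrow> (nat \<Rightarrow> real) \<Rightarrow> real" where
  "puncture_loop C z = loop_simplex
     (\<lambda>t. inv_into (fst (disc C z)) (snd (disc C z)) (rcis (1/4) (- puncture_sign C z * 2 * pi * t)))"

text \<open>A fundamental chain of \<open>capped_surface\<close>; as there is at least one puncture, its class is determined by
  its boundary.\<close>

definition fundamental_chain :: "'a hcurve \<Rightarrow> real chain \<Rightarrow> bool" where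
  "fundamental_chain C s \<longleftrightarrow> singular_chain 2 (subtopology (surf C) (capped_surface C)) s \<and>
     chain_boundary 2 s = (\<Sum>z\<in>ppos C. frag_of (puncture_loop C z)) - (\<Sum>z\<in>pneg C. frag_of (puncture_loop C z))"

text \<open>Holomorphic buildings in \<open>\<real> \<times> M\<close>.  \<open>lev\<close> assigns the components to levels, counted from the bottom;
  \<open>nodes\<close> are pairs of points of components of the same level; \<open>breaks\<close> are pairs of a negative puncture and
  a positive puncture one level below, whose circles at infinity are identified so that the markers match.
  External punctures and marked points are numbered.\<close>

record 'a building =
  comps :: "'a hcurve list"
  lev :: "nat \<Rightarrow> nat"
  nodes :: "((nat \<times> real) \<times> (nat \<times> real)) list"
  breaks :: "((nat \<times> real) \<times> (nat \<times> real)) list"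
  extpos :: "(nat \<times> real) list"
  extneg :: "(nat \<times> real) list"
  marks :: "(nat \<times> real) list"

definition special_points :: "'a building \<Rightarrow> (nat \<times> real) set" where
  "special_points B = set (map fst (nodes B)) \<union> set (map snd (nodes B)) \<union> set (marks B)"

definition trivial_cylinder :: "('a::euclidean_space, 'b) sft_data_scheme \<Rightarrow> 'a building \<Rightarrow> nat \<Rightarrow> bool" where
  "trivial_cylinder D B c \<longleftrightarrow> (let C = comps B ! c in genus C = 0 \<and> card (ppos C) = 1 \<and> card (pneg C) = 1 \<and>
     (\<forall>x. (c, x) \<notin> special_points B) \<and>
     (\<exists>k. umap C ` (topspace (surf C) - punctures C) \<subseteq> range (orb D k)))"

definition mult_word :: "mindex \<Rightarrow> nat list" where
  "mult_word I = concat (map (\<lambda>k. replicate (Poly_Mapping.lookup I k) k) (sorted_list_of_set (Poly_Mapping.keys I)))"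

definition building_class :: "('a::euclidean_space, 'b) sft_data_scheme \<Rightarrow> 'a building \<Rightarrow> 'a chain set \<Rightarrow> bool" where
  "building_class D B A \<longleftrightarrow> (\<exists>s m z.
     (\<forall>c<length (comps B). if punctures (comps B ! c) = {} then s c = 0 else fundamental_chain (comps B ! c) (s c)) \<and>
     z = (\<Sum>c<length (comps B). chain_map 2 (capped_map D (comps B ! c)) (s c))
         - (\<Sum>(c, x)\<leftarrow>extpos B. cap D (porb (comps B ! c) x))
         + (\<Sum>(c, x)\<leftarrow>extneg B. cap D (porb (comps B ! c) x))
         - (\<Sum>i\<in>{i. i < nloop D \<and> 0 < tors D i}. frag_cmul (m i) (tchain D i)) \<and>
     singular_relcycle 2 (top_of_set (mfd D)) {} z \<and> A = homologous_rel_set 2 (top_of_set (mfd D)) {} z)"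

definition stable_building :: "('a::euclidean_space, 'b) sft_data_scheme \<Rightarrow> nat \<Rightarrow> 'a building \<Rightarrow> bool" where
  "stable_building D g B \<longleftrightarrow> (let N = length (comps B); C = (!) (comps B) in
     0 < N \<and> (\<forall>c<N. holomorphic_curve D (C c)) \<and>
     (\<exists>h. lev B ` {..<N} = {..<h} \<and> (\<forall>l<h. \<exists>c<N. lev B c = l \<and> \<not> trivial_cylinder D B c) \<and>
        (\<forall>(c, x)\<in>set (extpos B). Suc (lev B c) = h)) \<and>
     (\<forall>(c, x)\<in>set (extneg B). lev B c = 0) \<and>
     distinct (map fst (nodes B) @ map snd (nodes B) @ marks B) \<and>
     (\<forall>(c, x)\<in>special_points B. c < N \<and> x \<in> topspace (surf (C c)) - punctures (C c)) \<and>
     (\<forall>((c, x), (c', x'))\<in>set (nodes B). lev B c = lev B c' \<and>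
        amap (C c) x = amap (C c') x' \<and> umap (C c) x = umap (C c') x') \<and>
     distinct (extpos B @ map snd (breaks B)) \<and> distinct (extneg B @ map fst (breaks B)) \<and>
     set (extpos B @ map snd (breaks B)) = {(c, x). c < N \<and> x \<in> ppos (C c)} \<and>
     set (extneg B @ map fst (breaks B)) = {(c, x). c < N \<and> x \<in> pneg (C c)} \<and>
     (\<forall>((c, x), (c', x'))\<in>set (breaks B). lev B c = Suc (lev B c') \<and> porb (C c) x = porb (C c') x') \<and>
     (let E = {(c, c'). \<exists>x x'. ((c, x), (c', x')) \<in> set (nodes B) \<union> set (breaks B)} in
        \<forall>c<N. \<forall>c'<N. (c, c') \<in> (E \<union> E\<inverse>)\<^sup>*) \<and>
     (\<Sum>c<N. genus (C c)) + length (nodes B) + length (breaks B) + 1 = g + N \<and>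
     (\<forall>c<N. (amap (C c)) constant_on (topspace (surf (C c)) - punctures (C c)) \<and>
        (umap (C c)) constant_on (topspace (surf (C c)) - punctures (C c)) \<longrightarrow>
          3 \<le> 2 * genus (C c) + card {x. (c, x) \<in> special_points B}))"

text \<open>Representatives of the points of the (unperturbed) compactified moduli space, up to reparametrization
  and, level by level, shifts in the \<open>\<real>\<close>-direction.  The buildings with a single component form the moduli
  space of holomorphic curves.\<close>

definition buildings ::
  "('a::euclidean_space, 'b) sft_data_scheme \<Rightarrow> bool \<Rightarrow> nat \<Rightarrow> nat \<Rightarrow> 'a chain set \<Rightarrow> mindex \<Rightarrow> mindex \<Rightarrow> nat \<Rightarrow> 'a building set" where
  "buildings D pos g m A I J k = {B. stable_building D g B \<and> length (marks B) = m \<and>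
     map (\<lambda>(c, x). porb (comps B ! c) x) (extneg B) = (if pos then mult_word I else k # mult_word I) \<and>
     map (\<lambda>(c, x). porb (comps B ! c) x) (extpos B) = (if pos then mult_word J @ [k] else mult_word J) \<and>
     building_class D B A}"


section \<open>Curve counts\<close>

definition msize :: "mindex \<Rightarrow> nat" where
  "msize I = (\<Sum>k\<in>Poly_Mapping.keys I. Poly_Mapping.lookup I k)"

definition symmetry_factor :: "('a::euclidean_space, 'b) sft_data_scheme \<Rightarrow> mindex \<Rightarrow> nat" where
  "symmetry_factor D I = (\<Prod>k\<in>Poly_Mapping.keys I.
     fact (Poly_Mapping.lookup I k) * multiplicity_of D k ^ Poly_Mapping.lookup I k)"

definition expected_dim ::
  "('a::euclidean_space, 'b) sft_data_scheme \<Rightarrow> bool \<Rightarrow> nat \<Rightarrow> nat \<Rightarrow> 'a chain set \<Rightarrow> mindex \<Rightarrow> mindex \<Rightarrow> nat \<Rightarrow> real" where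
  "expected_dim D pos g m A I J k =
     (real (hdim D) - 3) * (2 - 2 * real g - real (msize I) - real (msize J) - 1) - 1 + 2 * real m +
     (if pos then CZ D k else - CZ D k) + 2 * of_int (chern D A) +
     (\<Sum>j\<in>Poly_Mapping.keys I \<union> Poly_Mapping.keys J.
        (real (Poly_Mapping.lookup J j) - real (Poly_Mapping.lookup I j)) * CZ D j)"

text \<open>\<open>curve_count D pos g A I J k [a\<^sub>1, \<dots>, a\<^sub>m]\<close> is the integral of the pullback of
  \<open>\<Theta>\<^sup>a\<^sup>1 \<times> \<dots> \<times> \<Theta>\<^sup>a\<^sup>m\<close> over the perturbed moduli space; for the empty list it is the weighted count of points.\<close>

definition curve_count ::
  "('a::euclidean_space, 'b) sft_data_scheme \<Rightarrow> bool \<Rightarrow> nat \<Rightarrow> 'a chain set \<Rightarrow> mindex \<Rightarrow> mindex \<Rightarrow> nat \<Rightarrow> nat list \<Rightarrow> real" where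
  "curve_count D pos g A I J k as =
     (if real (\<Sum>a\<leftarrow>as. tdeg D a) = expected_dim D pos g (length as) A I J k
      then (\<Sum>(w, \<sigma>)\<leftarrow>moduli D pos g (length as) A I J k.
              of_rat w * simplex_integral (length as) (\<lambda>j. tdeg D (as ! j)) (\<lambda>j. theta D (as ! j)) \<sigma>)
      else 0)"

definition curve_count_rat ::
  "('a::euclidean_space, 'b) sft_data_scheme \<Rightarrow> bool \<Rightarrow> nat \<Rightarrow> 'a chain set \<Rightarrow> mindex \<Rightarrow> mindex \<Rightarrow> nat \<Rightarrow> nat list \<Rightarrow> rat" where
  "curve_count_rat D pos g A I J k as = (THE r. of_rat r = curve_count D pos g A I J k as)"

text \<open>The perturbed moduli spaces are of the expected dimension and define elements of the algebras over
  the rational group ring (integrals are rational, sums finite).  Of the smallness of the perturbation only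
  the consequence is recorded that a perturbed space is empty if the compact unperturbed one is.  That the
  resulting operators are differentials is stated in \<open>sft_differential\<close>.\<close>

definition transversality :: "('a::euclidean_space, 'b) sft_data_scheme \<Rightarrow> bool" where
  "transversality D \<longleftrightarrow>
     (\<forall>pos g m A I J k.
        A \<in> carrier (H2 D) \<and> Poly_Mapping.keys I \<subseteq> orbs D \<and> Poly_Mapping.keys J \<subseteq> orbs D \<and> k \<in> orbs D \<longrightarrow>
        (\<forall>(w, \<sigma>)\<in>set (moduli D pos g m A I J k). \<exists>d. real d = expected_dim D pos g m A I J k \<and>
           (\<forall>j<m. smooth_simplex d (\<sigma> j) \<and> \<sigma> j ` standard_simplex d \<subseteq> mfd D)) \<and>
        (buildings D pos g m A I J k = {} \<longrightarrow> moduli D pos g m A I J k = []) \<and>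
        (\<forall>as. set as \<subseteq> {..<nform D} \<longrightarrow> curve_count D pos g A I J k as \<in> \<rat>)) \<and>
     (\<forall>pos g m J k. Poly_Mapping.keys J \<subseteq> orbs D \<and> k \<in> orbs D \<longrightarrow>
        finite {(A, I). A \<in> carrier (H2 D) \<and> Poly_Mapping.keys I \<subseteq> orbs D \<and>
          (\<exists>as. length as = m \<and> set as \<subseteq> {..<nform D} \<and> curve_count D pos g A I J k as \<noteq> 0)})"


section \<open>The algebras\<close>

datatype sft_kind = CH | RSFT | SFT

text \<open>The exponents \<open>(K, I, J, g)\<close> stand for the ordered monomial \<open>t\<^sup>K q\<^sup>I p\<^sup>J \<hbar>\<^sup>g\<close>, and \<open>x (K, I, J, g) A\<close> is the
  coefficient of \<open>e\<^sup>A t\<^sup>K q\<^sup>I p\<^sup>J \<hbar>\<^sup>g\<close> in the series \<open>x\<close>.\<close>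

type_synonym mono = "mindex \<times> mindex \<times> mindex \<times> nat"
type_synonym 'a coef_group = "'a chain set set"
type_synonym 'a series = "mono \<Rightarrow> 'a coef_group \<Rightarrow> rat"

definition QH :: "('a::euclidean_space, 'b) sft_data_scheme \<Rightarrow> 'a coef_group monoid" where
  "QH D = H2 D Mod rels D"

text \<open>Parity of \<open>q\<^sub>\<gamma>\<close>, which is also that of \<open>p\<^sub>\<gamma>\<close>; the parity of \<open>t\<^sub>j\<close> is that of \<open>tdeg\<close>.\<close>

definition qpar :: "('a::euclidean_space, 'b) sft_data_scheme \<Rightarrow> nat \<Rightarrow> nat" where
  "qpar D k = nat ((cz_int D k + int (hdim D) - 3) mod 2)"

definition wsum :: "(nat \<Rightarrow> nat) \<Rightarrow> mindex \<Rightarrow> nat" where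
  "wsum w I = (\<Sum>k\<in>Poly_Mapping.keys I. Poly_Mapping.lookup I k * w k)"

definition wbelow :: "(nat \<Rightarrow> nat) \<Rightarrow> mindex \<Rightarrow> nat \<Rightarrow> nat" where
  "wbelow w I j = (\<Sum>k\<in>{k \<in> Poly_Mapping.keys I. k < j}. Poly_Mapping.lookup I k * w k)"

text \<open>Odd variables square to zero.\<close>

fun valid_mono :: "('a::euclidean_space, 'b) sft_data_scheme \<Rightarrow> mono \<Rightarrow> bool" where
  "valid_mono D (K, I, J, g) \<longleftrightarrow>
     Poly_Mapping.keys K \<subseteq> {..<nform D} \<and> Poly_Mapping.keys I \<subseteq> orbs D \<and> Poly_Mapping.keys J \<subseteq> orbs D \<and>
     (\<forall>j. odd (tdeg D j) \<longrightarrow> Poly_Mapping.lookup K j \<le> 1) \<and>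
     (\<forall>k. odd (qpar D k) \<longrightarrow> Poly_Mapping.lookup I k \<le> 1 \<and> Poly_Mapping.lookup J k \<le> 1)"

definition sft_carrier :: "('a::euclidean_space, 'b) sft_data_scheme \<Rightarrow> sft_kind \<Rightarrow> bool \<Rightarrow> 'a series set" where
  "sft_carrier D kind marked = {x.
     (\<forall>K I J g A. x (K, I, J, g) A \<noteq> 0 \<longrightarrow> valid_mono D (K, I, J, g) \<and> A \<in> carrier (QH D) \<and>
        (kind \<noteq> SFT \<longrightarrow> g = 0) \<and> (kind = CH \<longrightarrow> J = 0) \<and> (\<not> marked \<longrightarrow> K = 0)) \<and>
     (\<forall>K J g. finite {(I, A). x (K, I, J, g) A \<noteq> 0})}"

definition mono_elt :: "('a::euclidean_space, 'b) sft_data_scheme \<Rightarrow> mono \<Rightarrow> 'a series" where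
  "mono_elt D \<mu> = (\<lambda>\<mu>' A. if \<mu>' = \<mu> \<and> valid_mono D \<mu> \<and> A = \<one>\<^bsub>QH D\<^esub> then 1 else 0)"

definition q_elt :: "('a::euclidean_space, 'b) sft_data_scheme \<Rightarrow> nat \<Rightarrow> 'a series" where
  "q_elt D k = mono_elt D (0, Poly_Mapping.single k 1, 0, 0)"

definition p_elt :: "('a::euclidean_space, 'b) sft_data_scheme \<Rightarrow> nat \<Rightarrow> 'a series" where
  "p_elt D k = mono_elt D (0, 0, Poly_Mapping.single k 1, 0)"

definition t_elt :: "('a::euclidean_space, 'b) sft_data_scheme \<Rightarrow> nat \<Rightarrow> 'a series" where
  "t_elt D j = mono_elt D (Poly_Mapping.single j 1, 0, 0, 0)"

definition h_elt :: "('a::euclidean_space, 'b) sft_data_scheme \<Rightarrow> 'a series" where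
  "h_elt D = mono_elt D (0, 0, 0, 1)"

text \<open>Left multiplication by \<open>e\<^sup>A\<close>, \<open>\<hbar>\<close>, \<open>t\<^sub>j\<close>, \<open>q\<^sub>k\<close> and \<open>p\<^sub>k\<close>.  Moving \<open>p\<^sub>k\<close> to its place gives the Koszul sign and,
  in the Weyl algebra (\<open>weyl\<close>), the additional term \<open>\<kappa>\<^sub>k \<hbar> \<partial>/\<partial>q\<^sub>k\<close>.\<close>

definition mul_e :: "('a::euclidean_space, 'b) sft_data_scheme \<Rightarrow> 'a coef_group \<Rightarrow> 'a series \<Rightarrow> 'a series" where
  "mul_e D A x = (\<lambda>\<mu> B. if B \<in> carrier (QH D) then x \<mu> (B \<otimes>\<^bsub>QH D\<^esub> inv\<^bsub>QH D\<^esub> A) else 0)"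

definition mul_h :: "'a series \<Rightarrow> 'a series" where
  "mul_h x = (\<lambda>(K, I, J, g) A. if 0 < g then x (K, I, J, g - 1) A else 0)"

definition mul_t :: "('a::euclidean_space, 'b) sft_data_scheme \<Rightarrow> nat \<Rightarrow> 'a series \<Rightarrow> 'a series" where
  "mul_t D j x = (\<lambda>(K, I, J, g) A.
     if valid_mono D (K, I, J, g) \<and> 0 < Poly_Mapping.lookup K j
     then (-1) ^ (tdeg D j * wbelow (tdeg D) K j) * x (K - Poly_Mapping.single j 1, I, J, g) A else 0)"

definition mul_q :: "('a::euclidean_space, 'b) sft_data_scheme \<Rightarrow> nat \<Rightarrow> 'a series \<Rightarrow> 'a series" where
  "mul_q D k x = (\<lambda>(K, I, J, g) A.
     if valid_mono D (K, I, J, g) \<and> 0 < Poly_Mapping.lookup I k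
     then (-1) ^ (qpar D k * (wsum (tdeg D) K + wbelow (qpar D) I k)) * x (K, I - Poly_Mapping.single k 1, J, g) A
     else 0)"

definition mul_p :: "('a::euclidean_space, 'b) sft_data_scheme \<Rightarrow> bool \<Rightarrow> nat \<Rightarrow> 'a series \<Rightarrow> 'a series" where
  "mul_p D weyl k x = (\<lambda>(K, I, J, g) A.
     (if valid_mono D (K, I, J, g) \<and> 0 < Poly_Mapping.lookup J k
      then (-1) ^ (qpar D k * (wsum (tdeg D) K + wsum (qpar D) I + wbelow (qpar D) J k)) *
           x (K, I, J - Poly_Mapping.single k 1, g) A
      else 0) +
     (if weyl \<and> valid_mono D (K, I, J, g) \<and> 0 < g
      then of_nat (multiplicity_of D k) * (-1) ^ (qpar D k * (wsum (tdeg D) K + wbelow (qpar D) I k)) *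
           of_nat (Poly_Mapping.lookup I k + 1) * x (K, I + Poly_Mapping.single k 1, J, g - 1) A
      else 0))"

fun mul_mono :: "('a::euclidean_space, 'b) sft_data_scheme \<Rightarrow> bool \<Rightarrow> mono \<Rightarrow> 'a series \<Rightarrow> 'a series" where
  "mul_mono D weyl (K, I, J, g) x =
     foldr (mul_t D) (mult_word K) (foldr (mul_q D) (mult_word I) (foldr (mul_p D weyl) (mult_word J) ((mul_h ^^ g) x)))"

text \<open>On \<open>sft_carrier\<close> the sum is finite for every \<open>\<mu>\<close> and \<open>B\<close>.\<close>

definition sft_mult :: "('a::euclidean_space, 'b) sft_data_scheme \<Rightarrow> sft_kind \<Rightarrow> 'a series \<Rightarrow> 'a series \<Rightarrow> 'a series" where
  "sft_mult D kind x y = (\<lambda>\<mu> B.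
     let f = (\<lambda>(\<nu>, A). x \<nu> A * mul_e D A (mul_mono D (kind = SFT) \<nu> y) \<mu> B) in \<Sum>i | f i \<noteq> 0. f i)"

fun mono_parity :: "('a::euclidean_space, 'b) sft_data_scheme \<Rightarrow> mono \<Rightarrow> nat" where
  "mono_parity D (K, I, J, g) = (wsum (tdeg D) K + wsum (qpar D) I + wsum (qpar D) J) mod 2"

text \<open>Elements of the coefficient ring and \<open>\<hbar>\<close> are even.\<close>

definition has_parity :: "('a::euclidean_space, 'b) sft_data_scheme \<Rightarrow> nat \<Rightarrow> 'a series \<Rightarrow> bool" where
  "has_parity D \<epsilon> x \<longleftrightarrow> (\<forall>\<mu> A. x \<mu> A \<noteq> 0 \<longrightarrow> mono_parity D \<mu> = \<epsilon>)"

fun term_degree :: "('a::euclidean_space, 'b) sft_data_scheme \<Rightarrow> mono \<Rightarrow> 'a coef_group \<Rightarrow> real" where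
  "term_degree D (K, I, J, g) A =
     (\<Sum>j\<in>Poly_Mapping.keys K. real (Poly_Mapping.lookup K j) * (real (tdeg D j) - 2)) +
     (\<Sum>k\<in>Poly_Mapping.keys I. real (Poly_Mapping.lookup I k) * (CZ D k + real (hdim D) - 3)) +
     (\<Sum>k\<in>Poly_Mapping.keys J. real (Poly_Mapping.lookup J k) * (- CZ D k + real (hdim D) - 3)) +
     real g * (2 * (real (hdim D) - 3)) - 2 * of_int (chern D (SOME a. a \<in> A))"

definition has_degree :: "('a::euclidean_space, 'b) sft_data_scheme \<Rightarrow> real \<Rightarrow> 'a series \<Rightarrow> bool" where
  "has_degree D \<delta> x \<longleftrightarrow> (\<forall>\<mu> A. x \<mu> A \<noteq> 0 \<longrightarrow> term_degree D \<mu> A = \<delta>)"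


section \<open>The differentials\<close>

text \<open>The summand of the differential of \<open>q\<^sub>k\<close> (\<open>pos\<close>) or \<open>p\<^sub>k\<close> (\<open>\<not> pos\<close>, up to sign) belonging to
  \<open>(g, [a\<^sub>1, \<dots>, a\<^sub>m], A, I\<^sup>-, I\<^sup>+)\<close>.\<close>

fun diff_term ::
  "('a::euclidean_space, 'b) sft_data_scheme \<Rightarrow> bool \<Rightarrow> nat \<Rightarrow> nat \<times> nat list \<times> 'a chain set \<times> mindex \<times> mindex \<Rightarrow> 'a series" where
  "diff_term D pos k (g, as, A, I, J) = (\<lambda>\<mu> B.
     curve_count_rat D pos g A I J k as /
       (fact (length as) * of_nat (symmetry_factor D I) * of_nat (symmetry_factor D J)) *
     mul_e D (rels D #>\<^bsub>H2 D\<^esub> A) (foldr (mul_t D) as (mono_elt D (0, I, J, g))) \<mu> B)"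

definition diff_index ::
  "('a::euclidean_space, 'b) sft_data_scheme \<Rightarrow> sft_kind \<Rightarrow> bool \<Rightarrow> (nat \<times> nat list \<times> 'a chain set \<times> mindex \<times> mindex) set" where
  "diff_index D kind marked = {(g, as, A, I, J). set as \<subseteq> {..<nform D} \<and> A \<in> carrier (H2 D) \<and>
     Poly_Mapping.keys I \<subseteq> orbs D \<and> Poly_Mapping.keys J \<subseteq> orbs D \<and>
     (kind \<noteq> SFT \<longrightarrow> g = 0) \<and> (kind = CH \<longrightarrow> J = 0) \<and> (\<not> marked \<longrightarrow> as = [])}"

text \<open>The formal sum of these terms; \<open>transversality\<close> makes it finite in every coefficient.\<close>

definition diff_gen :: "('a::euclidean_space, 'b) sft_data_scheme \<Rightarrow> sft_kind \<Rightarrow> bool \<Rightarrow> bool \<Rightarrow> nat \<Rightarrow> 'a series" where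
  "diff_gen D kind marked pos k = (\<lambda>\<mu> B.
     \<Sum>\<iota> | \<iota> \<in> diff_index D kind marked \<and> diff_term D pos k \<iota> \<mu> B \<noteq> 0. diff_term D pos k \<iota> \<mu> B)"

text \<open>The part \<open>f\<^bsub>K,J,g\<^esub>(q)\<close> of a series: \<open>x\<close> is the formal sum of the elements \<open>series_part x (K, J, g)\<close>.\<close>

definition series_part :: "'a series \<Rightarrow> mindex \<times> mindex \<times> nat \<Rightarrow> 'a series" where
  "series_part x = (\<lambda>(K, J, g) (K', I, J', g') A. if K' = K \<and> J' = J \<and> g' = g then x (K', I, J', g') A else 0)"

text \<open>\<open>d\<close> is the differential of the indicated algebra: it has the prescribed values on the generators, is
  linear over the coefficient ring, satisfies the graded Leibniz rule, is compatible with the formal sums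
  of power series, has degree \<open>-1\<close> and square zero.  These conditions determine \<open>d\<close> on the algebra; that such a \<open>d\<close> exists
  belongs to the transversality assumption.\<close>

definition sft_differential ::
  "('a::euclidean_space, 'b) sft_data_scheme \<Rightarrow> sft_kind \<Rightarrow> bool \<Rightarrow> ('a series \<Rightarrow> 'a series) \<Rightarrow> bool" where
  "sft_differential D kind marked d \<longleftrightarrow> (let \<A> = sft_carrier D kind marked in
     (\<forall>k\<in>orbs D. d (q_elt D k) = diff_gen D kind marked True k) \<and>
     (kind \<noteq> CH \<longrightarrow> (\<forall>k\<in>orbs D. d (p_elt D k) =
        (\<lambda>\<mu> B. (-1) ^ (qpar D k + 1) * diff_gen D kind marked False k \<mu> B))) \<and>
     (kind = SFT \<longrightarrow> d (h_elt D) = (\<lambda>\<mu> B. 0)) \<and>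
     (marked \<longrightarrow> (\<forall>j<nform D. d (t_elt D j) = (\<lambda>\<mu> B. 0))) \<and>
     (\<forall>x\<in>\<A>. d x \<in> \<A>) \<and>
     (\<forall>x\<in>\<A>. \<forall>y\<in>\<A>. d (\<lambda>\<mu> B. x \<mu> B + y \<mu> B) = (\<lambda>\<mu> B. d x \<mu> B + d y \<mu> B)) \<and>
     (\<forall>x\<in>\<A>. \<forall>r. \<forall>A\<in>carrier (QH D).
        d (\<lambda>\<mu> B. r * mul_e D A x \<mu> B) = (\<lambda>\<mu> B. r * mul_e D A (d x) \<mu> B)) \<and>
     (\<forall>x\<in>\<A>. \<forall>y\<in>\<A>. \<forall>\<epsilon>. has_parity D \<epsilon> x \<longrightarrow>
        d (sft_mult D kind x y) =
          (\<lambda>\<mu> B. sft_mult D kind (d x) y \<mu> B + (-1) ^ \<epsilon> * sft_mult D kind x (d y) \<mu> B)) \<and>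
     (\<forall>x\<in>\<A>. \<forall>\<mu> B. finite {e. d (series_part x e) \<mu> B \<noteq> 0} \<and>
        d x \<mu> B = (\<Sum>e | d (series_part x e) \<mu> B \<noteq> 0. d (series_part x e) \<mu> B)) \<and>
     (\<forall>x\<in>\<A>. \<forall>\<delta>. has_degree D \<delta> x \<longrightarrow> has_degree D (\<delta> - 1) (d x)) \<and>
     (\<forall>x\<in>\<A>. d (d x) = (\<lambda>\<mu> B. 0)))"

definition homology_vanishes ::
  "('a::euclidean_space, 'b) sft_data_scheme \<Rightarrow> sft_kind \<Rightarrow> bool \<Rightarrow> ('a series \<Rightarrow> 'a series) \<Rightarrow> bool" where
  "homology_vanishes D kind marked d \<longleftrightarrow>
     (\<forall>x\<in>sft_carrier D kind marked. d x = (\<lambda>\<mu> B. 0) \<longrightarrow> (\<exists>y\<in>sft_carrier D kind marked. d y = x))"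

end

theory Submission
  imports Defs
begin

text \<open>A holomorphic building in the symplectization has a positive puncture: the \<open>\<real>\<close>-component of a
  holomorphic curve is subharmonic, so it cannot tend to \<open>-\<infinity>\<close> at every puncture.  Hence \<open>d p\<close> has no term
  without \<open>p\<close>, \<open>t\<close> or \<open>\<hbar>\<close>, all differentials respect the filtration by the number of these variables, and on
  the quotient by positive weight they induce the differential \<open>\<partial>\<close> of contact homology.  If some
  algebra has vanishing homology, then \<open>1 = d y\<close>, and the weight 0 part of \<open>y\<close> shows that \<open>1\<close> is \<open>\<partial>\<close>-exact.
  Conversely, if \<open>\<partial> y = 1\<close> then in each of the algebras \<open>d y = 1\<close> up to positive weight; for a closed \<open>x\<close> the
  element \<open>x - d (y x)\<close> is closed of higher weight, and iterating this writes \<open>x\<close> as \<open>d\<close> of a series that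
  converges in the power series algebra.\<close>

section \<open>The maximum principle\<close>

text \<open>The contact homology algebra is contained in each of the others, but the inclusion is
  not a chain map: \<open>d q\<close> may have further terms with p, t or \<hbar>. This is why a
  primitive of 1 in contact homology is a primitive elsewhere only up to positive weight, and why a
  correction process is needed. The map in the other direction, setting p, t and \<hbar> to zero, is
  a chain map as soon as \<open>d\<close> preserves positive weight. For t and \<hbar> this follows
  from \<open>d t = 0\<close> and \<open>d \<hbar> = 0\<close>, so that the geometry is needed for p
  alone. Subharmonicity comes from the Cauchy-Riemann equations, which express the gradient of the
  \<real>-component through \<alpha>: its Laplacian is d\<alpha> evaluated on the two partial
  derivatives of the map to \<open>M\<close>, and compatibility of J makes this nonnegative. All
  equivalences rest on one criterion, the existence of a polynomial y in the q's for which the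
  weight 0 part of \<open>d y\<close> is 1. It reads the same for all six differentials, so each
  algebra is compared with contact homology and never with another one.\<close>

lemma mixed_partials_commute_real:
  fixes f :: "'a::real_normed_vector \<Rightarrow> real"
  assumes U: "open U" "z \<in> U"
    and f: "\<And>x. x \<in> U \<Longrightarrow> (f has_derivative f' x) (at x)"
    and v: "\<And>x. x \<in> U \<Longrightarrow> ((\<lambda>x. f' x v) has_derivative fv x) (at x)" "continuous_on U (\<lambda>x. fv x w)"
    and w: "\<And>x. x \<in> U \<Longrightarrow> ((\<lambda>x. f' x w) has_derivative fw x) (at x)" "continuous_on U (\<lambda>x. fw x v)"
  shows "fv z w = fw z v"
proof -
  have line: "((\<lambda>s. F (p + s *\<^sub>R d)) has_real_derivative F' (p + s *\<^sub>R d) d) (at s)"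
    if "\<And>x. x \<in> U \<Longrightarrow> (F has_derivative F' x) (at x)" "p + s *\<^sub>R d \<in> U"
    for F :: "'a \<Rightarrow> real" and F' p s d
  proof -
    have "((\<lambda>s. F (p + s *\<^sub>R d)) has_derivative (\<lambda>h. F' (p + s *\<^sub>R d) (h *\<^sub>R d))) (at s)"
      by (rule has_derivative_compose[where g = F and f = "\<lambda>s. p + s *\<^sub>R d" and f' = "\<lambda>h. h *\<^sub>R d", OF _ that(1)[OF that(2)]])
        (auto intro!: derivative_eq_intros)
    moreover have "(\<lambda>h. F' (p + s *\<^sub>R d) (h *\<^sub>R d)) = (*) (F' (p + s *\<^sub>R d) d)"
      using has_derivative_bounded_linear[OF that(1)[OF that(2)]]
      by (auto simp: linear_simps)
    ultimately show ?thesis by (simp add: has_field_derivative_def)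
  qed
  have small: "\<exists>h>0. \<forall>s\<in>{0..h}. \<forall>t\<in>{0..h}. z + s *\<^sub>R v + t *\<^sub>R w \<in> ball z r" if "r > 0" for r
  proof -
    define h where "h = r / (2 * (1 + norm v + norm w))"
    have pos: "0 < 1 + norm v + norm w" by (smt (verit) norm_ge_zero)
    have h0: "h > 0" using that pos by (simp add: h_def)
    have "norm (s *\<^sub>R v + t *\<^sub>R w) < r" if "s \<in> {0..h}" "t \<in> {0..h}" for s t
    proof -
      have "norm (s *\<^sub>R v + t *\<^sub>R w) \<le> s * norm v + t * norm w"
        using norm_triangle_ineq[of "s *\<^sub>R v" "t *\<^sub>R w"] that by simp
      also have "\<dots> \<le> h * norm v + h * norm w"
        using that by (intro add_mono mult_right_mono) auto
      also have "\<dots> \<le> h * (1 + norm v + norm w)" using h0 by (simp add: algebra_simps)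
      also have "\<dots> = r / 2" using pos by (simp add: h_def field_simps)
      finally show ?thesis using \<open>r > 0\<close> by simp
    qed
    moreover have "dist z (z + s *\<^sub>R v + t *\<^sub>R w) = norm (s *\<^sub>R v + t *\<^sub>R w)" for s t
      by (metis add.assoc add_diff_cancel_left' dist_commute dist_norm)
    ultimately show ?thesis using h0 by (intro exI[of _ h]) (simp add: mem_ball)
  qed
  show ?thesis
  proof (rule ccontr)
    assume ne: "fv z w \<noteq> fw z v"
    define e where "e = \<bar>fv z w - fw z v\<bar> / 2"
    have e: "e > 0" using ne by (simp add: e_def)
    have "isCont (\<lambda>x. fv x w) z" "isCont (\<lambda>x. fw x v) z"
      using v(2) w(2) U by (auto simp: continuous_on_eq_continuous_at)
    then obtain r1 r2 where r: "r1 > 0" "\<And>x. dist x z < r1 \<Longrightarrow> \<bar>fv x w - fv z w\<bar> < e"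
        "r2 > 0" "\<And>x. dist x z < r2 \<Longrightarrow> \<bar>fw x v - fw z v\<bar> < e"
      using e by (auto simp: continuous_at_eps_delta dist_real_def) metis
    obtain r3 where r3: "r3 > 0" "ball z r3 \<subseteq> U" using U openE by blast
    define r where "r = min r1 (min r2 r3)"
    have "r > 0" using r r3 by (simp add: r_def)
    from small[OF this] obtain h where h: "h > 0"
      and hh: "\<And>s t. 0 \<le> s \<Longrightarrow> s \<le> h \<Longrightarrow> 0 \<le> t \<Longrightarrow> t \<le> h \<Longrightarrow> z + s *\<^sub>R v + t *\<^sub>R w \<in> ball z r" by auto
    have inU: "z + s *\<^sub>R v + t *\<^sub>R w \<in> U" if "0 \<le> s" "s \<le> h" "0 \<le> t" "t \<le> h" for s t
      using hh[OF that] r3(2) by (auto simp: r_def)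
    have inU': "z + t *\<^sub>R w + s *\<^sub>R v \<in> U" if "0 \<le> s" "s \<le> h" "0 \<le> t" "t \<le> h" for s t
      using inU[OF that] by (simp add: algebra_simps)
    \<comment> \<open>The second difference of \<open>f\<close> over the parallelogram spanned by
      \<open>h *\<^sub>R v\<close> and \<open>h *\<^sub>R w\<close>. Two applications of the mean
      value theorem turn it into h^2 times a second derivative at some point of the parallelogram;
      their order decides whether this is \<open>fv\<close> in direction \<open>w\<close> or
      \<open>fw\<close> in direction \<open>v\<close>. As \<open>e\<close> is half of the assumed
      gap, the two values cannot both be within \<open>e\<close> of those at
      \<open>z\<close>.\<close>
    define \<Delta> where "\<Delta> = f (z + h *\<^sub>R v + h *\<^sub>R w) - f (z + h *\<^sub>R v) - f (z + h *\<^sub>R w) + f z"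
    have A: "\<exists>s t. 0 \<le> s \<and> s \<le> h \<and> 0 \<le> t \<and> t \<le> h \<and> \<Delta> = h * h * fv (z + s *\<^sub>R v + t *\<^sub>R w) w"
    proof -
      define G where "G s = f (z + h *\<^sub>R w + s *\<^sub>R v) - f (z + s *\<^sub>R v)" for s
      have "(G has_real_derivative f' (z + h *\<^sub>R w + s *\<^sub>R v) v - f' (z + s *\<^sub>R v) v) (at s)"
        if "0 \<le> s" "s \<le> h" for s
        unfolding G_def using inU'[OF that, of h] inU[OF that, of 0] h
        by (intro DERIV_diff line[OF f]) auto
      from MVT2[OF h this] obtain s where s: "0 < s" "s < h"
        "G h - G 0 = h * (f' (z + h *\<^sub>R w + s *\<^sub>R v) v - f' (z + s *\<^sub>R v) v)" by auto
      define H where "H t = f' (z + s *\<^sub>R v + t *\<^sub>R w) v" for t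
      have "(H has_real_derivative fv (z + s *\<^sub>R v + t *\<^sub>R w) w) (at t)"
        if "0 \<le> t" "t \<le> h" for t
        unfolding H_def using inU[OF _ _ that, of s] s by (intro line v) auto
      from MVT2[OF h this] obtain t where t: "0 < t" "t < h"
        "H h - H 0 = h * fv (z + s *\<^sub>R v + t *\<^sub>R w) w" by auto
      have "\<Delta> = G h - G 0" by (simp add: \<Delta>_def G_def algebra_simps)
      also have "\<dots> = h * (H h - H 0)" using s(3) by (simp add: H_def algebra_simps)
      finally show ?thesis using s t by (intro exI[of _ s] exI[of _ t]) auto
    qed
    have B: "\<exists>s t. 0 \<le> s \<and> s \<le> h \<and> 0 \<le> t \<and> t \<le> h \<and> \<Delta> = h * h * fw (z + s *\<^sub>R v + t *\<^sub>R w) v"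
    proof -
      define G where "G t = f (z + h *\<^sub>R v + t *\<^sub>R w) - f (z + t *\<^sub>R w)" for t
      have "(G has_real_derivative f' (z + h *\<^sub>R v + t *\<^sub>R w) w - f' (z + t *\<^sub>R w) w) (at t)"
        if "0 \<le> t" "t \<le> h" for t
        unfolding G_def using inU[OF _ _ that, of h] inU'[OF _ _ that, of 0] h
        by (intro DERIV_diff line[OF f]) auto
      from MVT2[OF h this] obtain t where t: "0 < t" "t < h"
        "G h - G 0 = h * (f' (z + h *\<^sub>R v + t *\<^sub>R w) w - f' (z + t *\<^sub>R w) w)" by auto
      define H where "H s = f' (z + t *\<^sub>R w + s *\<^sub>R v) w" for s
      have "(H has_real_derivative fw (z + t *\<^sub>R w + s *\<^sub>R v) v) (at s)"
        if "0 \<le> s" "s \<le> h" for s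
        unfolding H_def using inU'[OF that, of t] t by (intro line w) auto
      from MVT2[OF h this] obtain s where s: "0 < s" "s < h"
        "H h - H 0 = h * fw (z + t *\<^sub>R w + s *\<^sub>R v) v" by auto
      have "\<Delta> = G h - G 0" by (simp add: \<Delta>_def G_def algebra_simps)
      also have "\<dots> = h * (H h - H 0)" using t(3) by (simp add: H_def algebra_simps)
      finally show ?thesis using s t by (intro exI[of _ s] exI[of _ t]) (auto simp: algebra_simps)
    qed
    from A B obtain s t s' t' where st: "0 \<le> s" "s \<le> h" "0 \<le> t" "t \<le> h" "0 \<le> s'" "s' \<le> h" "0 \<le> t'" "t' \<le> h"
      and eq: "h * h * fv (z + s *\<^sub>R v + t *\<^sub>R w) w = h * h * fw (z + s' *\<^sub>R v + t' *\<^sub>R w) v" by metis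
    have "fv (z + s *\<^sub>R v + t *\<^sub>R w) w = fw (z + s' *\<^sub>R v + t' *\<^sub>R w) v" using eq h by simp
    moreover have "\<bar>fv (z + s *\<^sub>R v + t *\<^sub>R w) w - fv z w\<bar> < e"
      using hh[of s t] st by (intro r(2)) (auto simp: r_def dist_commute)
    moreover have "\<bar>fw (z + s' *\<^sub>R v + t' *\<^sub>R w) v - fw z v\<bar> < e"
      using hh[of s' t'] st by (intro r(4)) (auto simp: r_def dist_commute)
    ultimately show False by (simp add: e_def abs_if split: if_splits)
  qed
qed

text \<open>Continuity is asked for one pair of directions at a time, because \<open>Ck\<close>
  speaks of derivatives only along fixed vectors.\<close>

lemma mixed_partials_commute:
  fixes f :: "'a::real_normed_vector \<Rightarrow> 'b::euclidean_space"
  assumes "open U" "z \<in> U"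
    and f: "\<And>x. x \<in> U \<Longrightarrow> (f has_derivative f' x) (at x)"
    and v: "\<And>x. x \<in> U \<Longrightarrow> ((\<lambda>x. f' x v) has_derivative fv x) (at x)" "continuous_on U (\<lambda>x. fv x w)"
    and w: "\<And>x. x \<in> U \<Longrightarrow> ((\<lambda>x. f' x w) has_derivative fw x) (at x)" "continuous_on U (\<lambda>x. fw x v)"
  shows "fv z w = fw z v"
proof (rule euclidean_eqI)
  fix b :: 'b assume "b \<in> Basis"
  show "fv z w \<bullet> b = fw z v \<bullet> b"
    by (rule mixed_partials_commute_real[OF assms(1,2), of "\<lambda>x. f x \<bullet> b" "\<lambda>x y. f' x y \<bullet> b" v "\<lambda>x y. fv x y \<bullet> b" w "\<lambda>x y. fw x y \<bullet> b"])
      (auto intro!: f v w has_derivative_inner_left continuous_intros)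
qed

text \<open>If the second derivative were positive, \<open>f'\<close> would increase from its value
  0 at the maximum, and the mean value theorem would give a larger value of \<open>f\<close> just to
  the right.\<close>

lemma second_derivative_nonpos_at_local_max:
  fixes f :: "real \<Rightarrow> real"
  assumes r: "r > 0" and max: "\<And>s. \<bar>s\<bar> < r \<Longrightarrow> f s \<le> f 0"
    and d: "\<And>s. \<bar>s\<bar> < r \<Longrightarrow> (f has_real_derivative f' s) (at s)"
    and dd: "(f' has_real_derivative l) (at 0)"
  shows "l \<le> 0"
proof (rule ccontr)
  assume "\<not> l \<le> 0"
  have f0: "f' 0 = 0"
    by (rule DERIV_local_max[OF d r]) (use r max in auto)
  from has_real_derivative_pos_inc_right[OF dd[unfolded has_field_derivative_def[symmetric]]] \<open>\<not> l \<le> 0\<close>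
  obtain e where e: "e > 0" "\<And>h. 0 < h \<Longrightarrow> h < e \<Longrightarrow> f' 0 < f' h"
    by fastforce
  define h where "h = min e r / 2"
  have h: "0 < h" "h < e" "h < r" using e r by (auto simp: h_def min_def)
  have "\<exists>z. 0 < z \<and> z < h \<and> f h - f 0 = (h - 0) * f' z"
    using h by (intro MVT2) (auto intro!: d)
  then obtain z where z: "0 < z" "z < h" "f h - f 0 = h * f' z" by auto
  have "f' z > 0" using e(2)[of z] z h f0 by auto
  then have "f h > f 0" using z h by (smt (verit) mult_pos_pos)
  moreover have "f h \<le> f 0" using h by (intro max) auto
  ultimately show False by simp
qed


text \<open>Hopf's argument: at a point \<open>p\<close> where a disc free of maxima touches the set of maxima, the quadratic
  \<open>2\<rho>s + 3s\<^sup>2 - 2t\<^sup>2\<close> (\<open>s\<close> in the direction of the centre of the disc, whose radius is \<open>\<rho>\<close>) has positive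
  Laplacian and is negative outside the disc.\<close>

lemma strong_maximum_principle_ball:
  fixes g :: "complex \<Rightarrow> real"
  assumes R: "R > 0"
    and g: "\<And>z. z \<in> ball z0 R \<Longrightarrow> (g has_derivative g' z) (at z)"
    and gx: "\<And>z. z \<in> ball z0 R \<Longrightarrow> ((\<lambda>z. g' z 1) has_derivative gx z) (at z)"
    and gy: "\<And>z. z \<in> ball z0 R \<Longrightarrow> ((\<lambda>z. g' z \<i>) has_derivative gy z) (at z)"
    and lap: "\<And>z. z \<in> ball z0 R \<Longrightarrow> 0 \<le> gx z 1 + gy z \<i>"
    and max: "\<And>z. z \<in> ball z0 R \<Longrightarrow> g z \<le> g z0"
    and z1: "z1 \<in> ball z0 (R / 2)"
  shows "g z1 = g z0"
proof (rule ccontr)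
  assume ne: "g z1 \<noteq> g z0"
  define S where "S = {z \<in> cball z1 (dist z1 z0). g z = g z0}"
  have sub: "cball z1 (dist z1 z0) \<subseteq> ball z0 R"
  proof
    fix z assume "z \<in> cball z1 (dist z1 z0)"
    then show "z \<in> ball z0 R" using z1 dist_triangle[of z0 z z1] by (auto simp: dist_commute)
  qed
  have cont: "continuous_on (ball z0 R) g"
    using g by (meson continuous_at_imp_continuous_on has_derivative_continuous)
  have "closed S" unfolding S_def
    by (intro continuous_closed_preimage_constant continuous_on_subset[OF cont sub]) auto
  moreover have "z0 \<in> S" by (simp add: S_def)
  \<comment> \<open>The maximum point closest to \<open>z1\<close>: the open disc of radius \<rho>
    about \<open>z1\<close> is free of maxima and has \<open>p\<close> on its boundary.\<close>
  ultimately obtain p where p: "p \<in> S" "\<And>z. z \<in> S \<Longrightarrow> dist z1 p \<le> dist z1 z"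
    using distance_attains_inf[of S z1] by (metis empty_iff)
  define \<rho> where "\<rho> = dist z1 p"
  have gp: "g p = g z0" and p1: "dist z1 p \<le> dist z1 z0" using p by (auto simp: S_def)
  have \<rho>: "\<rho> > 0" using ne gp by (auto simp: \<rho>_def)
  have pR: "p \<in> ball z0 R" using p1 sub by auto
  have inside: "g z < g z0" if "dist z1 z < \<rho>" for z
  proof -
    have z: "z \<in> cball z1 (dist z1 z0)" using that p1 by (auto simp: \<rho>_def)
    then have "z \<notin> S" using p(2)[of z] that by (auto simp: \<rho>_def)
    then have "g z \<noteq> g z0" using z by (auto simp: S_def)
    then show ?thesis using max[of z] z sub by force
  qed
  obtain r where r: "r > 0" "ball p r \<subseteq> ball z0 R" using pR open_ball openE by blast
  \<comment> \<open>The bound \<rho> / 3 carries over to |s|; it makes 2 \<rho> + 3 s positive, and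
    5 s^2 smaller than 2 \<rho> s when s > 0. The bound by r / 2 keeps the closed disc in the
    domain.\<close>
  define \<delta> where "\<delta> = min (r / 2) (\<rho> / 3)"
  have \<delta>: "\<delta> > 0" "\<delta> \<le> \<rho> / 3" "\<delta> < r" using r \<rho> by (auto simp: \<delta>_def)
  have cb: "cball p \<delta> \<subseteq> ball z0 R" using r \<delta> by fastforce
  \<comment> \<open>Multiplication by this unit number turns the direction from \<open>p\<close> to
    \<open>z1\<close> into the positive real axis.\<close>
  define c where "c = cnj (z1 - p) / of_real \<rho>"
  have c1: "cmod c = 1" using \<rho> by (simp add: c_def norm_divide \<rho>_def dist_norm del: complex_cnj_diff)
  have c2: "(Re c)\<^sup>2 + (Im c)\<^sup>2 = 1" using c1 by (simp add: cmod_def)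
  define s t where "s z = Re ((z - p) * c)" and "t z = Im ((z - p) * c)" for z
  have st: "(s z)\<^sup>2 + (t z)\<^sup>2 = (dist z p)\<^sup>2" for z
    using c1 by (metis cmod_power2 dist_norm mult.right_neutral norm_mult s_def t_def)
  define h where "h z = 2 * \<rho> * s z + 3 * (s z)\<^sup>2 - 2 * (t z)\<^sup>2" for z
  \<comment> \<open>In the rotated coordinates the squared distance to \<open>z1\<close> is (\<rho>
    - s)^2 + t^2. Nonnegativity of \<open>h\<close> bounds t^2 by \<rho> s + (3/2) s^2, which puts
    the distance below \<rho> once s > 0; and s \<le> 0 would force z = p.\<close>
  have hin: "dist z1 z < \<rho>" if z: "dist z p \<le> \<delta>" "z \<noteq> p" "h z \<ge> 0" for z
  proof -
    have "(z1 - p) * cnj (z1 - p) = of_real (\<rho>\<^sup>2)"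
      by (simp only: complex_norm_square \<rho>_def dist_norm)
    then have "(z1 - p) * c = of_real \<rho>"
      using \<rho> by (simp add: c_def power2_eq_square del: complex_cnj_diff)
    then have "(z1 - z) * c = of_real \<rho> - (z - p) * c" by (simp add: algebra_simps)
    moreover have "(dist z1 z)\<^sup>2 = (cmod ((z1 - z) * c))\<^sup>2" using c1 by (simp add: norm_mult dist_norm)
    ultimately have d: "(dist z1 z)\<^sup>2 = (\<rho> - s z)\<^sup>2 + (t z)\<^sup>2"
      by (simp add: cmod_power2 s_def t_def) (simp add: power2_eq_square algebra_simps)
    have "\<bar>s z\<bar> \<le> dist z p"
      using st[of z] by (metis abs_le_square_iff abs_of_nonneg le_add_same_cancel1 zero_le_dist zero_le_power2)
    then have sz: "\<bar>s z\<bar> \<le> \<rho> / 3" using z \<delta> by linarith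
    have "s z > 0"
    proof (rule ccontr)
      assume "\<not> s z > 0"
      then have "s z \<le> 0" by simp
      have "2 * \<rho> + 3 * s z > 0" using sz \<rho> by linarith
      then have "s z * (2 * \<rho> + 3 * s z) \<le> 0" using \<open>s z \<le> 0\<close> by (simp add: mult_le_0_iff)
      moreover have "s z * (2 * \<rho> + 3 * s z) \<ge> 2 * (t z)\<^sup>2"
        using z(3) by (simp add: h_def power2_eq_square algebra_simps)
      ultimately have t0: "2 * (t z)\<^sup>2 \<le> 0" and s0: "s z * (2 * \<rho> + 3 * s z) = 0"
        using zero_le_power2[of "t z"] by linarith+
      have "t z = 0" using t0 by simp
      have "s z = 0" using s0 \<open>2 * \<rho> + 3 * s z > 0\<close> by simp
      with \<open>t z = 0\<close> st[of z] z(2) show False by simp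
    qed
    have "2 * (t z)\<^sup>2 \<le> 2 * \<rho> * s z + 3 * (s z)\<^sup>2" using z(3) by (simp add: h_def)
    moreover have "5 * (s z)\<^sup>2 < 2 * \<rho> * s z"
      using \<open>s z > 0\<close> sz \<rho> by (simp add: power2_eq_square)
    ultimately have "(\<rho> - s z)\<^sup>2 + (t z)\<^sup>2 < \<rho>\<^sup>2" by (simp add: power2_eq_square algebra_simps)
    then show ?thesis using d \<rho> by (metis less_imp_le power2_less_imp_less)
  qed
  have conth: "continuous_on A h" for A
    unfolding h_def s_def t_def by (intro continuous_intros)
  define T where "T = {z \<in> sphere p \<delta>. 0 \<le> h z}"
  have Tlt: "g z < g z0" if "z \<in> T" for z
    using that \<delta> by (intro inside hin) (auto simp: T_def dist_commute)
  have "closed T" unfolding T_def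
    using continuous_closed_preimage[OF conth[of "sphere p \<delta>"], of "{0..}"]
    by (simp add: vimage_def Int_def conj_commute)
  then have "compact T" by (simp add: T_def compact_eq_bounded_closed bounded_subset[OF bounded_sphere[of p \<delta>]] subset_iff)
  \<comment> \<open>On the arc \<open>T\<close>, where \<open>h\<close> is nonnegative,
    \<open>g\<close> stays below its maximum by a definite amount, and \<open>e\<close> is so small
    that \<open>e * h\<close> uses up at most half of it. The summand 1 in the denominator covers
    the case \<open>h zh = 0\<close>.\<close>
  obtain \<epsilon> where \<epsilon>: "\<epsilon> > 0" "\<And>z. z \<in> T \<Longrightarrow> g z + \<epsilon> * h z < g z0"
  proof (cases "T = {}")
    case True
    then show ?thesis using that[of 1] by auto
  next
    case False
    have "continuous_on T g"
      using cb by (intro continuous_on_subset[OF cont]) (auto simp: T_def)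
    then obtain zg where zg: "zg \<in> T" "\<And>z. z \<in> T \<Longrightarrow> g z \<le> g zg"
      using continuous_attains_sup[OF \<open>compact T\<close> False] by metis
    obtain zh where zh: "zh \<in> T" "\<And>z. z \<in> T \<Longrightarrow> h z \<le> h zh"
      using continuous_attains_sup[OF \<open>compact T\<close> False conth] by metis
    define e where "e = (g z0 - g zg) / (2 * (1 + h zh))"
    have h0: "h zh \<ge> 0" using zh by (auto simp: T_def)
    have "e > 0" using h0 Tlt[OF zg(1)] by (simp add: e_def)
    moreover have "g z + e * h z < g z0" if "z \<in> T" for z
    proof -
      have "e * h z \<le> e * (1 + h zh)" using \<open>e > 0\<close> zh(2)[OF that] by (intro mult_left_mono) auto
      also have "\<dots> = (g z0 - g zg) / 2" using h0 by (simp add: e_def field_simps)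
      finally show ?thesis using zg(2)[OF that] Tlt[OF zg(1)] by simp
    qed
    ultimately show ?thesis using that by blast
  qed
  \<comment> \<open>As \<open>h p = 0\<close>, the perturbed function still has the value
    \<open>g z0\<close> at the centre \<open>p\<close>, but it is smaller on the whole circle. Its
    maximum over the closed disc is therefore interior.\<close>
  define G where "G z = g z + \<epsilon> * h z" for z
  have "continuous_on (cball p \<delta>) G"
    unfolding G_def by (intro continuous_intros conth continuous_on_subset[OF cont cb])
  then obtain q where q: "q \<in> cball p \<delta>" "\<And>z. z \<in> cball p \<delta> \<Longrightarrow> G z \<le> G q"
    using continuous_attains_sup[of "cball p \<delta>" G] \<delta> by (metis centre_in_cball compact_cball empty_iff less_imp_le)
  have "G p = g z0" by (simp add: G_def h_def s_def t_def gp)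
  then have Gq: "G q \<ge> g z0" using q(2)[of p] \<delta> by simp
  have "q \<notin> sphere p \<delta>"
  proof
    assume qs: "q \<in> sphere p \<delta>"
    have "G q < g z0"
    proof (cases "h q \<ge> 0")
      case True
      then show ?thesis using \<epsilon>(2)[of q] qs by (simp add: T_def G_def)
    next
      case False
      then have "\<epsilon> * h q < 0" using \<epsilon>(1) by (simp add: mult_less_0_iff)
      then show ?thesis using max[of q] q(1) cb by (auto simp: G_def)
    qed
    with Gq show False by simp
  qed
  then have "q \<in> ball p \<delta>" using q(1) by auto
  then obtain \<eta> where \<eta>: "\<eta> > 0" "ball q \<eta> \<subseteq> ball p \<delta>" using open_ball openE by blast
  \<comment> \<open>Second derivative test for \<open>G\<close> along the line through
    \<open>q\<close> in direction \<open>v\<close>. The expression 6 Re^2 - 4 Im^2 is the second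
    derivative of \<open>h\<close> along this line.\<close>
  have dir: "l + \<epsilon> * (6 * (Re (v * c))\<^sup>2 - 4 * (Im (v * c))\<^sup>2) \<le> 0"
    if v: "cmod v = 1" and dd: "((\<lambda>z. g' z v) has_derivative d) (at q)" and l: "l = d v" for v d l
  proof -
    have inb: "q + of_real \<tau> * v \<in> ball q \<eta>" if "\<bar>\<tau>\<bar> < \<eta>" for \<tau>
      using that v by (simp add: dist_norm norm_mult)
    have inR: "q + of_real \<tau> * v \<in> ball z0 R" if "\<bar>\<tau>\<bar> < \<eta>" for \<tau>
      using inb[OF that] \<eta>(2) cb by (meson ball_subset_cball subsetD)
    have line: "((\<lambda>\<tau>. F (q + of_real \<tau> * v)) has_real_derivative F' v) (at \<tau>)"
      if "(F has_derivative F') (at (q + of_real \<tau> * v))" for F :: "complex \<Rightarrow> real" and F' \<tau>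
    proof -
      have "((\<lambda>\<tau>. F (q + of_real \<tau> * v)) has_derivative (\<lambda>h. F' (of_real h * v))) (at \<tau>)"
        by (rule has_derivative_compose[where g = F and f = "\<lambda>\<tau>. q + of_real \<tau> * v" and f' = "\<lambda>h. of_real h * v", OF _ that])
          (auto intro!: derivative_eq_intros)
      moreover have "(\<lambda>h. F' (of_real h * v)) = (*) (F' v)"
        using linear_cmul[OF has_derivative_linear[OF that]] by (auto simp: scaleR_conv_of_real[symmetric])
      ultimately show ?thesis by (simp add: has_field_derivative_def)
    qed
    have sd: "((\<lambda>\<tau>. s (q + of_real \<tau> * v)) has_real_derivative Re (v * c)) (at \<tau>)"
      "((\<lambda>\<tau>. t (q + of_real \<tau> * v)) has_real_derivative Im (v * c)) (at \<tau>)" for \<tau>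
      unfolding s_def t_def by (auto intro!: derivative_eq_intros simp: algebra_simps)
    have hd: "((\<lambda>\<tau>. h (q + of_real \<tau> * v)) has_real_derivative
        2 * \<rho> * Re (v * c) + 6 * s (q + of_real \<tau> * v) * Re (v * c) - 4 * t (q + of_real \<tau> * v) * Im (v * c)) (at \<tau>)" for \<tau>
      unfolding h_def
      by (rule DERIV_cong[OF DERIV_diff[OF DERIV_add[OF DERIV_cmult[OF sd(1)] DERIV_cmult[OF DERIV_power[OF sd(1)]]]
            DERIV_cmult[OF DERIV_power[OF sd(2)]]]]) (simp add: algebra_simps)
    have hdd: "((\<lambda>\<tau>. 2 * \<rho> * Re (v * c) + 6 * s (q + of_real \<tau> * v) * Re (v * c) - 4 * t (q + of_real \<tau> * v) * Im (v * c))
        has_real_derivative 6 * (Re (v * c))\<^sup>2 - 4 * (Im (v * c))\<^sup>2) (at 0)"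
      by (rule DERIV_cong[OF DERIV_diff[OF DERIV_add[OF DERIV_const DERIV_cmult_right[OF DERIV_cmult[OF sd(1)]]]
            DERIV_cmult_right[OF DERIV_cmult[OF sd(2)]]]]) (simp add: power2_eq_square algebra_simps)
    show ?thesis
    proof (rule second_derivative_nonpos_at_local_max[OF \<eta>(1), of "\<lambda>\<tau>. G (q + of_real \<tau> * v)"
          "\<lambda>\<tau>. g' (q + of_real \<tau> * v) v + \<epsilon> * (2 * \<rho> * Re (v * c) + 6 * s (q + of_real \<tau> * v) * Re (v * c) - 4 * t (q + of_real \<tau> * v) * Im (v * c))"])
      fix \<tau> assume \<tau>: "\<bar>\<tau>\<bar> < \<eta>"
      show "G (q + of_real \<tau> * v) \<le> G (q + of_real 0 * v)"
        using subsetD[OF ball_subset_cball subsetD[OF \<eta>(2) inb[OF \<tau>]]] by (auto intro!: q(2) simp del: mem_ball mem_cball)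
      show "((\<lambda>\<tau>. G (q + of_real \<tau> * v)) has_real_derivative
          g' (q + of_real \<tau> * v) v + \<epsilon> * (2 * \<rho> * Re (v * c) + 6 * s (q + of_real \<tau> * v) * Re (v * c) - 4 * t (q + of_real \<tau> * v) * Im (v * c))) (at \<tau>)"
        unfolding G_def by (intro DERIV_add DERIV_cmult hd line g inR \<tau>)
    next
      have "((\<lambda>\<tau>. g' (q + of_real \<tau> * v) v) has_real_derivative d v) (at 0)"
        using dd by (intro line[where F = "\<lambda>z. g' z v"]) simp
      then show "((\<lambda>\<tau>. g' (q + of_real \<tau> * v) v + \<epsilon> * (2 * \<rho> * Re (v * c) + 6 * s (q + of_real \<tau> * v) * Re (v * c) - 4 * t (q + of_real \<tau> * v) * Im (v * c)))
          has_real_derivative l + \<epsilon> * (6 * (Re (v * c))\<^sup>2 - 4 * (Im (v * c))\<^sup>2)) (at 0)"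
        unfolding l by (intro DERIV_add DERIV_cmult hdd)
    qed
  qed
  have qR: "q \<in> ball z0 R" using q(1) cb by auto
  have "gx q 1 + \<epsilon> * (6 * (Re c)\<^sup>2 - 4 * (Im c)\<^sup>2) \<le> 0"
    using dir[OF _ gx[OF qR] refl] by simp
  moreover have "gy q \<i> + \<epsilon> * (6 * (Im c)\<^sup>2 - 4 * (Re c)\<^sup>2) \<le> 0"
    using dir[OF _ gy[OF qR] refl] by simp
  \<comment> \<open>The directions 1 and \<open>\<i>\<close> together give the Laplacian, which is 6
    - 4 = 2 for \<open>h\<close>. This makes the inequality strict although the Laplacian of
    \<open>g\<close> is only nonnegative.\<close>
  moreover have "\<epsilon> * (6 * (Re c)\<^sup>2 - 4 * (Im c)\<^sup>2) + \<epsilon> * (6 * (Im c)\<^sup>2 - 4 * (Re c)\<^sup>2) = 2 * \<epsilon>"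
  proof -
    have "\<epsilon> * (6 * (Re c)\<^sup>2 - 4 * (Im c)\<^sup>2) + \<epsilon> * (6 * (Im c)\<^sup>2 - 4 * (Re c)\<^sup>2) = 2 * \<epsilon> * ((Re c)\<^sup>2 + (Im c)\<^sup>2)"
      by (simp add: algebra_simps)
    then show ?thesis using c2 by simp
  qed
  ultimately show False using lap[OF qR] \<epsilon>(1) by linarith
qed

section \<open>Holomorphic curves are subharmonic\<close>

text \<open>\<open>Ck\<close> gives a separate second derivative for each fixed first direction;
  choice collects them into one function whose first argument is that direction.\<close>

lemma smooth_onE_C2:
  assumes "smooth_on U f"
  obtains f' f'' where "\<And>x. x \<in> U \<Longrightarrow> (f has_derivative f' x) (at x)"
    "\<And>x v. x \<in> U \<Longrightarrow> ((\<lambda>x. f' x v) has_derivative f'' v x) (at x)"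
    "\<And>v w. continuous_on U (\<lambda>x. f'' v x w)"
proof -
  have "Ck (Suc (Suc 0)) U f" using assms by (auto simp: smooth_on_def simp del: Ck.simps)
  then obtain f' where f': "\<forall>x\<in>U. (f has_derivative f' x) (at x)"
    and "\<forall>v. \<exists>g. (\<forall>x\<in>U. ((\<lambda>x. f' x v) has_derivative g x) (at x)) \<and> (\<forall>w. continuous_on U (\<lambda>x. g x w))"
    by auto
  then obtain f'' where "\<forall>v. (\<forall>x\<in>U. ((\<lambda>x. f' x v) has_derivative f'' v x) (at x)) \<and> (\<forall>w. continuous_on U (\<lambda>x. f'' v x w))"
    by metis
  with f' show ?thesis using that by blast
qed

lemma smooth_on_open: "smooth_on U f \<Longrightarrow> open U"
  by (simp add: smooth_on_def)

lemma smooth_on_differentiable: "smooth_on U f \<Longrightarrow> x \<in> U \<Longrightarrow> f differentiable (at x)"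
  by (metis smooth_onE_C2 differentiableI)

text \<open>A tangent vector has to be realized by a curve that stays in \<open>M\<close> for all
  real times, while \<open>u\<close> is controlled only near \<open>z\<close>. The reparametrization
  \<open>c * sin (s / c)\<close> stays below \<open>r\<close> in absolute value and has derivative 1
  at 0.\<close>

lemma tangentI:
  assumes u: "(u has_derivative u') (at z)" and r: "r > 0"
    and M: "\<And>s. \<bar>s\<bar> < r \<Longrightarrow> u (z + s *\<^sub>R v) \<in> M"
  shows "u' v \<in> tangent M (u z)"
proof -
  define c where "c = r / 2"
  have c: "c > 0" using r by (simp add: c_def)
  define b where "b s = u (z + (c * sin (s / c)) *\<^sub>R v)" for s
  have "b s \<in> M" for s
  proof -
    have "\<bar>c * sin (s / c)\<bar> \<le> c" using c by (simp add: abs_mult)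
    then show ?thesis unfolding b_def using r by (intro M) (simp add: c_def)
  qed
  moreover have "(b has_vector_derivative u' v) (at 0)"
  proof -
    have "((\<lambda>s. z + (c * sin (s / c)) *\<^sub>R v) has_derivative (\<lambda>h. h *\<^sub>R v)) (at 0)"
      using c by (auto intro!: derivative_eq_intros)
    then have "(b has_derivative (\<lambda>h. u' (h *\<^sub>R v))) (at 0)"
      unfolding b_def by (rule has_derivative_compose) (simp add: u)
    moreover have "(\<lambda>h. u' (h *\<^sub>R v)) = (\<lambda>h. h *\<^sub>R u' v)"
      using linear_cmul[OF has_derivative_linear[OF u]] by simp
    ultimately show ?thesis by (simp add: has_vector_derivative_def)
  qed
  ultimately show ?thesis by (auto simp: tangent_def b_def intro!: exI[of _ b])
qed

lemma tangentI_open: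
  assumes "(u has_derivative u') (at z)" "open \<Omega>" "z \<in> \<Omega>" "u ` \<Omega> \<subseteq> M"
  shows "u' v \<in> tangent M (u z)"
proof -
  obtain r where r: "r > 0" "ball z r \<subseteq> \<Omega>" using assms(2,3) openE by blast
  have pos: "0 < 1 + norm v" by (smt (verit) norm_ge_zero)
  show ?thesis
  proof (rule tangentI[OF assms(1), of "r / (1 + norm v)"])
    fix s :: real assume s: "\<bar>s\<bar> < r / (1 + norm v)"
    have "\<bar>s\<bar> * norm v \<le> \<bar>s\<bar> * (1 + norm v)" by (simp add: mult_left_mono)
    also have "\<dots> < r" using s pos by (simp add: pos_less_divide_eq)
    finally have "z + s *\<^sub>R v \<in> ball z r" by (simp add: dist_norm)
    then show "u (z + s *\<^sub>R v) \<in> M" using r assms(4) by blast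
  qed (use r pos in auto)
qed

text \<open>Being defined through curves, \<open>tangent\<close> is not visibly closed under
  addition. A slice chart identifies it with the image of a linear subspace: curves in
  \<open>M\<close> have their charted velocity in \<open>L\<close>, and straight segments in
  \<open>L\<close> come back as curves in \<open>M\<close>.\<close>

lemma subspace_tangent:
  assumes "submanifold d M" "x \<in> M"
  shows "subspace (tangent M x)"
proof -
  obtain U V \<phi> \<psi> and L :: "'a set" where chart: "x \<in> U \<and> smooth_on U \<phi> \<and> smooth_on V \<psi> \<and> \<phi> ` U = V \<and> \<psi> ` V = U \<and>
      (\<forall>y\<in>U. \<psi> (\<phi> y) = y) \<and> (\<forall>y\<in>V. \<phi> (\<psi> y) = y) \<and> subspace L \<and> dim L = d \<and> \<phi> ` (U \<inter> M) = V \<inter> L"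
    using bspec[OF assms(1)[unfolded submanifold_def] assms(2)] by (elim exE) (rule that)
  then have x: "x \<in> U" and sm: "smooth_on U \<phi>" "smooth_on V \<psi>" and UV: "\<phi> ` U = V" "\<psi> ` V = U"
    and inv: "\<forall>y\<in>U. \<psi> (\<phi> y) = y" "\<forall>y\<in>V. \<phi> (\<psi> y) = y" and L: "subspace L" "\<phi> ` (U \<inter> M) = V \<inter> L"
    by simp_all
  obtain \<phi>' where \<phi>': "(\<phi> has_derivative \<phi>') (at x)"
    using smooth_on_differentiable[OF sm(1) x] by (auto simp: differentiable_def)
  have px: "\<phi> x \<in> V" "\<phi> x \<in> L" using x UV L assms(2) by auto
  obtain \<psi>' where \<psi>': "(\<psi> has_derivative \<psi>') (at (\<phi> x))"
    using smooth_on_differentiable[OF sm(2) px(1)] by (auto simp: differentiable_def)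
  have id: "\<psi>' (\<phi>' v) = v" for v
  proof -
    have "((\<lambda>y. \<psi> (\<phi> y)) has_derivative (\<lambda>h. \<psi>' (\<phi>' h))) (at x)"
      by (rule has_derivative_compose[OF \<phi>' \<psi>'])
    then have "((\<lambda>y. y) has_derivative (\<lambda>h. \<psi>' (\<phi>' h))) (at x)"
      by (rule has_derivative_transform_within_open[OF _ smooth_on_open[OF sm(1)] x]) (use inv in auto)
    then have "(\<lambda>h. \<psi>' (\<phi>' h)) = (\<lambda>h. h)"
      using has_derivative_unique has_derivative_ident by blast
    then show ?thesis by metis
  qed
  have "tangent M x = \<psi>' ` L"
  proof (intro equalityI subsetI)
    fix v assume "v \<in> tangent M x"
    then obtain b where b: "b 0 = x" "\<And>s::real. b s \<in> M" "(b has_vector_derivative v) (at 0)"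
      by (auto simp: tangent_def)
    have "((\<lambda>s. \<phi> (b s)) has_derivative (\<lambda>h. \<phi>' (h *\<^sub>R v))) (at 0)"
      by (rule has_derivative_compose[OF b(3)[unfolded has_vector_derivative_def]]) (simp add: b(1) \<phi>')
    then have d: "((\<lambda>s. \<phi> (b s)) has_vector_derivative \<phi>' v) (at 0)"
      using linear_cmul[OF has_derivative_linear[OF \<phi>']] by (simp add: has_vector_derivative_def)
    have "isCont b 0" using b(3) has_vector_derivative_continuous by blast
    then have "\<forall>\<^sub>F s in at 0. b s \<in> U"
      using smooth_on_open[OF sm(1)] x b(1) by (auto simp: isCont_def tendsto_def)
    then have "\<forall>\<^sub>F s in at 0. (\<phi> (b s) - \<phi> (b 0)) /\<^sub>R (s - 0) \<in> L"
    proof eventually_elim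
      case (elim s)
      then have "\<phi> (b s) \<in> L" using L(2) b(2) by blast
      then show ?case using px b(1) L(1) by (simp add: subspace_diff subspace_scale)
    qed
    \<comment> \<open>The difference quotients lie in \<open>L\<close>, which is closed, hence so
      does their limit, the velocity of the charted curve.\<close>
    moreover have "((\<lambda>s. (\<phi> (b s) - \<phi> (b 0)) /\<^sub>R (s - 0)) \<longlongrightarrow> \<phi>' v) (at 0)"
    proof (rule LIM_zero_cancel, rule tendsto_norm_zero_cancel)
      have "((\<lambda>s. norm (\<phi> (b s) - \<phi> (b 0) - s *\<^sub>R \<phi>' v) / \<bar>s\<bar>) \<longlongrightarrow> 0) (at 0)"
        using d by (simp add: has_vector_derivative_def has_derivative_iff_norm)
      moreover have "norm (\<phi> (b s) - \<phi> (b 0) - s *\<^sub>R \<phi>' v) / \<bar>s\<bar> = norm ((\<phi> (b s) - \<phi> (b 0)) /\<^sub>R (s - 0) - \<phi>' v)"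
        if "s \<noteq> 0" for s
      proof -
        have "(\<phi> (b s) - \<phi> (b 0)) /\<^sub>R s - \<phi>' v = (\<phi> (b s) - \<phi> (b 0) - s *\<^sub>R \<phi>' v) /\<^sub>R s"
          using that by (simp add: scaleR_diff_right)
        then show ?thesis by (simp add: divide_inverse mult.commute)
      qed
      ultimately show "((\<lambda>s. norm ((\<phi> (b s) - \<phi> (b 0)) /\<^sub>R (s - 0) - \<phi>' v)) \<longlongrightarrow> 0) (at 0)"
        using Lim_transform_eventually[of _ 0 "at 0" "\<lambda>s. norm ((\<phi> (b s) - \<phi> (b 0)) /\<^sub>R (s - 0) - \<phi>' v)"]
        by (simp add: eventually_at_filter)
    qed
    ultimately have "\<phi>' v \<in> L"
      using Lim_in_closed_set[OF closed_subspace[OF L(1)]] by (metis trivial_limit_at)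
    then show "v \<in> \<psi>' ` L" using id by (metis image_eqI)
  next
    fix v assume "v \<in> \<psi>' ` L"
    then obtain l where l: "l \<in> L" "v = \<psi>' l" by auto
    obtain r where r: "r > 0" "ball (\<phi> x) r \<subseteq> V" using smooth_on_open[OF sm(2)] px openE by blast
    have pos: "0 < 1 + norm l" by (smt (verit) norm_ge_zero)
    have "\<psi>' l \<in> tangent M (\<psi> (\<phi> x))"
    proof (rule tangentI[OF \<psi>', of "r / (1 + norm l)"])
      fix s :: real assume s: "\<bar>s\<bar> < r / (1 + norm l)"
      have "\<bar>s\<bar> * norm l \<le> \<bar>s\<bar> * (1 + norm l)" by (simp add: mult_left_mono)
      also have "\<dots> < r" using s pos by (simp add: pos_less_divide_eq)
      finally have "\<phi> x + s *\<^sub>R l \<in> V" using r(2) by (auto simp: dist_norm subset_iff)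
      moreover have "\<phi> x + s *\<^sub>R l \<in> L" using L(1) l px by (simp add: subspace_add subspace_scale)
      ultimately have "\<phi> x + s *\<^sub>R l \<in> \<phi> ` (U \<inter> M)" using L(2) by blast
      then show "\<psi> (\<phi> x + s *\<^sub>R l) \<in> M" using inv by auto
    qed (use r pos in auto)
    then show "v \<in> tangent M x" using l inv x by simp
  qed
  moreover have "subspace (\<psi>' ` L)"
    using linear_subspace_image[OF has_derivative_linear[OF \<psi>'] L(1)] .
  ultimately show ?thesis by simp
qed

section \<open>Calculus of the contact form\<close>

lemma contact_manifoldE_form:
  assumes "contact_manifold D"
  obtains U where "open U" "mfd D \<subseteq> U" "\<And>x. x \<in> U \<Longrightarrow> linear (cform D x)" "\<And>v. smooth_on U (\<lambda>x. cform D x v)"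
  using assms unfolding contact_manifold_def by blast

lemma linear_cform: "contact_manifold D \<Longrightarrow> x \<in> mfd D \<Longrightarrow> linear (cform D x)"
  by (metis contact_manifoldE_form subsetD)

lemma cform_has_frechet_derivative:
  assumes "contact_manifold D" "x \<in> mfd D"
  shows "((\<lambda>y. cform D y v) has_derivative frechet_derivative (\<lambda>y. cform D y v) (at x)) (at x)"
  by (metis assms contact_manifoldE_form subsetD smooth_on_differentiable frechet_derivative_works)

text \<open>The identities for sums and multiples of \<open>v\<close> can be differentiated at
  \<open>x\<close> because \<open>cform\<close> is linear on a whole neighbourhood of the
  manifold.\<close>

lemma linear_frechet_derivative_cform:
  fixes D :: "('a::euclidean_space, 'b) sft_data_scheme"
  assumes D: "contact_manifold D" and x: "x \<in> mfd D"
  shows "linear (\<lambda>v. frechet_derivative (\<lambda>y. cform D y v) (at x) w)"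
proof -
  obtain U where U: "open U" "mfd D \<subseteq> U" "\<And>x. x \<in> U \<Longrightarrow> linear (cform D x)"
    using contact_manifoldE_form[OF D] by metis
  let ?d = "\<lambda>v. frechet_derivative (\<lambda>y. cform D y v) (at x)"
  note d = cform_has_frechet_derivative[OF D x]
  show ?thesis
  proof (rule linearI)
    fix v v'
    have "((\<lambda>y. cform D y (v + v')) has_derivative (\<lambda>h. ?d v h + ?d v' h)) (at x)"
      by (rule has_derivative_transform_within_open[OF has_derivative_add[OF d d] U(1)])
        (use U x in \<open>auto simp: linear_add\<close>)
    then have "?d (v + v') = (\<lambda>h. ?d v h + ?d v' h)"
      using frechet_derivative_at by metis
    then show "?d (v + v') w = ?d v w + ?d v' w" by simp
  next
    fix c v
    have "((\<lambda>y. cform D y (c *\<^sub>R v)) has_derivative (\<lambda>h. c *\<^sub>R ?d v h)) (at x)"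
      by (rule has_derivative_transform_within_open[OF has_derivative_scaleR_right[OF d] U(1)])
        (use U x in \<open>auto simp: linear_cmul\<close>)
    then have "?d (c *\<^sub>R v) = (\<lambda>h. c *\<^sub>R ?d v h)"
      using frechet_derivative_at by metis
    then show "?d (c *\<^sub>R v) w = c *\<^sub>R ?d v w" by simp
  qed
qed

lemma linear_dcform: "contact_manifold D \<Longrightarrow> x \<in> mfd D \<Longrightarrow> linear (dcform D x v)"
  unfolding dcform_def[abs_def]
  by (intro linear_compose_sub linear_frechet_derivative_cform has_derivative_linear[OF cform_has_frechet_derivative])

lemma dcform_antisym: "dcform D x v w = - dcform D x w v"
  by (simp add: dcform_def)

lemma euclidean_linear_expansion:
  fixes f :: "'a::euclidean_space \<Rightarrow> real"
  assumes "linear f"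
  shows "f v = (\<Sum>b\<in>Basis. (v \<bullet> b) * f b)"
proof -
  have "f v = f (\<Sum>b\<in>Basis. (v \<bullet> b) *\<^sub>R b)" by (simp add: euclidean_representation)
  also have "\<dots> = (\<Sum>b\<in>Basis. (v \<bullet> b) * f b)"
    by (simp add: linear_sum[OF assms] linear_cmul[OF assms])
  finally show ?thesis .
qed

text \<open>A product rule: \<open>cform\<close> is known to be differentiable with a fixed vector
  inserted, so the moving vector \<open>V\<close> is first expanded in the standard basis.\<close>

lemma cform_along_has_derivative:
  fixes D :: "('a::euclidean_space, 'b) sft_data_scheme"
  assumes D: "contact_manifold D" and pz: "p z \<in> mfd D"
    and p: "(p has_derivative p') (at z)" and V: "(V has_derivative V') (at z)"
  shows "((\<lambda>z. cform D (p z) (V z)) has_derivative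
    (\<lambda>h. frechet_derivative (\<lambda>y. cform D y (V z)) (at (p z)) (p' h) + cform D (p z) (V' h))) (at z)"
proof -
  obtain U where U: "open U" "mfd D \<subseteq> U" "\<And>x. x \<in> U \<Longrightarrow> linear (cform D x)"
    using contact_manifoldE_form[OF D] by metis
  let ?d = "\<lambda>v. frechet_derivative (\<lambda>y. cform D y v) (at (p z))"
  have "((\<lambda>z. \<Sum>b\<in>Basis. (V z \<bullet> b) * cform D (p z) b) has_derivative
      (\<lambda>h. \<Sum>b\<in>Basis. (V z \<bullet> b) * ?d b (p' h) + (V' h \<bullet> b) * cform D (p z) b)) (at z)"
    by (intro has_derivative_sum has_derivative_mult has_derivative_inner_left V
        has_derivative_compose[OF p cform_has_frechet_derivative[OF D pz]])
  moreover have "(\<Sum>b\<in>Basis. (V z \<bullet> b) * ?d b (p' h) + (V' h \<bullet> b) * cform D (p z) b) = ?d (V z) (p' h) + cform D (p z) (V' h)" for h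
    using euclidean_linear_expansion[OF linear_frechet_derivative_cform[OF D pz, of "p' h"], of "V z"]
      euclidean_linear_expansion[OF linear_cform[OF D pz], of "V' h"]
    by (simp add: sum.distrib)
  ultimately have der: "((\<lambda>z. \<Sum>b\<in>Basis. (V z \<bullet> b) * cform D (p z) b) has_derivative
      (\<lambda>h. ?d (V z) (p' h) + cform D (p z) (V' h))) (at z)" by simp
  have ev: "\<forall>\<^sub>F y in at z. p y \<in> U"
    using has_derivative_continuous[OF p] U pz by (auto simp: isCont_def tendsto_def)
  show ?thesis
    by (rule has_derivative_transform_eventually[OF der _ ])
      (use ev U pz in \<open>auto elim!: eventually_mono intro!: euclidean_linear_expansion[symmetric]\<close>)
qed

text \<open>The equation for \<open>w\<close> says that it is the component in \<open>M\<close> of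
  the image of (\<open>e\<close>, \<open>v\<close>) under \<open>symplectization_acs\<close>. Since
  d\<alpha> annihilates the Reeb field, only the projection P of \<open>v\<close> to the contact
  plane and its image J P survive, and d\<alpha>(P, J P) is a squared norm.\<close>

lemma dcform_complex_line_nonneg:
  assumes D: "contact_manifold D" and R: "reeb_field D" and J: "compatible_acs D" and x: "x \<in> mfd D"
    and v: "v \<in> tangent (mfd D) x" and w: "w \<in> tangent (mfd D) x"
    and w_eq: "w = e *\<^sub>R reeb D x + acs D x (v - cform D x v *\<^sub>R reeb D x)"
  shows "0 \<le> dcform D x v w"
proof -
  let ?R = "reeb D x" and ?P = "v - cform D x v *\<^sub>R reeb D x"
  note lin = linear_dcform[OF D x]
  have sub: "subspace (tangent (mfd D) x)"
    using D x subspace_tangent by (auto simp: contact_manifold_def closed_manifold_def)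
  have Rt: "?R \<in> tangent (mfd D) x" "cform D x ?R = 1" "\<And>w. w \<in> tangent (mfd D) x \<Longrightarrow> dcform D x ?R w = 0"
    using R x by (auto simp: reeb_field_def)
  have Pt: "?P \<in> tangent (mfd D) x" using sub v Rt by (simp add: subspace_diff subspace_scale)
  have Pc: "?P \<in> contact_plane D x"
    using Pt Rt linear_diff[OF linear_cform[OF D x]] linear_cmul[OF linear_cform[OF D x]]
    by (simp add: contact_plane_def)
  have "dcform D x v w = - dcform D x w (?P + cform D x v *\<^sub>R ?R)" by (subst dcform_antisym) simp
  also have "\<dots> = dcform D x ?P w + cform D x v * dcform D x ?R w"
    using dcform_antisym[of D x w] by (simp only: linear_add[OF lin] linear_cmul[OF lin]) simp
  also have "\<dots> = dcform D x ?P (e *\<^sub>R ?R + acs D x ?P)" using Rt(3)[OF w] w_eq by simp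
  also have "\<dots> = e * dcform D x ?P ?R + dcform D x ?P (acs D x ?P)"
    by (simp only: linear_add[OF lin] linear_cmul[OF lin]) simp
  also have "\<dots> = dcform D x ?P (acs D x ?P)" using Rt(3)[OF Pt] dcform_antisym[of D x ?P ?R] by simp
  also have "\<dots> \<ge> 0"
  proof (cases "?P = 0")
    case True
    then show ?thesis using linear_0[OF lin] dcform_antisym[of D x 0] by simp
  next
    case False
    then show ?thesis using J Pc x by (auto simp: compatible_acs_def intro: less_imp_le)
  qed
  finally show ?thesis .
qed

text \<open>The Cauchy-Riemann equations say that a_x = \<alpha>(u_y) and a_y = - \<alpha>(u_x).
  When they are differentiated once more, the mixed derivatives of \<open>u\<close> cancel, and the
  Laplacian of \<open>a\<close> becomes d\<alpha>(u_x, u_y), to which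
  \<open>dcform_complex_line_nonneg\<close> applies.\<close>

lemma holomorphic_laplacian_nonneg:
  fixes D :: "('a::euclidean_space, 'b) sft_data_scheme" and a :: "complex \<Rightarrow> real"
  assumes D: "contact_manifold D" "reeb_field D" "compatible_acs D"
    and a: "smooth_on \<Omega> a" and u: "smooth_on \<Omega> u" and uM: "u ` \<Omega> \<subseteq> mfd D"
    and hol: "\<And>z v. z \<in> \<Omega> \<Longrightarrow> symplectization_acs D (u z) (frechet_derivative a (at z) v, frechet_derivative u (at z) v) =
      (frechet_derivative a (at z) (\<i> * v), frechet_derivative u (at z) (\<i> * v))"
  obtains a' ax ay where "\<And>z. z \<in> \<Omega> \<Longrightarrow> (a has_derivative a' z) (at z)"
    "\<And>z. z \<in> \<Omega> \<Longrightarrow> ((\<lambda>z. a' z 1) has_derivative ax z) (at z)"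
    "\<And>z. z \<in> \<Omega> \<Longrightarrow> ((\<lambda>z. a' z \<i>) has_derivative ay z) (at z)"
    "\<And>z. z \<in> \<Omega> \<Longrightarrow> 0 \<le> ax z 1 + ay z \<i>"
proof -
  have op: "open \<Omega>" using a by (rule smooth_on_open)
  define a' where "a' z = frechet_derivative a (at z)" for z
  have da: "(a has_derivative a' z) (at z)" if "z \<in> \<Omega>" for z
    using smooth_on_differentiable[OF a that] by (simp add: a'_def frechet_derivative_works)
  obtain u' u'' where du: "\<And>z. z \<in> \<Omega> \<Longrightarrow> (u has_derivative u' z) (at z)"
    and ddu: "\<And>z v. z \<in> \<Omega> \<Longrightarrow> ((\<lambda>z. u' z v) has_derivative u'' v z) (at z)"
    and cu: "\<And>v w. continuous_on \<Omega> (\<lambda>z. u'' v z w)"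
    using smooth_onE_C2[OF u] by metis
  have eq: "a' z (\<i> * v) = - cform D (u z) (u' z v)"
    "u' z (\<i> * v) = a' z v *\<^sub>R reeb D (u z) + acs D (u z) (u' z v - cform D (u z) (u' z v) *\<^sub>R reeb D (u z))"
    if "z \<in> \<Omega>" for z v
    using hol[OF that, of v] frechet_derivative_at[OF du[OF that]]
    by (simp_all add: symplectization_acs_def a'_def)
  define ax where "ax z h = frechet_derivative (\<lambda>y. cform D y (u' z \<i>)) (at (u z)) (u' z h) + cform D (u z) (u'' \<i> z h)" for z h
  define ay where "ay z h = - (frechet_derivative (\<lambda>y. cform D y (u' z 1)) (at (u z)) (u' z h) + cform D (u z) (u'' 1 z h))" for z h
  have M: "u z \<in> mfd D" if "z \<in> \<Omega>" for z using that uM by blast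
  have dax: "((\<lambda>z. a' z 1) has_derivative ax z) (at z)" if z: "z \<in> \<Omega>" for z
  proof (rule has_derivative_transform_within_open[OF _ op z])
    show "((\<lambda>z. cform D (u z) (u' z \<i>)) has_derivative ax z) (at z)"
      unfolding ax_def by (rule cform_along_has_derivative[OF D(1) M[OF z] du[OF z] ddu[OF z]])
    show "cform D (u y) (u' y \<i>) = a' y 1" if y: "y \<in> \<Omega>" for y
    proof -
      have "a' y (\<i> * \<i>) = - a' y 1" using linear_neg[OF has_derivative_linear[OF da[OF y]], of 1] by simp
      then show ?thesis using eq(1)[OF y, of \<i>] by simp
    qed
  qed
  have day: "((\<lambda>z. a' z \<i>) has_derivative ay z) (at z)" if z: "z \<in> \<Omega>" for z
  proof (rule has_derivative_transform_within_open[OF _ op z])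
    show "((\<lambda>z. - cform D (u z) (u' z 1)) has_derivative ay z) (at z)"
      unfolding ay_def by (rule has_derivative_minus[OF cform_along_has_derivative[OF D(1) M[OF z] du[OF z] ddu[OF z]]])
    show "- cform D (u y) (u' y 1) = a' y \<i>" if y: "y \<in> \<Omega>" for y
      using eq(1)[OF y, of 1] by simp
  qed
  have "0 \<le> ax z 1 + ay z \<i>" if z: "z \<in> \<Omega>" for z
  proof -
    have "u'' \<i> z 1 = u'' 1 z \<i>"
      by (rule mixed_partials_commute[OF op z du ddu cu ddu cu])
    then have "ax z 1 + ay z \<i> = dcform D (u z) (u' z 1) (u' z \<i>)"
      by (simp add: ax_def ay_def dcform_def)
    also have "\<dots> \<ge> 0"
      by (rule dcform_complex_line_nonneg[OF D M[OF z] tangentI_open[OF du[OF z] op z uM]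
            tangentI_open[OF du[OF z] op z uM] eq(2)[OF z, of 1, unfolded mult_1_right]])
    finally show ?thesis .
  qed
  with da dax day that show ?thesis by blast
qed

lemma holomorphic_local_maximum:
  fixes D :: "('a::euclidean_space, 'b) sft_data_scheme" and a :: "complex \<Rightarrow> real"
  assumes D: "contact_manifold D" "reeb_field D" "compatible_acs D"
    and a: "smooth_on \<Omega> a" and u: "smooth_on \<Omega> u" and uM: "u ` \<Omega> \<subseteq> mfd D"
    and hol: "\<And>z v. z \<in> \<Omega> \<Longrightarrow> symplectization_acs D (u z) (frechet_derivative a (at z) v, frechet_derivative u (at z) v) =
      (frechet_derivative a (at z) (\<i> * v), frechet_derivative u (at z) (\<i> * v))"
    and z0: "z0 \<in> \<Omega>" and max: "\<And>z. z \<in> \<Omega> \<Longrightarrow> a z \<le> a z0"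
  obtains r where "r > 0" "ball z0 r \<subseteq> \<Omega>" "\<And>z. z \<in> ball z0 r \<Longrightarrow> a z = a z0"
proof -
  obtain a' ax ay where d: "\<And>z. z \<in> \<Omega> \<Longrightarrow> (a has_derivative a' z) (at z)"
    "\<And>z. z \<in> \<Omega> \<Longrightarrow> ((\<lambda>z. a' z 1) has_derivative ax z) (at z)"
    "\<And>z. z \<in> \<Omega> \<Longrightarrow> ((\<lambda>z. a' z \<i>) has_derivative ay z) (at z)"
    "\<And>z. z \<in> \<Omega> \<Longrightarrow> 0 \<le> ax z 1 + ay z \<i>"
    using holomorphic_laplacian_nonneg[OF D a u uM hol] by blast
  obtain R where R: "R > 0" "ball z0 R \<subseteq> \<Omega>"
    using smooth_on_open[OF a] z0 openE by blast
  show ?thesis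
  proof (rule that[of "R / 2"])
    show "a z = a z0" if "z \<in> ball z0 (R / 2)" for z
      by (rule strong_maximum_principle_ball[where g = a and g' = a' and gx = ax and gy = ay, OF R(1) d max that])
        (use R in blast)+
    show "ball z0 (R / 2) \<subseteq> \<Omega>" using R by (auto simp: subset_iff)
  qed (use R in auto)
qed

section \<open>Holomorphic buildings have positive punctures\<close>

lemma holomorphic_chart_openin:
  assumes "holomorphic_chart X \<A> U \<phi>" "open T"
  shows "openin X {p \<in> U. \<phi> p \<in> T}"
proof -
  have U: "openin X U" "topspace (subtopology X U) = U"
    and h: "homeomorphic_map (subtopology X U) (top_of_set (\<phi> ` U)) \<phi>"
    using assms(1) openin_subset by (force simp: holomorphic_chart_def)+
  have "openin (subtopology X U) {p \<in> topspace (subtopology X U). \<phi> p \<in> \<phi> ` U \<inter> T}"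
    by (rule openin_continuous_map_preimage[OF homeomorphic_imp_continuous_map[OF h]])
      (use assms(2) in \<open>auto simp: openin_open\<close>)
  moreover have "{p \<in> topspace (subtopology X U). \<phi> p \<in> \<phi> ` U \<inter> T} = {p \<in> U. \<phi> p \<in> T}"
    using U(2) by auto
  ultimately show ?thesis using U(1) openin_trans_full by metis
qed

lemma holomorphic_chart_inj_on:
  assumes "holomorphic_chart X \<A> U \<phi>"
  shows "inj_on \<phi> U"
proof -
  have "topspace (subtopology X U) = U"
    using assms openin_subset by (force simp: holomorphic_chart_def)
  moreover have "homeomorphic_map (subtopology X U) (top_of_set (\<phi> ` U)) \<phi>"
    using assms by (simp add: holomorphic_chart_def)
  ultimately show ?thesis using homeomorphic_imp_injective_map by metis
qed

text \<open>The \<open>\<real>\<close>-component of a curve with only negative punctures would attain its maximum, and the set where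
  it does so would be open and closed in the surface.\<close>

lemma holomorphic_curve_positive_puncture:
  fixes D :: "('a::euclidean_space, 'b) sft_data_scheme"
  assumes D: "contact_manifold D" "reeb_field D" "compatible_acs D"
    and C: "holomorphic_curve D C" and neg: "pneg C \<noteq> {}"
  shows "ppos C \<noteq> {}"
proof
  assume pos: "ppos C = {}"
  define X P E a where "X = surf C" and "P = punctures C" and "E = topspace (surf C) - punctures C" and "a = amap C"
  have P: "P = pneg C" using pos by (simp add: P_def punctures_def)
  have X: "compact_space X" "connected_space X" "\<Union> (fst ` atlas C) = topspace X"
    and chart: "\<And>U \<phi>. (U, \<phi>) \<in> atlas C \<Longrightarrow> holomorphic_chart X (atlas C) U \<phi>"
    using C by (auto simp: holomorphic_curve_def closed_riemann_surface_def X_def)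
  have sub: "P \<subseteq> topspace X" and uE: "umap C ` E \<subseteq> mfd D"
    and disj: "\<And>z z'. z \<in> P \<Longrightarrow> z' \<in> P \<Longrightarrow> z \<noteq> z' \<Longrightarrow> fst (disc C z) \<inter> fst (disc C z') = {}"
    using C by (auto simp: holomorphic_curve_def X_def P_def E_def)
  have loc: "smooth_on (\<phi> ` (U - P)) (a \<circ> inv_into U \<phi>)" "smooth_on (\<phi> ` (U - P)) (umap C \<circ> inv_into U \<phi>)"
    "\<And>z v. z \<in> \<phi> ` (U - P) \<Longrightarrow> symplectization_acs D ((umap C \<circ> inv_into U \<phi>) z)
        (frechet_derivative (a \<circ> inv_into U \<phi>) (at z) v, frechet_derivative (umap C \<circ> inv_into U \<phi>) (at z) v) =
      (frechet_derivative (a \<circ> inv_into U \<phi>) (at z) (\<i> * v), frechet_derivative (umap C \<circ> inv_into U \<phi>) (at z) (\<i> * v))"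
    if "(U, \<phi>) \<in> atlas C" for U \<phi>
  proof -
    have "\<forall>(U, \<phi>)\<in>atlas C. let \<Omega> = \<phi> ` (U - punctures C); a = amap C \<circ> inv_into U \<phi>; u = umap C \<circ> inv_into U \<phi> in
        smooth_on \<Omega> a \<and> smooth_on \<Omega> u \<and>
        (\<forall>z\<in>\<Omega>. \<forall>v. symplectization_acs D (u z) (frechet_derivative a (at z) v, frechet_derivative u (at z) v) =
           (frechet_derivative a (at z) (\<i> * v), frechet_derivative u (at z) (\<i> * v)))"
      using C unfolding holomorphic_curve_def by (elim conjE)
    from bspec[OF this that]
    show "smooth_on (\<phi> ` (U - P)) (a \<circ> inv_into U \<phi>)" "smooth_on (\<phi> ` (U - P)) (umap C \<circ> inv_into U \<phi>)"
      "\<And>z v. z \<in> \<phi> ` (U - P) \<Longrightarrow> symplectization_acs D ((umap C \<circ> inv_into U \<phi>) z)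
        (frechet_derivative (a \<circ> inv_into U \<phi>) (at z) v, frechet_derivative (umap C \<circ> inv_into U \<phi>) (at z) v) =
      (frechet_derivative (a \<circ> inv_into U \<phi>) (at z) (\<i> * v), frechet_derivative (umap C \<circ> inv_into U \<phi>) (at z) (\<i> * v))"
      unfolding P_def a_def Let_def prod.case by blast+
  qed
  \<comment> \<open>For lack of positive punctures the sign is -1 everywhere, so \<open>a\<close>
    tends to minus infinity at each puncture.\<close>
  have pd: "holomorphic_chart X (atlas C) (fst (disc C z)) (snd (disc C z))" "z \<in> fst (disc C z)"
    "snd (disc C z) z = 0" "snd (disc C z) ` fst (disc C z) = ball 0 1"
    "\<And>B. \<exists>r>0. \<forall>p\<in>fst (disc C z) - {z}. cmod (snd (disc C z) p) < r \<longrightarrow> B < - a p"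
    if "z \<in> P" for z
  proof -
    have "\<forall>z\<in>punctures C. let U = fst (disc C z); \<psi> = snd (disc C z); k = porb C z; \<epsilon> = puncture_sign C z in
        holomorphic_chart (surf C) (atlas C) U \<psi> \<and> z \<in> U \<and> \<psi> z = 0 \<and> \<psi> ` U = ball 0 1 \<and>
        (\<forall>B. \<exists>r>0. \<forall>p\<in>U - {z}. cmod (\<psi> p) < r \<longrightarrow> B < \<epsilon> * amap C p) \<and>
        uniform_limit UNIV (\<lambda>\<rho> \<theta>. umap C (inv_into U \<psi> (rcis \<rho> \<theta>)))
          (\<lambda>\<theta>. orb D k (- \<epsilon> * period D k * \<theta> / (2 * pi))) (at_right 0)"
      using C unfolding holomorphic_curve_def by (elim conjE)
    note * = bspec[OF this that[unfolded P_def], unfolded Let_def puncture_sign_def pos]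
    show "holomorphic_chart X (atlas C) (fst (disc C z)) (snd (disc C z))"
      unfolding X_def using * by (elim conjE)
    show "z \<in> fst (disc C z)" using * by (elim conjE)
    show "snd (disc C z) z = 0" using * by (elim conjE)
    show "snd (disc C z) ` fst (disc C z) = ball 0 1" using * by (elim conjE)
    have "\<forall>B. \<exists>r>0. \<forall>p\<in>fst (disc C z) - {z}. cmod (snd (disc C z) p) < r \<longrightarrow> B < (if z \<in> {} then 1 else - 1) * amap C p"
      using * by (elim conjE)
    then show "\<exists>r>0. \<forall>p\<in>fst (disc C z) - {z}. cmod (snd (disc C z) p) < r \<longrightarrow> B < - a p" for B
      by (simp add: a_def)
  qed
  have chart_E: "q \<in> E" if "(U, \<phi>) \<in> atlas C" "q \<in> U" "\<phi> q \<in> \<phi> ` (U - P)" for U \<phi> q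
  proof -
    have "q \<notin> P" using that holomorphic_chart_inj_on[OF chart[OF that(1)]] by (auto dest: inj_onD)
    moreover have "q \<in> topspace X" using X(3) that by force
    ultimately show ?thesis by (simp add: E_def X_def P_def)
  qed
  have inv: "inv_into U \<phi> (\<phi> q) = q" if "(U, \<phi>) \<in> atlas C" "q \<in> U" for U \<phi> q
    using that holomorphic_chart_inj_on[OF chart[OF that(1)]] by simp
  have E_chart: "\<exists>U \<phi>. (U, \<phi>) \<in> atlas C \<and> p \<in> U \<and> \<phi> p \<in> \<phi> ` (U - P)" if "p \<in> E" for p
  proof -
    have "p \<in> \<Union> (fst ` atlas C)" "p \<notin> P" using that X(3) by (auto simp: E_def X_def P_def)
    then show ?thesis by force
  qed
  have open_a: "openin X {p \<in> E. a p \<in> W}" if W: "open W" for W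
  proof (subst openin_subopen, intro ballI)
    fix p assume p: "p \<in> {p \<in> E. a p \<in> W}"
    then obtain U \<phi> where c: "(U, \<phi>) \<in> atlas C" "p \<in> U" "\<phi> p \<in> \<phi> ` (U - P)" using E_chart by blast
    define T where "T = {z \<in> \<phi> ` (U - P). (a \<circ> inv_into U \<phi>) z \<in> W}"
    have "continuous_on (\<phi> ` (U - P)) (a \<circ> inv_into U \<phi>)"
      using smooth_on_differentiable[OF loc(1)[OF c(1)]]
      by (intro continuous_at_imp_continuous_on ballI differentiable_imp_continuous_within) auto
    then have "open T" unfolding T_def
      using continuous_open_preimage[OF _ smooth_on_open[OF loc(1)[OF c(1)]] W] by (simp add: vimage_def Int_def)
    then have "openin X {q \<in> U. \<phi> q \<in> T}" using holomorphic_chart_openin[OF chart[OF c(1)]] by blast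
    moreover have "p \<in> {q \<in> U. \<phi> q \<in> T}" using c p inv[OF c(1,2)] by (simp add: T_def)
    moreover have "{q \<in> U. \<phi> q \<in> T} \<subseteq> {p \<in> E. a p \<in> W}"
    proof
      fix q assume q: "q \<in> {q \<in> U. \<phi> q \<in> T}"
      then have "q \<in> E" using chart_E[OF c(1)] by (simp add: T_def)
      moreover have "a q \<in> W" using q inv[OF c(1), of q] by (simp add: T_def)
      ultimately show "q \<in> {p \<in> E. a p \<in> W}" by simp
    qed
    ultimately show "\<exists>T. openin X T \<and> p \<in> T \<and> T \<subseteq> {p \<in> E. a p \<in> W}" by blast
  qed
  \<comment> \<open>A reference point that is not a puncture is found at coordinate 1/2 in the disc
    of some puncture; the discs of the other punctures are disjoint from this one.\<close>
  obtain p0 where p0: "p0 \<in> E"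
  proof -
    obtain z where z: "z \<in> P" using neg P by blast
    have "1 / 2 \<in> snd (disc C z) ` fst (disc C z)" using pd(4)[OF z] by (simp add: norm_divide)
    then obtain p where p: "p \<in> fst (disc C z)" "snd (disc C z) p = 1 / 2" by auto
    have "p \<noteq> z" using p pd(3)[OF z] by auto
    then have "p \<notin> P" using disj[OF z, of p] p pd(2)[of p] by blast
    moreover have "p \<in> topspace X"
      using p pd(1)[OF z] openin_subset by (force simp: holomorphic_chart_def)
    ultimately show ?thesis using that by (simp add: E_def X_def P_def)
  qed
  have "\<forall>z\<in>P. \<exists>r>0. \<forall>p\<in>fst (disc C z) - {z}. cmod (snd (disc C z) p) < r \<longrightarrow> - a p0 < - a p"
    using pd(5) by blast
  then obtain r where r: "\<And>z. z \<in> P \<Longrightarrow> r z > 0"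
    "\<And>z p. z \<in> P \<Longrightarrow> p \<in> fst (disc C z) \<Longrightarrow> p \<noteq> z \<Longrightarrow> cmod (snd (disc C z) p) < r z \<Longrightarrow> a p < a p0"
    by (auto dest!: bchoice)
  \<comment> \<open>Neighbourhoods of the punctures on which \<open>a\<close> stays below its value
    at \<open>p0\<close>. Their removal leaves a compact set containing \<open>p0\<close>, so a
    maximum over this set is a maximum over all of \<open>E\<close>.\<close>
  define N where "N z = {p \<in> fst (disc C z). snd (disc C z) p \<in> ball 0 (r z)}" for z
  have N: "openin X (N z)" "z \<in> N z" "\<And>p. p \<in> N z \<Longrightarrow> p \<in> E \<Longrightarrow> a p < a p0" if z: "z \<in> P" for z
  proof -
    show "openin X (N z)" unfolding N_def by (rule holomorphic_chart_openin[OF pd(1)[OF z]]) simp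
    show "z \<in> N z" using pd(2,3)[OF z] r(1)[OF z] by (simp add: N_def)
    show "a p < a p0" if p: "p \<in> N z" "p \<in> E" for p
    proof (rule r(2)[OF z])
      show "p \<noteq> z" using p(2) z by (auto simp: E_def P_def)
    qed (use p(1) in \<open>simp_all add: N_def\<close>)
  qed
  define K where "K = topspace X - (\<Union>z\<in>P. N z)"
  have "closedin X K" unfolding K_def using N(1) by (intro closedin_diff openin_Union) auto
  then have "compactin X K" using X(1) closedin_compact_space by blast
  have KE: "K \<subseteq> E" using N(2) by (auto simp: K_def E_def X_def P_def)
  have conta: "continuous_map (subtopology X K) euclideanreal a"
    unfolding continuous_map_def
  proof (intro conjI allI impI)
    fix W :: "real set" assume "openin euclidean W"
    then have "openin (subtopology X K) (K \<inter> {p \<in> E. a p \<in> W})"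
      using open_a by (auto simp: openin_subtopology_Int2)
    moreover have "K \<inter> {p \<in> E. a p \<in> W} = {x \<in> topspace (subtopology X K). a x \<in> W}"
      using KE by (auto simp: K_def)
    ultimately show "openin (subtopology X K) {x \<in> topspace (subtopology X K). a x \<in> W}" by simp
  qed auto
  have "compactin euclideanreal (a ` K)"
    by (rule image_compactin[OF _ conta]) (simp add: compactin_subtopology \<open>compactin X K\<close>)
  moreover have "p0 \<in> K" using p0 N(3)[of _ p0] by (auto simp: K_def E_def X_def)
  ultimately obtain pm where pm: "pm \<in> K" "\<And>p. p \<in> K \<Longrightarrow> a p \<le> a pm"
    using compact_attains_sup[of "a ` K"] by auto
  have m0: "a p0 \<le> a pm" using pm(2) \<open>p0 \<in> K\<close> by blast
  have max: "a p \<le> a pm" if pE: "p \<in> E" for p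
  proof (cases "p \<in> K")
    case False
    then obtain z where "z \<in> P" "p \<in> N z" using pE by (auto simp: K_def E_def X_def)
    then show ?thesis using N(3)[OF _ _ pE, of z] m0 by simp
  qed (use pm in auto)
  \<comment> \<open>Local constancy near a maximum makes this set open. The neighbourhoods
    \<open>N\<close> separate it from the punctures, so it is closed in the compact surface and not
    merely in the punctured one. By connectedness it is everything, although it omits the
    punctures.\<close>
  define S where "S = {p \<in> E. a p = a pm}"
  have "openin X S"
  proof (subst openin_subopen, intro ballI)
    fix p assume p: "p \<in> S"
    then obtain U \<phi> where c: "(U, \<phi>) \<in> atlas C" "p \<in> U" "\<phi> p \<in> \<phi> ` (U - P)"
      using E_chart[of p] by (auto simp only: S_def mem_Collect_eq)
    have uS: "(umap C \<circ> inv_into U \<phi>) ` \<phi> ` (U - P) \<subseteq> mfd D"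
      using uE chart_E[OF c(1)] inv[OF c(1)] by fastforce
    have mx: "(a \<circ> inv_into U \<phi>) z \<le> (a \<circ> inv_into U \<phi>) (\<phi> p)" if "z \<in> \<phi> ` (U - P)" for z
      using that p max chart_E[OF c(1)] inv[OF c(1)] c(2) by (auto simp: S_def)
    obtain \<delta> where \<delta>: "\<delta> > 0" "ball (\<phi> p) \<delta> \<subseteq> \<phi> ` (U - P)"
      "\<And>z. z \<in> ball (\<phi> p) \<delta> \<Longrightarrow> (a \<circ> inv_into U \<phi>) z = (a \<circ> inv_into U \<phi>) (\<phi> p)"
      by (rule holomorphic_local_maximum[OF D loc(1)[OF c(1)] loc(2)[OF c(1)] uS loc(3)[OF c(1)] c(3) mx]) (assumption | rule that)+
    have "openin X {q \<in> U. \<phi> q \<in> ball (\<phi> p) \<delta>}" using holomorphic_chart_openin[OF chart[OF c(1)]] by blast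
    moreover have "p \<in> {q \<in> U. \<phi> q \<in> ball (\<phi> p) \<delta>}" using c \<delta>(1) by simp
    moreover have "{q \<in> U. \<phi> q \<in> ball (\<phi> p) \<delta>} \<subseteq> S"
    proof
      fix q assume q: "q \<in> {q \<in> U. \<phi> q \<in> ball (\<phi> p) \<delta>}"
      then have "q \<in> E" using chart_E[OF c(1)] \<delta>(2) by blast
      moreover have "a q = a p" using \<delta>(3)[of "\<phi> q"] q inv[OF c(1)] c(2) by simp
      ultimately show "q \<in> S" using p by (simp add: S_def)
    qed
    ultimately show "\<exists>T. openin X T \<and> p \<in> T \<and> T \<subseteq> S" by blast
  qed
  moreover have "closedin X S"
  proof -
    have "topspace X - S = {p \<in> E. a p \<in> - {a pm}} \<union> (\<Union>z\<in>P. N z)"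
    proof (intro equalityI subsetI)
      fix p assume "p \<in> topspace X - S"
      then show "p \<in> {p \<in> E. a p \<in> - {a pm}} \<union> (\<Union>z\<in>P. N z)"
        using N(2) by (auto simp: S_def E_def X_def P_def)
    next
      fix p assume "p \<in> {p \<in> E. a p \<in> - {a pm}} \<union> (\<Union>z\<in>P. N z)"
      then show "p \<in> topspace X - S"
      proof
        assume "p \<in> (\<Union>z\<in>P. N z)"
        then obtain z where z: "z \<in> P" "p \<in> N z" by auto
        then have "p \<in> topspace X" using N(1) openin_subset by blast
        moreover have "p \<notin> S" using N(3)[OF z] m0 by (auto simp: S_def)
        ultimately show ?thesis by simp
      qed (auto simp: S_def E_def X_def)
    qed
    moreover have "openin X ({p \<in> E. a p \<in> - {a pm}} \<union> (\<Union>z\<in>P. N z))"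
      using N(1) by (intro openin_Un open_a openin_Union) auto
    moreover have "S \<subseteq> topspace X" by (auto simp: S_def E_def X_def)
    ultimately show ?thesis by (simp add: closedin_def)
  qed
  ultimately have "S = {} \<or> S = topspace X" using X(2) connected_space_clopen_in by blast
  moreover have "pm \<in> S" using pm KE by (auto simp: S_def)
  ultimately have "S = topspace X" by blast
  then have "P = {}" using sub by (auto simp: S_def E_def P_def)
  then show False using neg P by simp
qed

text \<open>Among the components with punctures take one of highest level. A positive puncture of it
  would be external or matched with a negative puncture one level higher; both are excluded, so all
  its punctures are negative, against the maximum principle. Components without punctures are kept
  out of \<open>Q\<close>, since \<open>holomorphic_curve_positive_puncture\<close> says nothing
  about them.\<close>

lemma stable_building_positive_puncture:
  fixes D :: "('a::euclidean_space, 'b) sft_data_scheme"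
  assumes D: "contact_manifold D" "reeb_field D" "compatible_acs D"
    and B: "stable_building D g B" and neg: "extneg B \<noteq> []"
  shows "extpos B \<noteq> []"
proof
  assume pos: "extpos B = []"
  define n where "n = length (comps B)"
  note building = B[unfolded stable_building_def Let_def, folded n_def]
  have curve: "\<forall>c<n. holomorphic_curve D (comps B ! c)" using building by (elim conjE)
  have pset: "set (extpos B @ map snd (breaks B)) = {(c, x). c < n \<and> x \<in> ppos (comps B ! c)}"
    using building by (elim conjE)
  have nset: "set (extneg B @ map fst (breaks B)) = {(c, x). c < n \<and> x \<in> pneg (comps B ! c)}"
    using building by (elim conjE)
  have br: "\<forall>((c, x), (c', x'))\<in>set (breaks B). lev B c = Suc (lev B c') \<and> porb (comps B ! c) x = porb (comps B ! c') x'"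
    using building by (elim conjE)
  define Q where "Q = {c. c < n \<and> punctures (comps B ! c) \<noteq> {}}"
  have "finite Q" by (simp add: Q_def)
  obtain c0 x0 where "(c0, x0) \<in> set (extneg B)" using neg by (metis list.set_intros(1) neq_Nil_conv surj_pair)
  then have "(c0, x0) \<in> set (extneg B @ map fst (breaks B))" by simp
  then have "c0 \<in> Q" unfolding nset Q_def punctures_def by blast
  then have "Max (lev B ` Q) \<in> lev B ` Q" using \<open>finite Q\<close> by (intro Max_in) auto
  then obtain c where "c \<in> Q" "lev B c = Max (lev B ` Q)" by auto
  then have c: "c \<in> Q" "\<And>c'. c' \<in> Q \<Longrightarrow> lev B c' \<le> lev B c"
    using \<open>finite Q\<close> by (auto intro: Max_ge)
  have "ppos (comps B ! c) = {}"
  proof (rule ccontr)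
    assume "ppos (comps B ! c) \<noteq> {}"
    then obtain x where "x \<in> ppos (comps B ! c)" by blast
    then have "(c, x) \<in> set (extpos B @ map snd (breaks B))" unfolding pset using c(1) by (simp add: Q_def)
    then have "(c, x) \<in> set (map snd (breaks B))" using pos by simp
    then obtain c' x' where b: "((c', x'), (c, x)) \<in> set (breaks B)" by force
    then have "(c', x') \<in> set (extneg B @ map fst (breaks B))" by force
    then have "c' \<in> Q" unfolding nset Q_def punctures_def by blast
    then show False using c(2)[of c'] bspec[OF br b] by simp
  qed
  moreover from this have "pneg (comps B ! c) \<noteq> {}" using c(1) by (auto simp: Q_def punctures_def)
  ultimately show False
    using holomorphic_curve_positive_puncture[OF D, of "comps B ! c"] curve c(1) by (auto simp: Q_def)
qed

text \<open>With \<open>False\<close> the extra orbit \<open>k\<close> is itself a negative end, so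
  an external negative puncture always exists, while the exponent \<open>0\<close> leaves no
  positive one.\<close>

lemma buildings_no_positive_orbits:
  assumes "contact_manifold D" "reeb_field D" "compatible_acs D"
  shows "buildings D False g m A I 0 k = {}"
proof -
  have False if "B \<in> buildings D False g m A I 0 k" for B
  proof -
    have "stable_building D g B" "extneg B \<noteq> []" "extpos B = []"
      using that by (auto simp: buildings_def mult_word_def)
    then show False using stable_building_positive_puncture[OF assms] by blast
  qed
  then show ?thesis by blast
qed

section \<open>The weight filtration\<close>

text \<open>The commutation relation of the Weyl algebra replaces \<open>p q\<close> by \<open>\<plusminus> q p\<close> and a multiple of \<open>\<hbar>\<close>, so it is
  homogeneous for this weight.\<close>

fun weight :: "mono \<Rightarrow> nat" where
  "weight (K, I, J, g) = msize K + msize J + g"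

definition filtered :: "nat \<Rightarrow> 'a series \<Rightarrow> bool" where
  "filtered n x \<longleftrightarrow> (\<forall>\<mu> B. weight \<mu> < n \<longrightarrow> x \<mu> B = 0)"

text \<open>Canonical representative modulo positive weight. It replaces the passage to the quotient
  algebra by a map from series to series.\<close>

definition weight0_part :: "'a series \<Rightarrow> 'a series" where
  "weight0_part x = (\<lambda>\<mu> B. if weight \<mu> = 0 then x \<mu> B else 0)"

section \<open>Weights of monomials and of products\<close>

lemma msize_eq_sum: "finite S \<Longrightarrow> Poly_Mapping.keys I \<subseteq> S \<Longrightarrow> msize I = sum (Poly_Mapping.lookup I) S"
  unfolding msize_def by (intro sum.mono_neutral_left) (auto simp: in_keys_iff)

lemma msize_add: "msize (I + J) = msize I + msize J"
proof -
  let ?S = "Poly_Mapping.keys I \<union> Poly_Mapping.keys J"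
  have "Poly_Mapping.keys (I + J) \<subseteq> ?S" by (rule keys_add)
  then show ?thesis by (simp add: msize_eq_sum[of ?S] lookup_add sum.distrib)
qed

lemma msize_0 [simp]: "msize 0 = 0"
  by (simp add: msize_def)

lemma msize_single [simp]: "msize (Poly_Mapping.single k n) = n"
  by (simp add: msize_def)

lemma msize_eq_0_iff [simp]: "msize I = 0 \<longleftrightarrow> I = 0"
proof
  assume "msize I = 0"
  then have "\<forall>k\<in>Poly_Mapping.keys I. Poly_Mapping.lookup I k = 0" by (simp add: msize_def)
  then show "I = 0" by (intro poly_mapping_eqI) (metis in_keys_iff lookup_zero)
qed simp

lemma mindex_diff_single:
  fixes I :: mindex
  assumes "0 < Poly_Mapping.lookup I k"
  shows "I - Poly_Mapping.single k 1 + Poly_Mapping.single k 1 = I"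
  by (rule poly_mapping_eqI) (use assms in \<open>auto simp: lookup_add lookup_minus lookup_single when_def\<close>)

lemma msize_diff_single: "0 < Poly_Mapping.lookup I k \<Longrightarrow> Suc (msize (I - Poly_Mapping.single k 1)) = msize I"
  by (metis mindex_diff_single msize_add msize_single Suc_eq_plus1)

lemma weight_eq_0_iff: "weight \<mu> = 0 \<longleftrightarrow> (\<exists>I. \<mu> = (0, I, 0, 0))"
  by (cases \<mu>) auto

lemma filteredD: "filtered n x \<Longrightarrow> weight \<mu> < n \<Longrightarrow> x \<mu> B = 0"
  by (simp add: filtered_def del: split_paired_All)

lemma filtered_mono: "filtered n x \<Longrightarrow> m \<le> n \<Longrightarrow> filtered m x"
  by (simp add: filtered_def)

lemma filtered_0 [simp]: "filtered 0 x"
  by (simp add: filtered_def)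

lemma filtered_mul_h: "filtered n x \<Longrightarrow> filtered (Suc n) (mul_h x)"
  by (auto simp: filtered_def mul_h_def)

lemma filtered_mul_t: "filtered n x \<Longrightarrow> filtered (Suc n) (mul_t D j x)"
  unfolding filtered_def mul_t_def
  by (auto simp: msize_diff_single[symmetric])

lemma filtered_mul_q: "filtered n x \<Longrightarrow> filtered n (mul_q D k x)"
  by (auto simp: filtered_def mul_q_def)

lemma filtered_mul_p: "filtered n x \<Longrightarrow> filtered (Suc n) (mul_p D weyl k x)"
  unfolding filtered_def mul_p_def
  by (auto simp: msize_diff_single[symmetric])

lemma filtered_mul_e: "filtered n x \<Longrightarrow> filtered n (mul_e D A x)"
  by (simp add: filtered_def mul_e_def)

lemma filtered_funpow_mul_h: "filtered n x \<Longrightarrow> filtered (g + n) ((mul_h ^^ g) x)"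
  by (induction g) (auto simp: filtered_mul_h)

lemma filtered_foldr_mul_t: "filtered n x \<Longrightarrow> filtered (length ks + n) (foldr (mul_t D) ks x)"
  by (induction ks) (auto simp: filtered_mul_t)

lemma filtered_foldr_mul_q: "filtered n x \<Longrightarrow> filtered n (foldr (mul_q D) ks x)"
  by (induction ks) (auto simp: filtered_mul_q)

lemma filtered_foldr_mul_p: "filtered n x \<Longrightarrow> filtered (length ks + n) (foldr (mul_p D weyl) ks x)"
  by (induction ks) (auto simp: filtered_mul_p)

lemma length_mult_word: "length (mult_word I) = msize I"
  by (simp add: mult_word_def msize_def length_concat comp_def sum_list_distinct_conv_sum_set)

lemma filtered_mul_mono:
  assumes "filtered n x"
  shows "filtered (weight \<nu> + n) (mul_mono D weyl \<nu> x)"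
proof (cases \<nu>)
  case (fields K I J g)
  have "filtered (length (mult_word K) + (length (mult_word J) + (g + n))) (mul_mono D weyl \<nu> x)"
    unfolding fields mul_mono.simps
    by (intro filtered_foldr_mul_t filtered_foldr_mul_q filtered_foldr_mul_p filtered_funpow_mul_h assms)
  then show ?thesis by (simp add: fields length_mult_word add.assoc)
qed

text \<open>If the sum defining a coefficient of the product were infinite, that coefficient would be \<open>0\<close> by
  convention, so no finiteness is needed.\<close>

lemma filtered_sft_mult:
  assumes "filtered m x" "filtered n y"
  shows "filtered (m + n) (sft_mult D kind x y)"
  unfolding filtered_def
proof (intro allI impI)
  fix \<mu> B assume \<mu>: "weight \<mu> < m + n"
  have "x \<nu> A * mul_e D A (mul_mono D (kind = SFT) \<nu> y) \<mu> B = 0" for \<nu> A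
  proof (cases "weight \<nu> < m")
    case False
    then have "weight \<mu> < weight \<nu> + n" using \<mu> by simp
    then show ?thesis
      by (simp add: filteredD[OF filtered_mul_e[OF filtered_mul_mono[OF assms(2)]]])
  qed (simp add: filteredD[OF assms(1)])
  then show "sft_mult D kind x y \<mu> B = 0"
    by (auto simp: sft_mult_def Let_def intro!: sum.neutral)
qed

section \<open>Monomials\<close>

lemma wsum_0 [simp]: "wsum w 0 = 0"
  by (simp add: wsum_def)

lemma mult_word_0 [simp]: "mult_word 0 = []"
  by (simp add: mult_word_def)

lemma sorted_mult_word: "sorted (mult_word I)"
proof -
  have "sorted (concat (map (\<lambda>k. replicate (f k) k) xs))" if "sorted xs" for f and xs :: "nat list"
    using that by (induction xs) (auto simp: sorted_append)
  then show ?thesis by (simp add: mult_word_def)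
qed

lemma count_mult_word: "count (mset (mult_word I)) j = Poly_Mapping.lookup I j"
proof -
  have "count (mset (concat (map (\<lambda>k. replicate (f k) k) xs))) j = (if j \<in> set xs then f j else 0)"
    if "distinct xs" for f and xs :: "nat list"
    using that by (induction xs) auto
  from this[of "sorted_list_of_set (Poly_Mapping.keys I)" "Poly_Mapping.lookup I"]
  show ?thesis by (simp add: mult_word_def in_keys_iff)
qed

lemma set_mult_word: "set (mult_word I) = Poly_Mapping.keys I"
  by (auto simp: mult_word_def in_keys_iff)

lemma mult_word_add_single:
  assumes "\<And>i. i \<in> Poly_Mapping.keys I \<Longrightarrow> k \<le> i"
  shows "mult_word (I + Poly_Mapping.single k 1) = k # mult_word I"
proof -
  have "sort (mult_word (I + Poly_Mapping.single k 1)) = k # mult_word I"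
  proof (rule properties_for_sort)
    show "mset (k # mult_word I) = mset (mult_word (I + Poly_Mapping.single k 1))"
      by (rule multiset_eqI) (simp add: count_mult_word lookup_add lookup_single when_def)
    show "sorted (k # mult_word I)"
      using assms by (simp add: sorted_mult_word set_mult_word)
  qed
  then show ?thesis by (simp add: sorted_mult_word sorted_sort_id)
qed

lemma mult_word_single [simp]: "mult_word (Poly_Mapping.single k 1) = [k]"
  using mult_word_add_single[of 0 k] by simp

text \<open>The index added last is the smallest, so it stands first in the sorted word and has no
  smaller variable of its kind to pass. Monomials built in this order arise by left multiplication
  without Koszul signs.\<close>

lemma mindex_induct [case_names zero add]:
  fixes I :: mindex
  assumes zero: "P 0"
    and add: "\<And>k I. P I \<Longrightarrow> (\<And>i. i \<in> Poly_Mapping.keys I \<Longrightarrow> k \<le> i) \<Longrightarrow> P (I + Poly_Mapping.single k 1)"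
  shows "P I"
proof (induction "msize I" arbitrary: I)
  case 0
  then show ?case using zero by simp
next
  case (Suc n)
  define k where "k = Min (Poly_Mapping.keys I)"
  have ne: "Poly_Mapping.keys I \<noteq> {}" using Suc(2) by (auto simp: msize_def)
  then have k: "k \<in> Poly_Mapping.keys I" "\<And>i. i \<in> Poly_Mapping.keys I \<Longrightarrow> k \<le> i"
    unfolding k_def by auto
  let ?I = "I - Poly_Mapping.single k 1"
  have pos: "0 < Poly_Mapping.lookup I k" using k(1) by (simp add: in_keys_iff)
  have "P ?I" using Suc msize_diff_single[OF pos] by simp
  moreover have "Poly_Mapping.keys ?I \<subseteq> Poly_Mapping.keys I"
    by (auto simp: in_keys_iff lookup_minus)
  ultimately have "P (?I + Poly_Mapping.single k 1)" using k(2) by (intro add) auto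
  then show ?case using mindex_diff_single[OF pos] by simp
qed

lemma wbelow_add_single_min:
  assumes "\<And>i. i \<in> Poly_Mapping.keys I \<Longrightarrow> k \<le> i"
  shows "wbelow w (I + Poly_Mapping.single k 1) k = 0"
proof -
  have "Poly_Mapping.keys (I + Poly_Mapping.single k 1) \<subseteq> insert k (Poly_Mapping.keys I)"
    using keys_add[of I "Poly_Mapping.single k 1"] by auto
  then have "{i \<in> Poly_Mapping.keys (I + Poly_Mapping.single k 1). i < k} = {}"
    using assms by (auto simp: not_less)
  then show ?thesis unfolding wbelow_def by (simp only: sum.empty)
qed

lemma valid_mono_add_singleD:
  "valid_mono D (K + Poly_Mapping.single j 1, I, J, g) \<Longrightarrow> valid_mono D (K, I, J, g)"
  "valid_mono D (K, I + Poly_Mapping.single k 1, J, g) \<Longrightarrow> valid_mono D (K, I, J, g)"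
  "valid_mono D (K, I, J + Poly_Mapping.single k 1, g) \<Longrightarrow> valid_mono D (K, I, J, g)"
proof -
  have sub: "Poly_Mapping.keys L \<subseteq> Poly_Mapping.keys (L + Poly_Mapping.single i 1)"
    "Poly_Mapping.lookup L l \<le> Poly_Mapping.lookup (L + Poly_Mapping.single i 1) l" for L :: mindex and i l
    by (auto simp: in_keys_iff lookup_add)
  show "valid_mono D (K + Poly_Mapping.single j 1, I, J, g) \<Longrightarrow> valid_mono D (K, I, J, g)"
    using sub(1)[of K j] by (auto intro: le_trans[OF sub(2)[of K _ j]] simp del: One_nat_def)
  show "valid_mono D (K, I + Poly_Mapping.single k 1, J, g) \<Longrightarrow> valid_mono D (K, I, J, g)"
    using sub(1)[of I k] by (auto intro: le_trans[OF sub(2)[of I _ k]] simp del: One_nat_def)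
  show "valid_mono D (K, I, J + Poly_Mapping.single k 1, g) \<Longrightarrow> valid_mono D (K, I, J, g)"
    using sub(1)[of J k] by (auto intro: le_trans[OF sub(2)[of J _ k]] simp del: One_nat_def)
qed

lemma add_single_eq_iff:
  fixes I :: mindex
  shows "0 < Poly_Mapping.lookup I' k \<and> I' - Poly_Mapping.single k 1 = I \<longleftrightarrow> I' = I + Poly_Mapping.single k 1"
  using mindex_diff_single[of I' k] by (auto simp: lookup_add)

lemma mul_h_mono_elt: "mul_h (mono_elt D (0, 0, 0, g)) = mono_elt D (0, 0, 0, Suc g)"
  by (auto simp: fun_eq_iff mul_h_def mono_elt_def gr0_conv_Suc)

lemma mul_p_mono_elt:
  assumes min: "\<And>i. i \<in> Poly_Mapping.keys J \<Longrightarrow> k \<le> i" and v: "valid_mono D (0, 0, J + Poly_Mapping.single k 1, g)"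
  shows "mul_p D weyl k (mono_elt D (0, 0, J, g)) = mono_elt D (0, 0, J + Poly_Mapping.single k 1, g)"
proof (intro ext)
  fix \<mu> :: mono and A
  obtain K' I' J' g' where \<mu>: "\<mu> = (K', I', J', g')" by (cases \<mu>)
  \<comment> \<open>The commutator term reads off the coefficient of a monomial that contains q_k.
    It is zero because no q has been multiplied in yet.\<close>
  have "I' + Poly_Mapping.single k 1 \<noteq> 0"
    by (metis add_is_0 lookup_add lookup_single_eq lookup_zero zero_neq_one)
  then show "mul_p D weyl k (mono_elt D (0, 0, J, g)) \<mu> A = mono_elt D (0, 0, J + Poly_Mapping.single k 1, g) \<mu> A"
    unfolding \<mu> using valid_mono_add_singleD(3)[OF v] v add_single_eq_iff[of J' k J] wbelow_add_single_min[OF min, where w = "qpar D"]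
    by (auto simp: mul_p_def mono_elt_def simp del: valid_mono.simps)
qed

lemma mul_q_mono_elt:
  assumes min: "\<And>i. i \<in> Poly_Mapping.keys I \<Longrightarrow> k \<le> i" and v: "valid_mono D (0, I + Poly_Mapping.single k 1, J, g)"
  shows "mul_q D k (mono_elt D (0, I, J, g)) = mono_elt D (0, I + Poly_Mapping.single k 1, J, g)"
proof (intro ext)
  fix \<mu> :: mono and A
  obtain K' I' J' g' where \<mu>: "\<mu> = (K', I', J', g')" by (cases \<mu>)
  show "mul_q D k (mono_elt D (0, I, J, g)) \<mu> A = mono_elt D (0, I + Poly_Mapping.single k 1, J, g) \<mu> A"
    unfolding \<mu> using valid_mono_add_singleD(2)[OF v] v add_single_eq_iff[of I' k I] wbelow_add_single_min[OF min, where w = "qpar D"]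
    by (auto simp: mul_q_def mono_elt_def simp del: valid_mono.simps)
qed

lemma mul_t_mono_elt:
  assumes min: "\<And>i. i \<in> Poly_Mapping.keys K \<Longrightarrow> j \<le> i" and v: "valid_mono D (K + Poly_Mapping.single j 1, I, J, g)"
  shows "mul_t D j (mono_elt D (K, I, J, g)) = mono_elt D (K + Poly_Mapping.single j 1, I, J, g)"
proof (intro ext)
  fix \<mu> :: mono and A
  obtain K' I' J' g' where \<mu>: "\<mu> = (K', I', J', g')" by (cases \<mu>)
  show "mul_t D j (mono_elt D (K, I, J, g)) \<mu> A = mono_elt D (K + Poly_Mapping.single j 1, I, J, g) \<mu> A"
    unfolding \<mu> using valid_mono_add_singleD(1)[OF v] v add_single_eq_iff[of K' j K] wbelow_add_single_min[OF min, where w = "tdeg D"]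
    by (auto simp: mul_t_def mono_elt_def simp del: valid_mono.simps)
qed

text \<open>The factors act in the order \<hbar>, p, q, t. Every p acts before any q is present, so
  no commutator arises even in the Weyl algebra, and every q acts before any t, so there are no
  signs between different kinds of variables.\<close>

lemma mul_mono_one:
  assumes "valid_mono D \<nu>"
  shows "mul_mono D weyl \<nu> (mono_elt D (0, 0, 0, 0)) = mono_elt D \<nu>"
proof -
  obtain K I J g where \<nu>: "\<nu> = (K, I, J, g)" by (cases \<nu>)
  have h: "(mul_h ^^ g) (mono_elt D (0, 0, 0, 0)) = mono_elt D (0, 0, 0, g)"
    by (induction g) (auto simp: mul_h_mono_elt)
  have p: "valid_mono D (0, 0, J, g) \<Longrightarrow> foldr (mul_p D weyl) (mult_word J) (mono_elt D (0, 0, 0, g)) = mono_elt D (0, 0, J, g)"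
    by (induction J rule: mindex_induct)
      (simp_all add: mult_word_add_single mul_p_mono_elt valid_mono_add_singleD(3) del: valid_mono.simps One_nat_def)
  have q: "valid_mono D (0, I, J, g) \<Longrightarrow> foldr (mul_q D) (mult_word I) (mono_elt D (0, 0, J, g)) = mono_elt D (0, I, J, g)"
    by (induction I rule: mindex_induct)
      (simp_all add: mult_word_add_single mul_q_mono_elt valid_mono_add_singleD(2) del: valid_mono.simps One_nat_def)
  have t: "valid_mono D (K, I, J, g) \<Longrightarrow> foldr (mul_t D) (mult_word K) (mono_elt D (0, I, J, g)) = mono_elt D (K, I, J, g)"
    by (induction K rule: mindex_induct)
      (simp_all add: mult_word_add_single mul_t_mono_elt valid_mono_add_singleD(1) del: valid_mono.simps One_nat_def)
  show ?thesis using assms unfolding \<nu> mul_mono.simps h by (subst p, simp, subst q, simp, subst t) simp_all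
qed

text \<open>Multiplication by a variable changes exponents but never the element of the coefficient
  group, so vanishing over one such element \<open>B\<close> persists.\<close>

lemma mul_vanishes_at:
  assumes "\<And>\<mu>. x \<mu> B = 0"
  shows "mul_h x \<mu> B = 0" "mul_t D j x \<mu> B = 0" "mul_q D k x \<mu> B = 0" "mul_p D weyl k x \<mu> B = 0"
  using assms by (cases \<mu>; simp add: mul_h_def mul_t_def mul_q_def mul_p_def)+

lemma mul_mono_vanishes_at:
  fixes x :: "'a::euclidean_space series"
  assumes "\<And>\<mu>. x \<mu> B = 0"
  shows "mul_mono D weyl \<nu> x \<mu> B = 0"
proof -
  obtain K I J g where \<nu>: "\<nu> = (K, I, J, g)" by (cases \<nu>)
  have fold: "(\<And>x \<mu> k. (\<And>\<mu>. x \<mu> B = 0) \<Longrightarrow> F k x \<mu> B = 0) \<Longrightarrow> (\<And>\<mu>. x \<mu> B = 0) \<Longrightarrow> foldr F ks x \<mu> B = 0"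
    for F :: "nat \<Rightarrow> 'a series \<Rightarrow> 'a series" and ks x \<mu>
    by (induction ks arbitrary: \<mu>) auto
  have "(mul_h ^^ g) x \<mu> B = 0" for \<mu>
    using assms by (induction g arbitrary: \<mu>) (auto simp: mul_vanishes_at(1))
  then show ?thesis
    unfolding \<nu> mul_mono.simps by (intro fold mul_vanishes_at)
qed

section \<open>The algebra acting on itself\<close>

abbreviation one_elt :: "('a::euclidean_space, 'b) sft_data_scheme \<Rightarrow> 'a series" where
  "one_elt D \<equiv> mono_elt D (0, 0, 0, 0)"

lemma group_QH: "subgroup (rels D) (H2 D) \<Longrightarrow> group (QH D)"
  unfolding QH_def H2_def
  by (intro normal.factorgroup_is_group comm_group.subgroup_imp_normal abelian_homology_group)

lemma valid_mono_one [simp]: "valid_mono D (0, 0, 0, 0)"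
  by simp

lemma mul_e_one:
  assumes "group (QH D)" "\<And>\<mu> B. B \<notin> carrier (QH D) \<Longrightarrow> x \<mu> B = 0"
  shows "mul_e D \<one>\<^bsub>QH D\<^esub> x = x"
proof -
  interpret group "QH D" by (rule assms)
  show ?thesis using assms(2) by (auto simp: mul_e_def fun_eq_iff)
qed

lemma mul_e_mono_elt:
  assumes "group (QH D)" "A \<in> carrier (QH D)"
  shows "mul_e D A (mono_elt D \<mu>) \<nu> B = (if \<nu> = \<mu> \<and> valid_mono D \<mu> \<and> B = A then 1 else 0)"
proof -
  interpret group "QH D" by (rule assms)
  show ?thesis using assms(2) inv_equality[of B "inv\<^bsub>QH D\<^esub> A"]
    by (auto simp: mul_e_def mono_elt_def)
qed

lemma mono_elt_0_off_carrier: "group (QH D) \<Longrightarrow> B \<notin> carrier (QH D) \<Longrightarrow> mono_elt D \<mu> \<nu> B = 0"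
  by (auto simp: mono_elt_def group.is_monoid monoid.one_closed)

text \<open>A single monomial reduces the defining sum to one term. Vanishing off the carrier enters
  because \<open>mul_e\<close> by the unit cuts every series down to the carrier of the coefficient
  group.\<close>

lemma sft_mult_mono_elt:
  assumes G: "group (QH D)" and v: "valid_mono D \<nu>"
    and x: "\<And>\<mu> B. B \<notin> carrier (QH D) \<Longrightarrow> x \<mu> B = 0"
  shows "sft_mult D kind (mono_elt D \<nu>) x = mul_mono D (kind = SFT) \<nu> x"
proof (intro ext)
  fix \<mu> B
  let ?f = "\<lambda>(\<nu>', A). mono_elt D \<nu> \<nu>' A * mul_e D A (mul_mono D (kind = SFT) \<nu>' x) \<mu> B"
  have e: "mul_e D \<one>\<^bsub>QH D\<^esub> (mul_mono D (kind = SFT) \<nu> x) = mul_mono D (kind = SFT) \<nu> x"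
    using x by (intro mul_e_one[OF G] mul_mono_vanishes_at) auto
  have "(\<Sum>i | ?f i \<noteq> 0. ?f i) = (\<Sum>i\<in>{(\<nu>, \<one>\<^bsub>QH D\<^esub>)}. ?f i)"
    by (rule sum.mono_neutral_left) (auto simp: mono_elt_def split: if_splits)
  then show "sft_mult D kind (mono_elt D \<nu>) x \<mu> B = mul_mono D (kind = SFT) \<nu> x \<mu> B"
    using v by (simp add: sft_mult_def Let_def e) (simp add: mono_elt_def)
qed

lemma sft_mult_0_right: "sft_mult D kind x (\<lambda>\<mu> B. 0) = (\<lambda>\<mu> B. 0)"
proof -
  have "mul_e D A (mul_mono D weyl \<nu> (\<lambda>\<mu> B. 0)) \<mu> B = 0" for A weyl \<nu> \<mu> B
    unfolding mul_e_def using mul_mono_vanishes_at[of "\<lambda>\<mu> B. 0" "B \<otimes>\<^bsub>QH D\<^esub> inv\<^bsub>QH D\<^esub> A" D weyl \<nu> \<mu>] by simp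
  then show ?thesis by (simp add: sft_mult_def fun_eq_iff)
qed

section \<open>Unit, weight 0 part and closure properties of the algebras\<close>

lemma sft_carrierI:
  assumes "\<And>K I J g A. x (K, I, J, g) A \<noteq> 0 \<Longrightarrow> valid_mono D (K, I, J, g) \<and> A \<in> carrier (QH D) \<and>
      (kind \<noteq> SFT \<longrightarrow> g = 0) \<and> (kind = CH \<longrightarrow> J = 0) \<and> (\<not> marked \<longrightarrow> K = 0)"
    and "\<And>K J g. finite {(I, A). x (K, I, J, g) A \<noteq> 0}"
  shows "x \<in> sft_carrier D kind marked"
  using assms unfolding sft_carrier_def mem_Collect_eq by blast

lemma sft_carrier_support:
  assumes "x \<in> sft_carrier D kind marked" "x (K, I, J, g) A \<noteq> 0"
  shows "valid_mono D (K, I, J, g) \<and> A \<in> carrier (QH D) \<and>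
      (kind \<noteq> SFT \<longrightarrow> g = 0) \<and> (kind = CH \<longrightarrow> J = 0) \<and> (\<not> marked \<longrightarrow> K = 0)"
  using assms unfolding sft_carrier_def mem_Collect_eq by blast

lemma sft_carrierD:
  assumes x: "x \<in> sft_carrier D kind marked"
  shows "x \<mu> A \<noteq> 0 \<Longrightarrow> valid_mono D \<mu>" "A \<notin> carrier (QH D) \<Longrightarrow> x \<mu> A = 0"
    "x \<mu> A \<noteq> 0 \<Longrightarrow> A \<in> carrier (QH D)" "finite {(I, A). x (K, I, J, g) A \<noteq> 0}"
proof -
  obtain K' I' J' g' where \<mu>: "\<mu> = (K', I', J', g')" by (cases \<mu>)
  show "x \<mu> A \<noteq> 0 \<Longrightarrow> valid_mono D \<mu>" "A \<notin> carrier (QH D) \<Longrightarrow> x \<mu> A = 0" "x \<mu> A \<noteq> 0 \<Longrightarrow> A \<in> carrier (QH D)"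
    using sft_carrier_support[OF x, of K' I' J' g' A] unfolding \<mu> by blast+
  have "\<forall>K J g. finite {(I, A). x (K, I, J, g) A \<noteq> 0}" using x unfolding sft_carrier_def mem_Collect_eq by (elim conjE)
  then show "finite {(I, A). x (K, I, J, g) A \<noteq> 0}" by (elim allE)
qed

lemma sft_mult_one_right:
  assumes G: "group (QH D)" and x: "x \<in> sft_carrier D kind marked"
  shows "sft_mult D kind x (one_elt D) = x"
proof (intro ext)
  fix \<mu> B
  let ?f = "\<lambda>i. x (fst i) (snd i) * mul_e D (snd i) (mul_mono D (kind = SFT) (fst i) (one_elt D)) \<mu> B"
  have f: "?f i = (if i = (\<mu>, B) then x \<mu> B else 0)" for i
  proof -
    obtain \<nu> A where i: "i = (\<nu>, A)" by (cases i)
    show ?thesis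
    proof (cases "x \<nu> A = 0")
      case False
      then have "valid_mono D \<nu>" "A \<in> carrier (QH D)" using sft_carrierD(1,3)[OF x] by blast+
      then show ?thesis
        unfolding i by (simp add: mul_mono_one mul_e_mono_elt[OF G] del: valid_mono.simps mul_mono.simps)
    qed (auto simp: i)
  qed
  have "(\<Sum>i | ?f i \<noteq> 0. ?f i) = (\<Sum>i\<in>{(\<mu>, B)}. ?f i)"
    by (rule sum.mono_neutral_left) (auto simp only: f split: if_splits)
  also have "\<dots> = x \<mu> B" using f[of "(\<mu>, B)"] by simp
  finally show "sft_mult D kind x (one_elt D) \<mu> B = x \<mu> B"
    by (simp add: sft_mult_def Let_def split_beta del: mul_mono.simps)
qed

lemma weight0_part_mul_q: "weight0_part (mul_q D k x) = mul_q D k (weight0_part x)"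
  by (auto simp: fun_eq_iff weight0_part_def mul_q_def)

lemma weight0_part_foldr_mul_q: "weight0_part (foldr (mul_q D) ks x) = foldr (mul_q D) ks (weight0_part x)"
  by (induction ks) (simp_all add: weight0_part_mul_q)

lemma weight0_part_idem [simp]: "weight0_part (weight0_part x) = weight0_part x"
  by (auto simp: weight0_part_def fun_eq_iff)

lemma mul_e_weight0_part: "weight0_part (mul_e D A x) = mul_e D A (weight0_part x)"
  by (auto simp: weight0_part_def fun_eq_iff mul_e_def)

text \<open>Passing to weight 0 is multiplicative: monomials of positive weight contribute only to
  positive weight, and left multiplication by monomials in the q's is the same in the Weyl algebra
  and in the supercommutative ones.\<close>

lemma weight0_part_sft_mult:
  "weight0_part (sft_mult D kind x y) = sft_mult D CH (weight0_part x) (weight0_part y)"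
proof (intro ext)
  fix \<mu> B
  have mm: "mul_mono D weyl \<nu> (weight0_part y) = weight0_part (mul_mono D weyl' \<nu> y)" if "weight \<nu> = 0" for \<nu> weyl weyl'
    using that unfolding weight_eq_0_iff by (auto simp: weight0_part_foldr_mul_q)
  have e0: "x \<nu> A * mul_e D A (mul_mono D (kind = SFT) \<nu> y) \<mu> B =
      weight0_part x \<nu> A * mul_e D A (mul_mono D (CH = SFT) \<nu> (weight0_part y)) \<mu> B" if \<mu>: "weight \<mu> = 0" for \<nu> A
  proof (cases "weight \<nu> = 0")
    case True
    then show ?thesis
      using \<mu> by (simp add: mm[of \<nu> _ "kind = SFT"] mul_e_weight0_part[symmetric]) (simp add: weight0_part_def)
  next
    case False
    then have "mul_e D A (mul_mono D (kind = SFT) \<nu> y) \<mu> B = 0"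
      using \<mu> by (intro filteredD[OF filtered_mul_e[OF filtered_mul_mono[OF filtered_0]]]) simp
    then show ?thesis using False by (simp add: weight0_part_def)
  qed
  have e1: "weight0_part x \<nu> A * mul_e D A (mul_mono D (CH = SFT) \<nu> (weight0_part y)) \<mu> B = 0" if \<mu>: "weight \<mu> \<noteq> 0" for \<nu> A
  proof (cases "weight \<nu> = 0")
    case True
    then show ?thesis
      using \<mu> by (simp add: mm[of \<nu> _ False] mul_e_weight0_part[symmetric]) (simp add: weight0_part_def)
  qed (simp add: weight0_part_def)
  show "weight0_part (sft_mult D kind x y) \<mu> B = sft_mult D CH (weight0_part x) (weight0_part y) \<mu> B"
  proof (cases "weight \<mu> = 0")
    case True
    have "weight0_part (sft_mult D kind x y) \<mu> B = sft_mult D kind x y \<mu> B"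
      using True by (simp add: weight0_part_def)
    \<comment> \<open>The summands agree one by one, hence so do the index sets, which consist of
      the nonzero summands.\<close>
    then show ?thesis unfolding sft_mult_def Let_def by (simp only: e0[OF True])
  next
    case False
    have "sft_mult D CH (weight0_part x) (weight0_part y) \<mu> B = 0"
      unfolding sft_mult_def Let_def by (simp only: e1[OF False] case_prod_unfold sum.neutral_const)
    then show ?thesis using False by (subst weight0_part_def) simp
  qed
qed

text \<open>A term of positive weight on the left pushes \<open>y\<close> beyond weight
  \<open>n\<close>, so only the weight 0 terms of \<open>x\<close> are seen. The set
  \<open>S\<close> may exceed their support, which allows several products to be summed over one
  index set.\<close>

lemma sft_mult_low_weight:
  assumes y: "filtered n y" and \<mu>: "weight \<mu> \<le> n"
    and S: "finite S" "\<And>I A. x (0, I, 0, 0) A \<noteq> 0 \<Longrightarrow> (I, A) \<in> S"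
  shows "sft_mult D kind x y \<mu> B =
    (\<Sum>(I, A)\<in>S. x (0, I, 0, 0) A * mul_e D A (mul_mono D (kind = SFT) (0, I, 0, 0) y) \<mu> B)"
proof -
  let ?f = "\<lambda>(\<nu>, A). x \<nu> A * mul_e D A (mul_mono D (kind = SFT) \<nu> y) \<mu> B"
  let ?i = "\<lambda>(I, A). ((0, I, 0, 0) :: mono, A)"
  have w: "weight \<nu> = 0" if "?f (\<nu>, A) \<noteq> 0" for \<nu> A
  proof (rule ccontr)
    assume "weight \<nu> \<noteq> 0"
    then have "mul_e D A (mul_mono D (kind = SFT) \<nu> y) \<mu> B = 0"
      using \<mu> by (intro filteredD[OF filtered_mul_e[OF filtered_mul_mono[OF y]]]) simp
    then show False using that by simp
  qed
  have "(\<Sum>i | ?f i \<noteq> 0. ?f i) = (\<Sum>i\<in>?i ` S. ?f i)"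
  proof (rule sum.mono_neutral_left)
    show "{i. ?f i \<noteq> 0} \<subseteq> ?i ` S"
    proof
      fix i assume i: "i \<in> {i. ?f i \<noteq> 0}"
      obtain \<nu> A where [simp]: "i = (\<nu>, A)" by (cases i)
      obtain I where [simp]: "\<nu> = (0, I, 0, 0)" using w[of \<nu> A] i unfolding weight_eq_0_iff by auto
      have "(I, A) \<in> S" using i by (intro S(2)) auto
      then show "i \<in> ?i ` S" by force
    qed
  qed (use S in auto)
  also have "\<dots> = (\<Sum>i\<in>S. ?f (?i i))"
    by (rule sum.reindex[THEN trans]) (auto simp: inj_on_def)
  finally show ?thesis by (simp add: sft_mult_def Let_def split_beta del: mul_mono.simps)
qed

lemma sft_carrier_zero [simp]: "(\<lambda>\<mu> B. 0) \<in> sft_carrier D kind marked"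
  by (simp add: sft_carrier_def)

lemma sft_carrier_add:
  assumes x: "x \<in> sft_carrier D kind marked" and y: "y \<in> sft_carrier D kind marked"
  shows "(\<lambda>\<mu> B. x \<mu> B + y \<mu> B) \<in> sft_carrier D kind marked"
proof (rule sft_carrierI)
  fix K I J g A assume "x (K, I, J, g) A + y (K, I, J, g) A \<noteq> 0"
  then have "x (K, I, J, g) A \<noteq> 0 \<or> y (K, I, J, g) A \<noteq> 0" by auto
  then show "valid_mono D (K, I, J, g) \<and> A \<in> carrier (QH D) \<and>
      (kind \<noteq> SFT \<longrightarrow> g = 0) \<and> (kind = CH \<longrightarrow> J = 0) \<and> (\<not> marked \<longrightarrow> K = 0)"
    by (elim disjE) (erule sft_carrier_support[OF x], erule sft_carrier_support[OF y])
next
  fix K J g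
  show "finite {(I, A). x (K, I, J, g) A + y (K, I, J, g) A \<noteq> 0}"
    by (rule finite_subset[OF _ finite_UnI[OF sft_carrierD(4)[OF x, of K J g] sft_carrierD(4)[OF y, of K J g]]]) auto
qed

text \<open>Both conditions defining the carrier concern the support alone.\<close>

lemma sft_carrier_if_support:
  assumes x: "x \<in> sft_carrier D kind marked" and y: "\<And>\<mu> A. y \<mu> A \<noteq> 0 \<Longrightarrow> x \<mu> A \<noteq> 0"
  shows "y \<in> sft_carrier D kind marked"
proof (rule sft_carrierI)
  show "finite {(I, A). y (K, I, J, g) A \<noteq> 0}" for K J g
    by (rule finite_subset[OF _ sft_carrierD(4)[OF x, of K J g]]) (use y in auto)
qed (use sft_carrier_support[OF x] y in blast)

lemma sft_carrier_cmult:
  "x \<in> sft_carrier D kind marked \<Longrightarrow> (\<lambda>\<mu> B. r * x \<mu> B) \<in> sft_carrier D kind marked"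
  by (erule sft_carrier_if_support) auto

lemma sft_carrier_diff:
  assumes "x \<in> sft_carrier D kind marked" "y \<in> sft_carrier D kind marked"
  shows "(\<lambda>\<mu> B. x \<mu> B - y \<mu> B) \<in> sft_carrier D kind marked"
  using sft_carrier_add[OF assms(1) sft_carrier_cmult[OF assms(2), of "-1"]] by simp

lemma sft_carrier_sum:
  assumes "\<And>i. i \<in> S \<Longrightarrow> x i \<in> sft_carrier D kind marked"
  shows "(\<lambda>\<mu> B. \<Sum>i\<in>S. x i \<mu> B) \<in> sft_carrier D kind marked"
  using assms by (induction S rule: infinite_finite_induct) (auto intro: sft_carrier_add)

lemma sft_carrier_restrict:
  "x \<in> sft_carrier D kind marked \<Longrightarrow> (\<lambda>\<mu> B. if P \<mu> then x \<mu> B else 0) \<in> sft_carrier D kind marked"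
  by (erule sft_carrier_if_support) (auto split: if_splits)

lemma sft_carrier_mono_elt:
  assumes G: "group (QH D)" and "kind \<noteq> SFT \<longrightarrow> g = 0" "kind = CH \<longrightarrow> J = 0" "\<not> marked \<longrightarrow> K = 0"
  shows "mono_elt D (K, I, J, g) \<in> sft_carrier D kind marked"
proof (rule sft_carrierI)
  fix K' I' J' g' A assume "mono_elt D (K, I, J, g) (K', I', J', g') A \<noteq> 0"
  then show "valid_mono D (K', I', J', g') \<and> A \<in> carrier (QH D) \<and>
      (kind \<noteq> SFT \<longrightarrow> g' = 0) \<and> (kind = CH \<longrightarrow> J' = 0) \<and> (\<not> marked \<longrightarrow> K' = 0)"
    using assms(2-) by (auto simp: mono_elt_def group.is_monoid[OF G] monoid.one_closed simp del: valid_mono.simps split: if_splits)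
next
  fix K' J' g'
  show "finite {(I', A). mono_elt D (K, I, J, g) (K', I', J', g') A \<noteq> 0}"
    by (rule finite_subset[of _ "{(I, \<one>\<^bsub>QH D\<^esub>)}"]) (auto simp: mono_elt_def simp del: valid_mono.simps split: if_splits)
qed

lemma sft_carrier_mul_q:
  assumes x: "x \<in> sft_carrier D kind marked"
  shows "mul_q D k x \<in> sft_carrier D kind marked"
proof -
  have nz: "valid_mono D (K, I, J, g) \<and> x (K, I - Poly_Mapping.single k 1, J, g) A \<noteq> 0 \<and> I = I - Poly_Mapping.single k 1 + Poly_Mapping.single k 1"
    if "mul_q D k x (K, I, J, g) A \<noteq> 0" for K I J g A
    using that mindex_diff_single[of I k] by (auto simp: mul_q_def simp del: valid_mono.simps split: if_splits)
  show ?thesis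
  proof (rule sft_carrierI)
    fix K I J g A assume "mul_q D k x (K, I, J, g) A \<noteq> 0"
    from nz[OF this] show "valid_mono D (K, I, J, g) \<and> A \<in> carrier (QH D) \<and>
        (kind \<noteq> SFT \<longrightarrow> g = 0) \<and> (kind = CH \<longrightarrow> J = 0) \<and> (\<not> marked \<longrightarrow> K = 0)"
      using sft_carrier_support[OF x] by blast
  next
    fix K J g
    show "finite {(I, A). mul_q D k x (K, I, J, g) A \<noteq> 0}"
    proof (rule finite_subset)
      show "{(I, A). mul_q D k x (K, I, J, g) A \<noteq> 0} \<subseteq>
          (\<lambda>(I, A). (I + Poly_Mapping.single k 1, A)) ` {(I, A). x (K, I, J, g) A \<noteq> 0}"
      proof clarify
        fix I A assume "mul_q D k x (K, I, J, g) A \<noteq> 0"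
        from nz[OF this] obtain nz': "x (K, I - Poly_Mapping.single k 1, J, g) A \<noteq> 0"
          and I: "I = I - Poly_Mapping.single k 1 + Poly_Mapping.single k 1" by (elim conjE)
        have "(I - Poly_Mapping.single k 1 + Poly_Mapping.single k 1, A) \<in>
            (\<lambda>(I, A). (I + Poly_Mapping.single k 1, A)) ` {(I, A). x (K, I, J, g) A \<noteq> 0}"
          by (rule image_eqI[of _ _ "(I - Poly_Mapping.single k 1, A)"]) (simp_all only: split_conv mem_Collect_eq nz' simp_thms)
        then show "(I, A) \<in> (\<lambda>(I, A). (I + Poly_Mapping.single k 1, A)) ` {(I, A). x (K, I, J, g) A \<noteq> 0}"
          by (simp only: I[symmetric])
      qed
    qed (use sft_carrierD(4)[OF x] in auto)
  qed
qed

lemma sft_carrier_mul_e: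
  assumes G: "group (QH D)" and A: "A \<in> carrier (QH D)" and x: "x \<in> sft_carrier D kind marked"
  shows "mul_e D A x \<in> sft_carrier D kind marked"
proof -
  interpret group "QH D" by (rule G)
  have nz: "B \<in> carrier (QH D) \<and> x \<mu> (B \<otimes>\<^bsub>QH D\<^esub> inv\<^bsub>QH D\<^esub> A) \<noteq> 0 \<and> B = B \<otimes>\<^bsub>QH D\<^esub> inv\<^bsub>QH D\<^esub> A \<otimes>\<^bsub>QH D\<^esub> A"
    if "mul_e D A x \<mu> B \<noteq> 0" for \<mu> B
    using that A by (auto simp: mul_e_def m_assoc split: if_splits)
  show ?thesis
  proof (rule sft_carrierI)
    fix K I J g B assume "mul_e D A x (K, I, J, g) B \<noteq> 0"
    from nz[OF this] show "valid_mono D (K, I, J, g) \<and> B \<in> carrier (QH D) \<and>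
        (kind \<noteq> SFT \<longrightarrow> g = 0) \<and> (kind = CH \<longrightarrow> J = 0) \<and> (\<not> marked \<longrightarrow> K = 0)"
      using sft_carrier_support[OF x] by blast
  next
    fix K J g
    show "finite {(I, B). mul_e D A x (K, I, J, g) B \<noteq> 0}"
    proof (rule finite_subset)
      show "{(I, B). mul_e D A x (K, I, J, g) B \<noteq> 0} \<subseteq> (\<lambda>(I, B). (I, B \<otimes>\<^bsub>QH D\<^esub> A)) ` {(I, B). x (K, I, J, g) B \<noteq> 0}"
      proof clarify
        fix I B assume "mul_e D A x (K, I, J, g) B \<noteq> 0"
        from nz[OF this] obtain nz': "x (K, I, J, g) (B \<otimes>\<^bsub>QH D\<^esub> inv\<^bsub>QH D\<^esub> A) \<noteq> 0"
          and B: "B = B \<otimes>\<^bsub>QH D\<^esub> inv\<^bsub>QH D\<^esub> A \<otimes>\<^bsub>QH D\<^esub> A" by (elim conjE)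
        have "(I, B \<otimes>\<^bsub>QH D\<^esub> inv\<^bsub>QH D\<^esub> A \<otimes>\<^bsub>QH D\<^esub> A) \<in>
            (\<lambda>(I, B). (I, B \<otimes>\<^bsub>QH D\<^esub> A)) ` {(I, B). x (K, I, J, g) B \<noteq> 0}"
          by (rule image_eqI[of _ _ "(I, B \<otimes>\<^bsub>QH D\<^esub> inv\<^bsub>QH D\<^esub> A)"]) (simp_all only: split_conv mem_Collect_eq nz' simp_thms)
        then show "(I, B) \<in> (\<lambda>(I, B). (I, B \<otimes>\<^bsub>QH D\<^esub> A)) ` {(I, B). x (K, I, J, g) B \<noteq> 0}"
          by (simp only: B[symmetric])
      qed
    qed (use sft_carrierD(4)[OF x] in auto)
  qed
qed

lemma sft_carrier_CH_subset: "sft_carrier D CH False \<subseteq> sft_carrier D kind marked"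
  unfolding sft_carrier_def by blast

lemma weight0_part_CH:
  assumes "x \<in> sft_carrier D CH False"
  shows "weight0_part x = x"
proof (intro ext)
  fix \<mu> :: mono and B
  obtain K I J g where "\<mu> = (K, I, J, g)" by (cases \<mu>)
  then show "weight0_part x \<mu> B = x \<mu> B"
    using sft_carrier_support[OF assms, of K I J g B] by (auto simp: weight0_part_def simp del: valid_mono.simps)
qed

lemma weight0_part_in_CH:
  assumes "x \<in> sft_carrier D kind marked"
  shows "weight0_part x \<in> sft_carrier D CH False"
proof -
  have x0: "weight0_part x \<in> sft_carrier D kind marked"
    unfolding weight0_part_def by (rule sft_carrier_restrict[OF assms])
  show ?thesis
  proof (rule sft_carrierI)
    fix K I J g A assume *: "weight0_part x (K, I, J, g) A \<noteq> 0"
    then have "weight (K, I, J, g) = 0" by (auto simp: weight0_part_def split: if_splits)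
    then show "valid_mono D (K, I, J, g) \<and> A \<in> carrier (QH D) \<and>
        (CH \<noteq> SFT \<longrightarrow> g = 0) \<and> (CH = CH \<longrightarrow> J = 0) \<and> (\<not> False \<longrightarrow> K = 0)"
      using sft_carrier_support[OF x0 *] by simp
  qed (rule sft_carrierD(4)[OF x0])
qed

lemma finite_support_CH:
  assumes "x \<in> sft_carrier D CH False"
  shows "finite {(\<mu>, A). x \<mu> A \<noteq> 0}"
proof (rule finite_subset)
  show "{(\<mu>, A). x \<mu> A \<noteq> 0} \<subseteq> (\<lambda>(I, A). ((0, I, 0, 0), A)) ` {(I, A). x (0, I, 0, 0) A \<noteq> 0}"
  proof clarify
    fix K I J g A assume "x (K, I, J, g) A \<noteq> 0"
    with sft_carrier_support[OF assms this] show "((K, I, J, g), A) \<in> (\<lambda>(I, A). ((0, I, 0, 0), A)) ` {(I, A). x (0, I, 0, 0) A \<noteq> 0}"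
      by force
  qed
qed (use sft_carrierD(4)[OF assms] in auto)

text \<open>A polynomial in the q's has finitely many terms, and multiplication by each of them
  preserves the algebra. This covers the homotopy, whose left factor comes from contact
  homology.\<close>

lemma sft_mult_CH_in_carrier:
  assumes G: "group (QH D)" and y: "y \<in> sft_carrier D CH False" and x: "x \<in> sft_carrier D kind marked"
  shows "sft_mult D kind y x \<in> sft_carrier D kind marked"
proof -
  let ?S = "{(\<nu>, A). y \<nu> A \<noteq> 0}"
  let ?g = "\<lambda>i \<mu> B. y (fst i) (snd i) * mul_e D (snd i) (mul_mono D (kind = SFT) (fst i) x) \<mu> B"
  have "sft_mult D kind y x = (\<lambda>\<mu> B. \<Sum>i\<in>?S. ?g i \<mu> B)"
  proof (intro ext)
    fix \<mu> B
    have "(\<Sum>i | ?g i \<mu> B \<noteq> 0. ?g i \<mu> B) = (\<Sum>i\<in>?S. ?g i \<mu> B)"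
      by (rule sum.mono_neutral_left) (use finite_support_CH[OF y] in auto)
    then show "sft_mult D kind y x \<mu> B = (\<Sum>i\<in>?S. ?g i \<mu> B)"
      by (simp add: sft_mult_def Let_def split_beta)
  qed
  moreover have "(\<lambda>\<mu> B. \<Sum>i\<in>?S. ?g i \<mu> B) \<in> sft_carrier D kind marked"
  proof (rule sft_carrier_sum)
    fix i assume "i \<in> ?S"
    then obtain K I J g A where i: "i = ((K, I, J, g), A)" "y (K, I, J, g) A \<noteq> 0" by (cases i) auto
    then have 0: "K = 0" "J = 0" "g = 0" and A: "A \<in> carrier (QH D)" using sft_carrier_support[OF y] by auto
    have "foldr (mul_q D) ks x \<in> sft_carrier D kind marked" for ks
      by (induction ks) (auto simp: x sft_carrier_mul_q)
    then show "?g i \<in> sft_carrier D kind marked"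
      unfolding i 0 by (auto intro!: sft_carrier_cmult sft_carrier_mul_e[OF G A])
  qed
  ultimately show ?thesis by simp
qed

section \<open>The differentials\<close>

lemma q_elt_in_carrier: "group (QH D) \<Longrightarrow> q_elt D k \<in> sft_carrier D kind marked"
  unfolding q_elt_def by (rule sft_carrier_mono_elt) auto

lemma valid_mono_single:
  "k \<in> orbs D \<Longrightarrow> valid_mono D (0, Poly_Mapping.single k 1, 0, 0)"
  "k \<in> orbs D \<Longrightarrow> valid_mono D (0, 0, Poly_Mapping.single k 1, 0)"
  "j < nform D \<Longrightarrow> valid_mono D (Poly_Mapping.single j 1, 0, 0, 0)"
  by (auto simp: lookup_single when_def)

lemma q_elt_mult:
  assumes "group (QH D)" "k \<in> orbs D" "\<And>\<mu> B. B \<notin> carrier (QH D) \<Longrightarrow> x \<mu> B = 0"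
  shows "sft_mult D kind (q_elt D k) x = mul_q D k x"
  unfolding q_elt_def using sft_mult_mono_elt[OF assms(1) valid_mono_single(1)[OF assms(2)] assms(3)]
  by (simp del: One_nat_def)

lemma p_elt_mult:
  assumes "group (QH D)" "k \<in> orbs D" "\<And>\<mu> B. B \<notin> carrier (QH D) \<Longrightarrow> x \<mu> B = 0"
  shows "sft_mult D kind (p_elt D k) x = mul_p D (kind = SFT) k x"
  unfolding p_elt_def using sft_mult_mono_elt[OF assms(1) valid_mono_single(2)[OF assms(2)] assms(3)]
  by (simp del: One_nat_def)

lemma t_elt_mult:
  assumes "group (QH D)" "j < nform D" "\<And>\<mu> B. B \<notin> carrier (QH D) \<Longrightarrow> x \<mu> B = 0"
  shows "sft_mult D kind (t_elt D j) x = mul_t D j x"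
  unfolding t_elt_def using sft_mult_mono_elt[OF assms(1) valid_mono_single(3)[OF assms(2)] assms(3)]
  by (simp del: One_nat_def)

lemma h_elt_mult:
  assumes "group (QH D)" "\<And>\<mu> B. B \<notin> carrier (QH D) \<Longrightarrow> x \<mu> B = 0"
  shows "sft_mult D kind (h_elt D) x = mul_h x"
  unfolding h_elt_def using sft_mult_mono_elt[OF assms(1) _ assms(2), of "(0, 0, 0, 1)"]
  by simp

definition generator :: "('a::euclidean_space, 'b) sft_data_scheme \<Rightarrow> sft_kind \<Rightarrow> bool \<Rightarrow> nat \<Rightarrow> 'a series \<Rightarrow> bool" where
  "generator D kind marked w \<gamma> \<longleftrightarrow>
     (w = 0 \<and> (\<exists>k\<in>orbs D. \<gamma> = q_elt D k)) \<or>
     (w = 1 \<and> kind \<noteq> CH \<and> (\<exists>k\<in>orbs D. \<gamma> = p_elt D k)) \<or>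
     (w = 1 \<and> kind = SFT \<and> \<gamma> = h_elt D) \<or>
     (w = 1 \<and> marked \<and> (\<exists>j<nform D. \<gamma> = t_elt D j))"

text \<open>The differential is prescribed on generators and controlled on products, so facts about
  it on monomials are proved by multiplying with one generator at a time from the left. The number
  in \<open>P\<close> adds up the weights of these generators.\<close>

lemma mono_elt_induct:
  assumes G: "group (QH D)" and \<mu>: "valid_mono D (K, I, J, g)"
    and A: "kind \<noteq> SFT \<longrightarrow> g = 0" "kind = CH \<longrightarrow> J = 0" "\<not> marked \<longrightarrow> K = 0"
    and one: "P 0 (one_elt D)"
    and step: "\<And>w n \<gamma> x. generator D kind marked w \<gamma> \<Longrightarrow> x \<in> sft_carrier D kind marked \<Longrightarrow> P n x \<Longrightarrow> P (w + n) (sft_mult D kind \<gamma> x)"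
  shows "P (weight (K, I, J, g)) (mono_elt D (K, I, J, g))"
proof -
  note off = mono_elt_0_off_carrier[OF G]
  have h: "P g (mono_elt D (0, 0, 0, g))"
    using A(1)
  proof (induction g)
    case 0
    then show ?case using one by simp
  next
    case (Suc g)
    then have "P (1 + g) (sft_mult D kind (h_elt D) (mono_elt D (0, 0, 0, g)))"
      by (intro step sft_carrier_mono_elt[OF G]) (auto simp: generator_def)
    then show ?case by (simp add: h_elt_mult[OF G off] mul_h_mono_elt)
  qed
  have p: "valid_mono D (0, 0, J, g) \<Longrightarrow> kind = CH \<longrightarrow> J = 0 \<Longrightarrow> P (msize J + g) (mono_elt D (0, 0, J, g))"
  proof (induction J rule: mindex_induct)
    case zero
    then show ?case using h by simp
  next
    case (add k J)
    have ne: "J + Poly_Mapping.single k 1 \<noteq> 0"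
      by (metis add_is_0 lookup_add lookup_single_eq lookup_zero zero_neq_one)
    then have kind: "kind \<noteq> CH" using add.prems(2) by blast
    have k: "k \<in> orbs D"
      using add.prems(1) by (auto simp: in_keys_iff lookup_add subset_iff)
    have "P (1 + (msize J + g)) (sft_mult D kind (p_elt D k) (mono_elt D (0, 0, J, g)))"
    proof (rule step)
      show "generator D kind marked 1 (p_elt D k)" using kind k by (auto simp: generator_def)
      show "mono_elt D (0, 0, J, g) \<in> sft_carrier D kind marked" using A(1) kind by (intro sft_carrier_mono_elt[OF G]) auto
      show "P (msize J + g) (mono_elt D (0, 0, J, g))"
        using add.IH[OF valid_mono_add_singleD(3)[OF add.prems(1)]] kind by blast
    qed
    then show ?case
      by (simp add: p_elt_mult[OF G k off] mul_p_mono_elt[OF add.hyps add.prems(1)] msize_add add.commute[of _ 1] add.assoc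
          del: One_nat_def valid_mono.simps)
  qed
  have q: "valid_mono D (0, I, J, g) \<Longrightarrow> P (msize J + g) (mono_elt D (0, I, J, g))"
  proof (induction I rule: mindex_induct)
    case zero
    then show ?case using p A(2) by blast
  next
    case (add k I)
    have k: "k \<in> orbs D"
      using add.prems by (auto simp: in_keys_iff lookup_add subset_iff)
    have "P (0 + (msize J + g)) (sft_mult D kind (q_elt D k) (mono_elt D (0, I, J, g)))"
    proof (rule step)
      show "generator D kind marked 0 (q_elt D k)" using k by (auto simp: generator_def)
      show "mono_elt D (0, I, J, g) \<in> sft_carrier D kind marked" using A by (intro sft_carrier_mono_elt[OF G]) auto
      show "P (msize J + g) (mono_elt D (0, I, J, g))"
        by (rule add.IH[OF valid_mono_add_singleD(2)[OF add.prems(1)]])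
    qed
    then show ?case
      by (simp add: q_elt_mult[OF G k off] mul_q_mono_elt[OF add.hyps add.prems(1)] del: One_nat_def valid_mono.simps)
  qed
  have "valid_mono D (K, I, J, g) \<Longrightarrow> \<not> marked \<longrightarrow> K = 0 \<Longrightarrow> P (msize K + (msize J + g)) (mono_elt D (K, I, J, g))"
  proof (induction K rule: mindex_induct)
    case zero
    then show ?case using q by simp
  next
    case (add j K)
    have ne: "K + Poly_Mapping.single j 1 \<noteq> 0"
      by (metis add_is_0 lookup_add lookup_single_eq lookup_zero zero_neq_one)
    then have mk: "marked" using add.prems(2) by blast
    have j: "j < nform D"
      using add.prems(1) by (auto simp: in_keys_iff lookup_add subset_iff)
    have "P (1 + (msize K + (msize J + g))) (sft_mult D kind (t_elt D j) (mono_elt D (K, I, J, g)))"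
    proof (rule step)
      show "generator D kind marked 1 (t_elt D j)" using mk j by (auto simp: generator_def)
      show "mono_elt D (K, I, J, g) \<in> sft_carrier D kind marked" using A mk by (intro sft_carrier_mono_elt[OF G]) auto
      show "P (msize K + (msize J + g)) (mono_elt D (K, I, J, g))"
        using add.IH[OF valid_mono_add_singleD(1)[OF add.prems(1)]] mk by blast
    qed
    then show ?case
      by (simp add: t_elt_mult[OF G j off] mul_t_mono_elt[OF add.hyps add.prems(1)] msize_add add.commute[of _ 1] add.assoc
          del: One_nat_def valid_mono.simps)
  qed
  then show ?thesis using \<mu> A(3) by (simp add: add.assoc del: valid_mono.simps)
qed

lemma generator_in_carrier:
  assumes "group (QH D)" "generator D kind marked w \<gamma>"
  shows "\<gamma> \<in> sft_carrier D kind marked"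
  using assms(2) unfolding generator_def q_elt_def p_elt_def h_elt_def t_elt_def
  by (elim disjE conjE bexE exE) (auto intro!: sft_carrier_mono_elt[OF assms(1)])

lemma has_parity_mono_elt: "has_parity D (mono_parity D \<mu>) (mono_elt D \<mu>)"
  by (simp add: has_parity_def mono_elt_def del: split_paired_All mono_parity.simps valid_mono.simps)

lemma generator_has_parity:
  assumes "generator D kind marked w \<gamma>"
  obtains \<epsilon> where "has_parity D \<epsilon> \<gamma>"
  using assms has_parity_mono_elt unfolding generator_def q_elt_def p_elt_def h_elt_def t_elt_def by metis

lemma filtered_mono_elt: "weight \<mu> = w \<Longrightarrow> filtered w (mono_elt D \<mu>)"
  by (auto simp: filtered_def mono_elt_def)

lemma generator_filtered:
  assumes "generator D kind marked w \<gamma>"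
  shows "filtered w \<gamma>"
  using assms unfolding generator_def q_elt_def p_elt_def h_elt_def t_elt_def
  by (elim disjE conjE bexE exE) (auto intro!: filtered_mono_elt)

section \<open>Weights in the differentials of the generators\<close>

lemma filtered_diff_term:
  assumes "diff_term D pos k (g, as, A, I, J) \<mu> B \<noteq> 0"
  shows "length as + msize J + g \<le> weight \<mu>"
proof -
  have "filtered (msize J + g) (mono_elt D (0, I, J, g))" by (rule filtered_mono_elt) simp
  then have f: "filtered (length as + (msize J + g)) (mul_e D (rels D #>\<^bsub>H2 D\<^esub> A) (foldr (mul_t D) as (mono_elt D (0, I, J, g))))"
    by (intro filtered_mul_e filtered_foldr_mul_t)
  have "\<not> weight \<mu> < length as + (msize J + g)"
    using filteredD[OF f, of \<mu> B] assms by auto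
  then show ?thesis by simp
qed

text \<open>A count of genus g with m marked points and positive orbits J contributes to weight at
  least m + |J| + g. Weight 0 leaves exactly genus 0, no marked points and no further positive
  puncture, which are the counts of contact homology.\<close>

lemma weight0_part_diff_gen: "weight0_part (diff_gen D kind marked True k) = diff_gen D CH False True k"
proof (intro ext)
  fix \<mu> B
  show "weight0_part (diff_gen D kind marked True k) \<mu> B = diff_gen D CH False True k \<mu> B"
  proof (cases "weight \<mu> = 0")
    case True
    have "{\<iota>. \<iota> \<in> diff_index D kind marked \<and> diff_term D True k \<iota> \<mu> B \<noteq> 0} =
        {\<iota>. \<iota> \<in> diff_index D CH False \<and> diff_term D True k \<iota> \<mu> B \<noteq> 0}"
    proof (rule Collect_cong)
      fix \<iota> :: "nat \<times> nat list \<times> 'a chain set \<times> mindex \<times> mindex"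
      obtain g as A I J where \<iota>: "\<iota> = (g, as, A, I, J)" by (cases \<iota>)
      show "(\<iota> \<in> diff_index D kind marked \<and> diff_term D True k \<iota> \<mu> B \<noteq> 0) =
        (\<iota> \<in> diff_index D CH False \<and> diff_term D True k \<iota> \<mu> B \<noteq> 0)"
      proof (cases "diff_term D True k \<iota> \<mu> B = 0")
        case False
        then have "g = 0" "as = []" "J = 0" using filtered_diff_term[of D True k g as A I J \<mu> B] True by (auto simp: \<iota>)
        then show ?thesis by (auto simp: \<iota> diff_index_def)
      qed simp
    qed
    then show ?thesis using True by (simp add: weight0_part_def diff_gen_def)
  next
    case False
    have "diff_term D True k \<iota> \<mu> B = 0" if "\<iota> \<in> diff_index D CH False" for \<iota>
    proof -
      obtain g as A I J where \<iota>: "\<iota> = (g, as, A, I, J)" by (cases \<iota>)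
      have 0: "g = 0" "as = []" "J = 0" using that by (auto simp: \<iota> diff_index_def)
      have "\<mu> \<noteq> (0, I, 0, 0)" using False by auto
      then show ?thesis by (simp add: \<iota> 0 mul_e_def mono_elt_def)
    qed
    then have "{\<iota>. \<iota> \<in> diff_index D CH False \<and> diff_term D True k \<iota> \<mu> B \<noteq> 0} = {}" by blast
    then have "diff_gen D CH False True k \<mu> B = 0" unfolding diff_gen_def by (simp only: sum.empty)
    then show ?thesis using False by (simp add: weight0_part_def)
  qed
qed

text \<open>The geometric input: a term of weight 0 would count rational curves with
  \<open>k\<close> among their negative ends and no positive end. There are no such buildings, and
  by \<open>transversality\<close> the perturbed moduli space is then empty as well.\<close>

lemma filtered_diff_gen_negative:
  assumes "contact_manifold D" "reeb_field D" "compatible_acs D" "transversality D" "k \<in> orbs D"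
  shows "filtered 1 (diff_gen D kind marked False k)"
  unfolding filtered_def
proof (intro allI impI)
  fix \<mu> B assume \<mu>: "weight \<mu> < 1"
  have "diff_term D False k \<iota> \<mu> B = 0" if \<iota>in: "\<iota> \<in> diff_index D kind marked" for \<iota>
  proof (rule ccontr)
    assume nz: "diff_term D False k \<iota> \<mu> B \<noteq> 0"
    obtain g as A I J where \<iota>: "\<iota> = (g, as, A, I, J)" by (cases \<iota>)
    have 0: "g = 0" "as = []" "J = 0" using filtered_diff_term[of D False k g as A I J \<mu> B] \<mu> nz by (auto simp: \<iota>)
    have A: "A \<in> carrier (H2 D)" "Poly_Mapping.keys I \<subseteq> orbs D" using \<iota>in by (auto simp: \<iota> diff_index_def)
    have "moduli D False 0 0 A I 0 k = []"
      using assms(4) A assms(5) buildings_no_positive_orbits[OF assms(1-3), of 0 0 A I k]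
      unfolding transversality_def by force
    then have "curve_count D False 0 A I 0 k [] = 0" by (simp add: curve_count_def)
    then have "curve_count_rat D False 0 A I 0 k [] = 0" by (simp add: curve_count_rat_def)
    then show False using nz by (simp add: \<iota> 0)
  qed
  then have "{\<iota>. \<iota> \<in> diff_index D kind marked \<and> diff_term D False k \<iota> \<mu> B \<noteq> 0} = {}" by blast
  then show "diff_gen D kind marked False k \<mu> B = 0" unfolding diff_gen_def by (simp only: sum.empty)
qed

section \<open>Vanishing of the homology\<close>

text \<open>The maximum principle is condensed into the assumption \<open>negative\<close>. The rest
  is algebra, and one argument serves all six differentials.\<close>

locale sft_dga =
  fixes D :: "('a::euclidean_space, 'b) sft_data_scheme" and kind :: sft_kind and marked :: bool
    and d :: "'a series \<Rightarrow> 'a series"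
  assumes subgroup_rels: "subgroup (rels D) (H2 D)"
    and differential: "sft_differential D kind marked d"
    and negative: "\<And>k. k \<in> orbs D \<Longrightarrow> filtered 1 (diff_gen D kind marked False k)"
begin

abbreviation alg :: "'a series set" ("\<A>") where
  "\<A> \<equiv> sft_carrier D kind marked"

abbreviation mult :: "'a series \<Rightarrow> 'a series \<Rightarrow> 'a series" (infixl "\<odot>" 70) where
  "x \<odot> y \<equiv> sft_mult D kind x y"

lemma G: "group (QH D)"
  using subgroup_rels by (rule group_QH)

lemma d_q: "k \<in> orbs D \<Longrightarrow> d (q_elt D k) = diff_gen D kind marked True k"
  and d_p: "kind \<noteq> CH \<Longrightarrow> k \<in> orbs D \<Longrightarrow> d (p_elt D k) =
        (\<lambda>\<mu> B. (-1) ^ (qpar D k + 1) * diff_gen D kind marked False k \<mu> B)"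
  and d_h: "kind = SFT \<Longrightarrow> d (h_elt D) = (\<lambda>\<mu> B. 0)"
  and d_t: "marked \<Longrightarrow> j < nform D \<Longrightarrow> d (t_elt D j) = (\<lambda>\<mu> B. 0)"
  and d_closed: "x \<in> \<A> \<Longrightarrow> d x \<in> \<A>"
  and d_add: "x \<in> \<A> \<Longrightarrow> y \<in> \<A> \<Longrightarrow> d (\<lambda>\<mu> B. x \<mu> B + y \<mu> B) = (\<lambda>\<mu> B. d x \<mu> B + d y \<mu> B)"
  and d_smult: "x \<in> \<A> \<Longrightarrow> A \<in> carrier (QH D) \<Longrightarrow> d (\<lambda>\<mu> B. r * mul_e D A x \<mu> B) = (\<lambda>\<mu> B. r * mul_e D A (d x) \<mu> B)"
  and leibniz: "x \<in> \<A> \<Longrightarrow> y \<in> \<A> \<Longrightarrow> has_parity D \<epsilon> x \<Longrightarrow>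
        d (x \<odot> y) = (\<lambda>\<mu> B. (d x \<odot> y) \<mu> B + (-1) ^ \<epsilon> * (x \<odot> d y) \<mu> B)"
  and d_sum_parts: "x \<in> \<A> \<Longrightarrow> d x \<mu> B = (\<Sum>e | d (series_part x e) \<mu> B \<noteq> 0. d (series_part x e) \<mu> B)"
  and d_square: "x \<in> \<A> \<Longrightarrow> d (d x) = (\<lambda>\<mu> B. 0)"
proof -
  note * = differential[unfolded sft_differential_def Let_def]
  show "k \<in> orbs D \<Longrightarrow> d (q_elt D k) = diff_gen D kind marked True k" using * by (elim conjE) (erule bspec)
  show "kind \<noteq> CH \<Longrightarrow> k \<in> orbs D \<Longrightarrow> d (p_elt D k) =
        (\<lambda>\<mu> B. (-1) ^ (qpar D k + 1) * diff_gen D kind marked False k \<mu> B)" using * by (elim conjE) blast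
  show "kind = SFT \<Longrightarrow> d (h_elt D) = (\<lambda>\<mu> B. 0)" using * by (elim conjE) (erule mp)
  show "marked \<Longrightarrow> j < nform D \<Longrightarrow> d (t_elt D j) = (\<lambda>\<mu> B. 0)" using * by (elim conjE) blast
  show "x \<in> \<A> \<Longrightarrow> d x \<in> \<A>" using * by (elim conjE) (erule bspec)
  have "\<forall>x\<in>\<A>. \<forall>y\<in>\<A>. d (\<lambda>\<mu> B. x \<mu> B + y \<mu> B) = (\<lambda>\<mu> B. d x \<mu> B + d y \<mu> B)" using * by (elim conjE)
  then show "x \<in> \<A> \<Longrightarrow> y \<in> \<A> \<Longrightarrow> d (\<lambda>\<mu> B. x \<mu> B + y \<mu> B) = (\<lambda>\<mu> B. d x \<mu> B + d y \<mu> B)" by blast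
  have "\<forall>x\<in>\<A>. \<forall>r. \<forall>A\<in>carrier (QH D). d (\<lambda>\<mu> B. r * mul_e D A x \<mu> B) = (\<lambda>\<mu> B. r * mul_e D A (d x) \<mu> B)"
    using * by (elim conjE)
  then show "x \<in> \<A> \<Longrightarrow> A \<in> carrier (QH D) \<Longrightarrow> d (\<lambda>\<mu> B. r * mul_e D A x \<mu> B) = (\<lambda>\<mu> B. r * mul_e D A (d x) \<mu> B)" by blast
  have "\<forall>x\<in>\<A>. \<forall>y\<in>\<A>. \<forall>\<epsilon>. has_parity D \<epsilon> x \<longrightarrow>
        d (x \<odot> y) = (\<lambda>\<mu> B. (d x \<odot> y) \<mu> B + (-1) ^ \<epsilon> * (x \<odot> d y) \<mu> B)" using * by (elim conjE)
  then show "x \<in> \<A> \<Longrightarrow> y \<in> \<A> \<Longrightarrow> has_parity D \<epsilon> x \<Longrightarrow>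
        d (x \<odot> y) = (\<lambda>\<mu> B. (d x \<odot> y) \<mu> B + (-1) ^ \<epsilon> * (x \<odot> d y) \<mu> B)" by blast
  have "\<forall>x\<in>\<A>. \<forall>\<mu> B. finite {e. d (series_part x e) \<mu> B \<noteq> 0} \<and>
        d x \<mu> B = (\<Sum>e | d (series_part x e) \<mu> B \<noteq> 0. d (series_part x e) \<mu> B)" using * by (elim conjE)
  then show "x \<in> \<A> \<Longrightarrow> d x \<mu> B = (\<Sum>e | d (series_part x e) \<mu> B \<noteq> 0. d (series_part x e) \<mu> B)" by blast
  show "x \<in> \<A> \<Longrightarrow> d (d x) = (\<lambda>\<mu> B. 0)" using * by (elim conjE) (erule bspec)
qed

lemma off_carrier: "x \<in> \<A> \<Longrightarrow> B \<notin> carrier (QH D) \<Longrightarrow> x \<mu> B = 0"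
  by (rule sft_carrierD(2))

lemma one_in_alg: "one_elt D \<in> \<A>"
  by (rule sft_carrier_mono_elt[OF G]) auto

lemma one_mult: "x \<in> \<A> \<Longrightarrow> one_elt D \<odot> x = x"
  by (subst sft_mult_mono_elt[OF G valid_mono_one]) (simp_all add: off_carrier)

text \<open>Since 1 is even and equal to its square, the Leibniz rule reads d 1 = 2 d 1.\<close>

lemma d_one: "d (one_elt D) = (\<lambda>\<mu> B. 0)"
proof (intro ext)
  fix \<mu> B
  have "d (one_elt D \<odot> one_elt D) \<mu> B = (d (one_elt D) \<odot> one_elt D) \<mu> B + (-1) ^ mono_parity D (0, 0, 0, 0) * (one_elt D \<odot> d (one_elt D)) \<mu> B"
    by (subst leibniz[OF one_in_alg one_in_alg has_parity_mono_elt]) simp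
  then show "d (one_elt D) \<mu> B = 0"
    by (simp add: one_mult one_in_alg d_closed sft_mult_one_right[OF G d_closed[OF one_in_alg]])
qed

lemma d_zero: "d (\<lambda>\<mu> B. 0) = (\<lambda>\<mu> B. 0)"
  using d_smult[OF sft_carrier_zero, of "\<one>\<^bsub>QH D\<^esub>" 0] group.is_monoid[OF G] monoid.one_closed by fastforce

lemma mul_e_one_alg: "x \<in> \<A> \<Longrightarrow> mul_e D \<one>\<^bsub>QH D\<^esub> x = x"
  by (rule mul_e_one[OF G]) (simp add: off_carrier)

lemma d_cmult:
  assumes x: "x \<in> \<A>"
  shows "d (\<lambda>\<mu> B. r * x \<mu> B) = (\<lambda>\<mu> B. r * d x \<mu> B)"
proof -
  have "\<one>\<^bsub>QH D\<^esub> \<in> carrier (QH D)" using G by (simp add: group.is_monoid monoid.one_closed)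
  from d_smult[OF x this, of r] show ?thesis
    by (simp only: mul_e_one_alg[OF x] mul_e_one_alg[OF d_closed[OF x]])
qed

lemma d_diff:
  assumes "x \<in> \<A>" "y \<in> \<A>"
  shows "d (\<lambda>\<mu> B. x \<mu> B - y \<mu> B) = (\<lambda>\<mu> B. d x \<mu> B - d y \<mu> B)"
  using d_add[OF assms(1) sft_carrier_cmult[OF assms(2), of "-1"]] d_cmult[OF assms(2), of "-1"] by simp

lemma d_sum:
  assumes "\<And>i. i \<in> S \<Longrightarrow> x i \<in> \<A>"
  shows "d (\<lambda>\<mu> B. \<Sum>i\<in>S. x i \<mu> B) = (\<lambda>\<mu> B. \<Sum>i\<in>S. d (x i) \<mu> B)"
  using assms
proof (induction S rule: infinite_finite_induct)
  case (insert i S)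
  then have "d (\<lambda>\<mu> B. x i \<mu> B + (\<Sum>i\<in>S. x i \<mu> B)) = (\<lambda>\<mu> B. d (x i) \<mu> B + d (\<lambda>\<mu> B. \<Sum>i\<in>S. x i \<mu> B) \<mu> B)"
    by (intro d_add sft_carrier_sum) auto
  with insert show ?case by simp
qed (simp_all add: d_zero)

text \<open>A series with finite support is a finite combination of monomials over the group ring,
  so linearity determines \<open>d\<close>. This applies to each \<open>series_part\<close> of an
  element of the algebra, where the exponents of t, p and \<hbar> are fixed.\<close>

lemma d_finite_support:
  assumes x: "x \<in> \<A>" and fin: "finite {i. x (fst i) (snd i) \<noteq> 0}"
  shows "d x = (\<lambda>\<nu> B. \<Sum>i | x (fst i) (snd i) \<noteq> 0. x (fst i) (snd i) * mul_e D (snd i) (d (mono_elt D (fst i))) \<nu> B)"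
proof -
  let ?S = "{i. x (fst i) (snd i) \<noteq> 0}"
  have S: "valid_mono D (fst i)" "snd i \<in> carrier (QH D)" "mono_elt D (fst i) \<in> \<A>" if "i \<in> ?S" for i
  proof -
    obtain K I J g where i: "fst i = (K, I, J, g)" by (cases "fst i")
    show "valid_mono D (fst i)" "snd i \<in> carrier (QH D)" "mono_elt D (fst i) \<in> \<A>"
      using sft_carrier_support[OF x, of K I J g "snd i"] that unfolding i mem_Collect_eq
      by (auto intro!: sft_carrier_mono_elt[OF G] simp del: valid_mono.simps)
  qed
  have "x = (\<lambda>\<nu> B. \<Sum>i\<in>?S. x (fst i) (snd i) * mul_e D (snd i) (mono_elt D (fst i)) \<nu> B)"
  proof (intro ext)
    fix \<nu> B
    have "(\<Sum>i\<in>?S. x (fst i) (snd i) * mul_e D (snd i) (mono_elt D (fst i)) \<nu> B) = (\<Sum>i\<in>?S. if i = (\<nu>, B) then x \<nu> B else 0)"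
      using S by (intro sum.cong) (auto simp: mul_e_mono_elt[OF G] simp del: valid_mono.simps)
    also have "\<dots> = x \<nu> B" using fin by (simp add: sum.delta)
    finally show "x \<nu> B = (\<Sum>i\<in>?S. x (fst i) (snd i) * mul_e D (snd i) (mono_elt D (fst i)) \<nu> B)" by simp
  qed
  then have "d x = d (\<lambda>\<nu> B. \<Sum>i\<in>?S. x (fst i) (snd i) * mul_e D (snd i) (mono_elt D (fst i)) \<nu> B)" by (rule arg_cong)
  also have "\<dots> = (\<lambda>\<nu> B. \<Sum>i\<in>?S. d (\<lambda>\<nu> B. x (fst i) (snd i) * mul_e D (snd i) (mono_elt D (fst i)) \<nu> B) \<nu> B)"
    using S by (intro d_sum sft_carrier_cmult sft_carrier_mul_e[OF G])
  also have "\<dots> = (\<lambda>\<nu> B. \<Sum>i\<in>?S. x (fst i) (snd i) * mul_e D (snd i) (d (mono_elt D (fst i))) \<nu> B)"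
    using S by (intro ext sum.cong refl) (simp add: d_smult)
  finally show ?thesis .
qed

section \<open>The differential respects the weight\<close>

lemma filtered_d_generator:
  assumes "generator D kind marked w \<gamma>"
  shows "filtered w (d \<gamma>)"
  using assms negative unfolding generator_def
  by (elim disjE conjE bexE exE) (auto simp: d_p d_h d_t filtered_def)

text \<open>The Leibniz rule for a generator times \<open>x\<close> involves \<open>x\<close> as
  well as \<open>d x\<close>, so the induction carries the filtration of both.\<close>

lemma filtered_d_mono_elt:
  assumes "valid_mono D (K, I, J, g)" "kind \<noteq> SFT \<longrightarrow> g = 0" "kind = CH \<longrightarrow> J = 0" "\<not> marked \<longrightarrow> K = 0"
  shows "filtered (weight (K, I, J, g)) (d (mono_elt D (K, I, J, g)))"
proof -
  have "filtered (weight (K, I, J, g)) (mono_elt D (K, I, J, g)) \<and> filtered (weight (K, I, J, g)) (d (mono_elt D (K, I, J, g)))"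
  proof (rule mono_elt_induct[OF G assms, where P = "\<lambda>n x. filtered n x \<and> filtered n (d x)"])
    fix w n \<gamma> x assume \<gamma>: "generator D kind marked w \<gamma>" and x: "x \<in> \<A>" "filtered n x \<and> filtered n (d x)"
    obtain \<epsilon> where \<epsilon>: "has_parity D \<epsilon> \<gamma>" using generator_has_parity[OF \<gamma>] by blast
    have "filtered (w + n) (d \<gamma> \<odot> x)" "filtered (w + n) (\<gamma> \<odot> d x)" "filtered (w + n) (\<gamma> \<odot> x)"
      using x(2) by (auto intro!: filtered_sft_mult filtered_d_generator[OF \<gamma>] generator_filtered[OF \<gamma>])
    then show "filtered (w + n) (\<gamma> \<odot> x) \<and> filtered (w + n) (d (\<gamma> \<odot> x))"
      unfolding leibniz[OF generator_in_carrier[OF G \<gamma>] x(1) \<epsilon>] by (simp add: filtered_def)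
  qed simp
  then show ?thesis by simp
qed

lemma series_part_in_alg: "x \<in> \<A> \<Longrightarrow> series_part x e \<in> \<A>"
  by (erule sft_carrier_if_support) (auto simp: series_part_def split: prod.splits if_splits)

lemma series_part_finite_support:
  assumes "x \<in> \<A>"
  shows "finite {i. series_part x e (fst i) (snd i) \<noteq> 0}"
proof -
  obtain K J g where e: "e = (K, J, g)" by (cases e)
  have "{i. series_part x e (fst i) (snd i) \<noteq> 0} \<subseteq> (\<lambda>(I, A). ((K, I, J, g), A)) ` {(I, A). x (K, I, J, g) A \<noteq> 0}"
    by (auto simp: series_part_def e image_iff split: if_splits)
  then show ?thesis using sft_carrierD(4)[OF assms] by (meson finite_imageI finite_subset)
qed

text \<open>For infinite series finite additivity is not enough. By compatibility with formal sums
  the coefficients of \<open>d x\<close> are assembled from the differentials of the finitely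
  supported parts, whose monomials all have weight at least \<open>n\<close>.\<close>

lemma filtered_d:
  assumes x: "x \<in> \<A>" "filtered n x"
  shows "filtered n (d x)"
proof -
  have part: "d (series_part x e) \<mu> B = 0" if \<mu>: "weight \<mu> < n" for e \<mu> B
  proof -
    have "mul_e D (snd i) (d (mono_elt D (fst i))) \<mu> B = 0" if nz: "series_part x e (fst i) (snd i) \<noteq> 0" for i
    proof -
      obtain K I J g where i: "fst i = (K, I, J, g)" by (cases "fst i")
      have "x (K, I, J, g) (snd i) \<noteq> 0"
        using nz unfolding i by (auto simp: series_part_def split: prod.splits if_splits)
      then have f: "filtered (weight (K, I, J, g)) (d (mono_elt D (K, I, J, g)))" and le: "n \<le> weight (K, I, J, g)"
        using sft_carrier_support[OF x(1)] filteredD[OF x(2), of "(K, I, J, g)" "snd i"]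
        by (blast intro: filtered_d_mono_elt, force)
      show ?thesis unfolding i by (rule filteredD[OF filtered_mul_e[OF filtered_mono[OF f le]] \<mu>])
    qed
    then show ?thesis
      by (subst d_finite_support[OF series_part_in_alg[OF x(1)] series_part_finite_support[OF x(1)]])
        (auto intro!: sum.neutral)
  qed
  then show ?thesis unfolding filtered_def by (auto simp: d_sum_parts[OF x(1)])
qed

lemma weight0_part_d:
  assumes x: "x \<in> \<A>"
  shows "weight0_part (d x) = weight0_part (d (weight0_part x))"
proof -
  have w: "weight0_part x \<in> \<A>" unfolding weight0_part_def by (rule sft_carrier_restrict[OF x])
  have "filtered 1 (d (\<lambda>\<mu> B. x \<mu> B - weight0_part x \<mu> B))"
    by (intro filtered_d sft_carrier_diff x w) (simp add: filtered_def weight0_part_def)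
  then show ?thesis
    unfolding d_diff[OF x w] by (auto simp: filtered_def weight0_part_def fun_eq_iff)
qed

section \<open>The contracting homotopy and its iteration\<close>

definition parity_part :: "nat \<Rightarrow> 'a series \<Rightarrow> 'a series" where
  "parity_part \<epsilon> x = (\<lambda>\<mu> B. if mono_parity D \<mu> = \<epsilon> then x \<mu> B else 0)"

lemma parity_parts_sum: "parity_part 0 x \<mu> B + parity_part 1 x \<mu> B = x \<mu> B"
proof -
  obtain K I J g where \<mu>: "\<mu> = (K, I, J, g)" by (cases \<mu>)
  have "mono_parity D \<mu> = 0 \<or> mono_parity D \<mu> = 1" unfolding \<mu> by auto
  then show ?thesis by (auto simp: parity_part_def)
qed

text \<open>If \<open>y\<close> is a primitive of \<open>1\<close> up to terms of positive weight, then \<open>x \<mapsto> y x\<close> is a contracting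
  homotopy on closed elements up to terms of higher weight.  The summands of both parities satisfy the
  Leibniz rule with different signs, which does not matter as \<open>d x = 0\<close>.\<close>

lemma homotopy_step:
  assumes y: "y \<in> sft_carrier D CH False" and dy: "weight0_part (d y) = one_elt D"
    and x: "x \<in> \<A>" "filtered n x" and dx: "d x = (\<lambda>\<mu> B. 0)"
  obtains z where "z \<in> \<A>" "filtered n z" "filtered (Suc n) (\<lambda>\<mu> B. x \<mu> B - d z \<mu> B)"
proof -
  have p: "parity_part \<epsilon> y \<in> sft_carrier D CH False" for \<epsilon>
    unfolding parity_part_def by (rule sft_carrier_restrict[OF y])
  then have pA: "parity_part \<epsilon> y \<in> \<A>" for \<epsilon> using sft_carrier_CH_subset by blast
  have par: "has_parity D \<epsilon> (parity_part \<epsilon> y)" for \<epsilon>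
    by (simp add: has_parity_def parity_part_def del: split_paired_All)
  define z where "z = (\<lambda>\<mu> B. (parity_part 0 y \<odot> x) \<mu> B + (parity_part 1 y \<odot> x) \<mu> B)"
  have m: "parity_part \<epsilon> y \<odot> x \<in> \<A>" for \<epsilon> by (rule sft_mult_CH_in_carrier[OF G p x(1)])
  have f: "filtered n (parity_part \<epsilon> y \<odot> x)" for \<epsilon> using filtered_sft_mult[OF filtered_0 x(2)] by simp
  have dp: "d (parity_part \<epsilon> y \<odot> x) = d (parity_part \<epsilon> y) \<odot> x" for \<epsilon>
    by (simp add: leibniz[OF pA x(1) par] dx sft_mult_0_right)
  have dz: "d z = (\<lambda>\<mu> B. (d (parity_part 0 y) \<odot> x) \<mu> B + (d (parity_part 1 y) \<odot> x) \<mu> B)"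
    unfolding z_def by (simp only: d_add[OF m m] dp)
  have sum: "d (parity_part 0 y) \<mu> A + d (parity_part 1 y) \<mu> A = d y \<mu> A" for \<mu> A
  proof -
    have "d (\<lambda>\<mu> B. parity_part 0 y \<mu> B + parity_part 1 y \<mu> B) = d y" by (simp only: parity_parts_sum)
    then show ?thesis unfolding d_add[OF pA pA] by (rule fun_cong[OF fun_cong])
  qed
  have low: "x \<mu> B - d z \<mu> B = 0" if \<mu>: "weight \<mu> < Suc n" for \<mu> B
  proof -
    \<comment> \<open>One index set for both parities, so that the two sums combine into one with
      the coefficients of \<open>d y\<close>. The pair of the unit is inserted so that this sum
      certainly contains the only term that will survive.\<close>
    define S where "S = insert (0, \<one>\<^bsub>QH D\<^esub>) ({(I, A). d (parity_part 0 y) (0, I, 0, 0) A \<noteq> 0} \<union> {(I, A). d (parity_part 1 y) (0, I, 0, 0) A \<noteq> 0})"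
    have S: "finite S" using sft_carrierD(4)[OF d_closed[OF pA]] by (simp add: S_def)
    let ?h = "\<lambda>I A. mul_e D A (mul_mono D (kind = SFT) (0, I, 0, 0) x) \<mu> B"
    have "(d (parity_part \<epsilon> y) \<odot> x) \<mu> B = (\<Sum>(I, A)\<in>S. d (parity_part \<epsilon> y) (0, I, 0, 0) A * ?h I A)"
      if "\<epsilon> = 0 \<or> \<epsilon> = 1" for \<epsilon>
      using that \<mu> by (intro sft_mult_low_weight[OF x(2) _ S]) (auto simp: S_def)
    then have "d z \<mu> B = (\<Sum>(I, A)\<in>S. d (parity_part 0 y) (0, I, 0, 0) A * ?h I A) + (\<Sum>(I, A)\<in>S. d (parity_part 1 y) (0, I, 0, 0) A * ?h I A)"
      by (simp add: dz)
    also have "\<dots> = (\<Sum>(I, A)\<in>S. d y (0, I, 0, 0) A * ?h I A)"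
      by (simp only: sum.distrib[symmetric] case_prod_unfold distrib_right[symmetric] sum)
    also have "\<dots> = (\<Sum>i\<in>S. if i = (0, \<one>\<^bsub>QH D\<^esub>) then x \<mu> B else 0)"
    proof (intro sum.cong refl, clarify)
      fix I A
      have "d y (0, I, 0, 0) A = one_elt D (0, I, 0, 0) A"
        unfolding dy[symmetric] by (simp add: weight0_part_def)
      moreover have "?h 0 \<one>\<^bsub>QH D\<^esub> = x \<mu> B"
        using mul_e_one_alg[OF x(1)] by simp
      ultimately show "d y (0, I, 0, 0) A * ?h I A = (if (I, A) = (0, \<one>\<^bsub>QH D\<^esub>) then x \<mu> B else 0)"
        by (auto simp: mono_elt_def simp del: mul_mono.simps)
    qed
    also have "\<dots> = x \<mu> B" using S by (simp add: sum.delta) (simp add: S_def)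
    finally show ?thesis by simp
  qed
  show ?thesis
  proof (rule that[of z])
    show "z \<in> \<A>" unfolding z_def by (intro sft_carrier_add m)
    show "filtered n z" using f by (simp add: z_def filtered_def)
    show "filtered (Suc n) (\<lambda>\<mu> B. x \<mu> B - d z \<mu> B)" using low by (simp add: filtered_def)
  qed
qed

text \<open>Every correction leaves a closed remainder of higher filtration. The corrections
  themselves have increasing filtration, so each coefficient of their infinite sum involves only
  finitely many of them.\<close>

lemma homology_vanishes_if_primitive:
  assumes y: "y \<in> sft_carrier D CH False" and dy: "weight0_part (d y) = one_elt D"
  shows "homology_vanishes D kind marked d"
  unfolding homology_vanishes_def
proof (intro ballI impI)
  fix x assume x: "x \<in> \<A>" "d x = (\<lambda>\<mu> B. 0)"
  let ?ok = "\<lambda>n x z. z \<in> \<A> \<and> filtered n z \<and> filtered (Suc n) (\<lambda>\<mu> B. x \<mu> B - d z \<mu> B)"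
  define Z where "Z n x = (SOME z. ?ok n x z)" for n x
  have Z: "?ok n x (Z n x)" if "x \<in> \<A>" "filtered n x" "d x = (\<lambda>\<mu> B. 0)" for n x
  proof -
    from homotopy_step[OF y dy that] obtain z where "?ok n x z" by blast
    then show ?thesis unfolding Z_def by (rule someI[where P = "?ok n x"])
  qed
  define X where "X = rec_nat x (\<lambda>n x. (\<lambda>\<mu> B. x \<mu> B - d (Z n x) \<mu> B))"
  have X0: "X 0 = x" and XS: "X (Suc n) = (\<lambda>\<mu> B. X n \<mu> B - d (Z n (X n)) \<mu> B)" for n
    by (simp_all add: X_def)
  have X: "X n \<in> \<A> \<and> filtered n (X n) \<and> d (X n) = (\<lambda>\<mu> B. 0)" for n
  proof (induction n)
    case 0
    then show ?case using x by (simp add: X0)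
  next
    case (Suc n)
    then have z: "?ok n (X n) (Z n (X n))" using Z by blast
    then show ?case
      unfolding XS using Suc by (auto simp: d_diff d_closed d_square intro!: sft_carrier_diff)
  qed
  define z where "z n = Z n (X n)" for n
  have z: "z n \<in> \<A>" "filtered n (z n)" for n using Z[of "X n" n] X[of n] by (auto simp: z_def)
  have partial: "d (\<lambda>\<mu> B. \<Sum>i<n. z i \<mu> B) = (\<lambda>\<mu> B. x \<mu> B - X n \<mu> B)" for n
  proof -
    have "(\<Sum>i<n. d (z i) \<mu> B) = x \<mu> B - X n \<mu> B" for \<mu> B
      by (induction n) (simp_all add: X0 XS z_def)
    then show ?thesis using d_sum[of "{..<n}" z] z by simp
  qed
  \<comment> \<open>The sum of all \<open>z i\<close>, cut off separately at each coefficient: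
    beyond the weight of the monomial \<open>z i\<close> has no coefficient there. Fixed exponents
    of t, p and \<hbar> fix the weight, so the required finiteness of supports reduces to finitely
    many \<open>z i\<close>.\<close>
  define s where "s = (\<lambda>\<mu> B. \<Sum>i\<le>weight \<mu>. z i \<mu> B)"
  have s_nz: "\<exists>i\<le>weight \<mu>. z i \<mu> A \<noteq> 0" if "s \<mu> A \<noteq> 0" for \<mu> A
  proof (rule ccontr)
    assume "\<not> ?thesis"
    then have "s \<mu> A = 0" unfolding s_def by (intro sum.neutral) blast
    with that show False by simp
  qed
  have s: "s \<in> \<A>"
  proof (rule sft_carrierI)
    fix K I J g A assume "s (K, I, J, g) A \<noteq> 0"
    then obtain i where "z i (K, I, J, g) A \<noteq> 0" using s_nz by blast
    then show "valid_mono D (K, I, J, g) \<and> A \<in> carrier (QH D) \<and>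
        (kind \<noteq> SFT \<longrightarrow> g = 0) \<and> (kind = CH \<longrightarrow> J = 0) \<and> (\<not> marked \<longrightarrow> K = 0)"
      by (rule sft_carrier_support[OF z(1)])
  next
    fix K J g
    show "finite {(I, A). s (K, I, J, g) A \<noteq> 0}"
    proof (rule finite_subset)
      show "{(I, A). s (K, I, J, g) A \<noteq> 0} \<subseteq> (\<Union>i\<le>msize K + msize J + g. {(I, A). z i (K, I, J, g) A \<noteq> 0})"
        using s_nz[of "(K, _, J, g)"] by auto
    qed (use sft_carrierD(4)[OF z(1)] in auto)
  qed
  have "d s \<mu> B = x \<mu> B" for \<mu> B
  proof -
    \<comment> \<open>One more than the weight of the monomial: \<open>s\<close> and the partial sum
      agree below weight \<open>n\<close>, hence so do their differentials by
      \<open>filtered_d\<close>, and \<open>d\<close> is never exchanged with an infinite sum. The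
      remainder \<open>X n\<close> vanishes at this monomial for the same reason.\<close>
    define n where "n = Suc (weight \<mu>)"
    let ?p = "\<lambda>\<mu> B. \<Sum>i<n. z i \<mu> B"
    have p: "?p \<in> \<A>" by (intro sft_carrier_sum z)
    have "filtered n (\<lambda>\<mu> B. s \<mu> B - ?p \<mu> B)"
      unfolding filtered_def
    proof (intro allI impI)
      fix \<nu> B assume \<nu>: "weight \<nu> < n"
      have "(\<Sum>i\<le>weight \<nu>. z i \<nu> B) = ?p \<nu> B"
        by (rule sum.mono_neutral_left) (use \<nu> filteredD[OF z(2)] in auto)
      then show "s \<nu> B - ?p \<nu> B = 0" by (simp add: s_def)
    qed
    then have "filtered n (\<lambda>\<mu> B. d s \<mu> B - d ?p \<mu> B)"
      unfolding d_diff[OF s p, symmetric] by (rule filtered_d[OF sft_carrier_diff[OF s p]])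
    from filteredD[OF this, of \<mu> B] have "d s \<mu> B - d ?p \<mu> B = 0" by (simp only: n_def lessI)
    then have "d s \<mu> B = d ?p \<mu> B" by (simp only: right_minus_eq)
    also have "\<dots> = x \<mu> B - X n \<mu> B" by (simp only: partial)
    also have "\<dots> = x \<mu> B" using X[of n] filteredD[of n "X n" \<mu> B] by (simp add: n_def)
    finally show ?thesis .
  qed
  then show "\<exists>y\<in>\<A>. d y = x" using s by blast
qed

lemma primitive_if_homology_vanishes:
  assumes "homology_vanishes D kind marked d"
  obtains y where "y \<in> sft_carrier D CH False" "weight0_part (d y) = one_elt D"
proof -
  obtain y where y: "y \<in> \<A>" "d y = one_elt D"
    using assms one_in_alg d_one unfolding homology_vanishes_def by blast
  have "weight0_part (one_elt D) = one_elt D"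
    by (auto simp: weight0_part_def mono_elt_def fun_eq_iff)
  then show ?thesis
    using that[OF weight0_part_in_CH[OF y(1)]] weight0_part_d[OF y(1)] y(2) by simp
qed

end

text \<open>Together with \<open>weight0_part_d\<close> this makes setting p, t and \<hbar> to zero
  a chain map. The projection is multiplicative, so both sides obey the same Leibniz rule; they
  agree on the q's, and finite support extends this to all polynomials.\<close>

lemma weight0_part_differential:
  assumes "sft_dga D kind marked d" "sft_dga D CH False d0" "x \<in> sft_carrier D CH False"
  shows "weight0_part (d x) = d0 x"
proof -
  interpret A: sft_dga D kind marked d by (rule assms)
  interpret C: sft_dga D CH False d0 by (rule assms)
  note x = assms(3)
  have sub: "x \<in> sft_carrier D CH False \<Longrightarrow> x \<in> sft_carrier D kind marked" for x
    using sft_carrier_CH_subset by blast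
  have mono: "weight0_part (d (mono_elt D (0, I, 0, 0))) = d0 (mono_elt D (0, I, 0, 0))" if v: "valid_mono D (0, I, 0, 0)" for I
  proof -
    have "mono_elt D (0, I, 0, 0) \<in> sft_carrier D CH False \<and> weight0_part (d (mono_elt D (0, I, 0, 0))) = d0 (mono_elt D (0, I, 0, 0))"
    proof (rule mono_elt_induct[OF A.G v, where kind = CH and marked = False and
          P = "\<lambda>n x. x \<in> sft_carrier D CH False \<and> weight0_part (d x) = d0 x"])
      show "one_elt D \<in> sft_carrier D CH False \<and> weight0_part (d (one_elt D)) = d0 (one_elt D)"
        using C.one_in_alg by (simp add: A.d_one C.d_one weight0_part_def)
    next
      fix w n \<gamma> x assume \<gamma>: "generator D CH False w \<gamma>" and x: "x \<in> sft_carrier D CH False"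
        "x \<in> sft_carrier D CH False \<and> weight0_part (d x) = d0 x"
      obtain k where k: "k \<in> orbs D" "\<gamma> = q_elt D k" using \<gamma> by (auto simp: generator_def)
      have q: "q_elt D k \<in> sft_carrier D CH False" by (rule q_elt_in_carrier[OF A.G])
      obtain \<epsilon> where \<epsilon>: "has_parity D \<epsilon> (q_elt D k)" using generator_has_parity[OF \<gamma>] k by blast
      \<comment> \<open>Left multiplication by a q produces no commutator, so the two products
        coincide and the Leibniz rule of either algebra can be applied.\<close>
      have "sft_mult D CH \<gamma> x = sft_mult D kind \<gamma> x"
        unfolding k using C.off_carrier[OF x(1)] by (simp add: q_elt_mult[OF A.G k(1)])
      then have "weight0_part (d (sft_mult D CH \<gamma> x)) = weight0_part
          (\<lambda>\<mu> B. sft_mult D kind (d \<gamma>) x \<mu> B + (-1) ^ \<epsilon> * sft_mult D kind \<gamma> (d x) \<mu> B)"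
        unfolding k by (simp add: A.leibniz[OF sub[OF q] sub[OF x(1)] \<epsilon>])
      also have "\<dots> = (\<lambda>\<mu> B. weight0_part (sft_mult D kind (d \<gamma>) x) \<mu> B + (-1) ^ \<epsilon> * weight0_part (sft_mult D kind \<gamma> (d x)) \<mu> B)"
        by (auto simp: weight0_part_def fun_eq_iff)
      also have "\<dots> = (\<lambda>\<mu> B. sft_mult D CH (d0 \<gamma>) x \<mu> B + (-1) ^ \<epsilon> * sft_mult D CH \<gamma> (d0 x) \<mu> B)"
        using x(2) by (simp add: weight0_part_sft_mult weight0_part_CH[OF x(1)] weight0_part_CH[OF q] k(2)
            A.d_q[OF k(1)] C.d_q[OF k(1)] weight0_part_diff_gen)
      also have "\<dots> = d0 (sft_mult D CH \<gamma> x)"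
        unfolding k by (rule C.leibniz[OF q x(1) \<epsilon>, symmetric])
      finally show "sft_mult D CH \<gamma> x \<in> sft_carrier D CH False \<and> weight0_part (d (sft_mult D CH \<gamma> x)) = d0 (sft_mult D CH \<gamma> x)"
        unfolding k using sft_mult_CH_in_carrier[OF A.G q x(1)] by simp
    qed auto
    then show ?thesis by simp
  qed
  have fin: "finite {i. x (fst i) (snd i) \<noteq> 0}"
    using finite_support_CH[OF x] by (simp only: case_prod_unfold)
  have "mul_e D (snd i) (d0 (mono_elt D (fst i))) = weight0_part (mul_e D (snd i) (d (mono_elt D (fst i))))"
    if nz: "x (fst i) (snd i) \<noteq> 0" for i
  proof -
    obtain K I J g where i: "fst i = (K, I, J, g)" by (cases "fst i")
    have "K = 0" "J = 0" "g = 0" "valid_mono D (K, I, J, g)"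
      using sft_carrier_support[OF x, of K I J g "snd i"] nz unfolding i by blast+
    then show ?thesis unfolding i using mono[of I] by (simp add: mul_e_weight0_part del: valid_mono.simps)
  qed
  then have "d0 x = weight0_part (d x)"
    unfolding C.d_finite_support[OF x fin] A.d_finite_support[OF sub[OF x] fin]
    by (auto simp: weight0_part_def fun_eq_iff intro!: sum.cong)
  then show ?thesis by simp
qed

text \<open>In each algebra vanishing amounts to a polynomial \<open>y\<close> in the q's whose
  differential has weight 0 part 1, and by \<open>weight0_part_differential\<close> this condition
  is the same for \<open>d\<close> and \<open>d0\<close>. Contact homology is itself an instance of
  the locale, and there the weight 0 part is taken a second time, which changes nothing.\<close>

lemma homology_vanishes_iff_CH:
  assumes A: "sft_dga D kind marked d" and C: "sft_dga D CH False d0"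
  shows "homology_vanishes D CH False d0 \<longleftrightarrow> homology_vanishes D kind marked d"
proof
  assume "homology_vanishes D CH False d0"
  then obtain y where "y \<in> sft_carrier D CH False" "weight0_part (d0 y) = one_elt D"
    using sft_dga.primitive_if_homology_vanishes[OF C] by blast
  then show "homology_vanishes D kind marked d"
    using weight0_part_differential[OF A C] sft_dga.homology_vanishes_if_primitive[OF A]
    by (metis weight0_part_idem)
next
  assume "homology_vanishes D kind marked d"
  then obtain y where "y \<in> sft_carrier D CH False" "weight0_part (d y) = one_elt D"
    using sft_dga.primitive_if_homology_vanishes[OF A] by blast
  then show "homology_vanishes D CH False d0"
    using weight0_part_differential[OF A C] sft_dga.homology_vanishes_if_primitive[OF C]
    by (metis weight0_part_idem)
qed

theorem theorem1:
  fixes D :: "'a::euclidean_space sft_data"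
    and dCH dRSFT dSFT dCH' dRSFT' dSFT' :: "'a series \<Rightarrow> 'a series"
  assumes "contact_manifold D" and "reeb_field D" and "nondegenerate D"
    and "sft_choices D" and "transversality D"
    and "sft_differential D CH False dCH"
    and "sft_differential D RSFT False dRSFT"
    and "sft_differential D SFT False dSFT"
    and "sft_differential D CH True dCH'"
    and "sft_differential D RSFT True dRSFT'"
    and "sft_differential D SFT True dSFT'"
  shows "(homology_vanishes D CH False dCH \<longleftrightarrow> homology_vanishes D RSFT False dRSFT) \<and>
    (homology_vanishes D CH False dCH \<longleftrightarrow> homology_vanishes D SFT False dSFT) \<and>
    (homology_vanishes D CH False dCH \<longleftrightarrow> homology_vanishes D CH True dCH') \<and>
    (homology_vanishes D CH False dCH \<longleftrightarrow> homology_vanishes D RSFT True dRSFT') \<and>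
    (homology_vanishes D CH False dCH \<longleftrightarrow> homology_vanishes D SFT True dSFT')"
proof -
  have "compatible_acs D" and rels: "subgroup (rels D) (H2 D)"
    using assms(4) by (simp_all add: sft_choices_def coefficient_submodule_def)
  then have dga: "sft_dga D kind marked d" if "sft_differential D kind marked d" for kind marked d
    using that filtered_diff_gen_negative[OF assms(1,2) _ assms(5)] by (intro sft_dga.intro) auto
  show ?thesis
    using homology_vanishes_iff_CH[OF dga dga[OF assms(6)]] assms(7-11) by blast
qed

end
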